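(* Let $t\mapsto\rho_t$ be a weakly continuous curve $[0,1]\to\mathcal P^{ac}(\mathbb R^d)$ with associated measure $\boldsymbol\rho$ on $[0,1]\times\mathbb R^d$. Assume that $\boldsymbol\rho$ satisfies the partial Poincaré inequality for some $K>0$, and that $\frac1{\boldsymbol\rho}\in L_{1,\mathrm{loc}}([0,1]\times\mathbb R^d)$. Let $\alpha:[0,1]\times\mathbb R^d\to\mathbb R$ be measurable with $\alpha_t:=\alpha(t,\cdot)\in L_2(\mathbb R^d,\rho_t)$, put $\overline{\alpha_t}:=\mathbb E_{\rho_t}[\alpha_t]=\int_{\mathbb R^d}\alpha_t\,\mathrm d\rho_t$, and suppose that the function $(t,x)\mapsto\alpha_t(x)-\overline{\alpha_t}$ belongs to $L_2([0,1]\times\mathbb R^d,\boldsymbol\rho)$. Then there exists a unique $\boldsymbol s\in\mathcal X_0^1$ such that $$\int_0^1\int_{\mathbb R^d}\langle\nabla_x\boldsymbol s_t,\nabla_x\psi_t\rangle\,\mathrm d\rho_t\,\mathrm dt=\int_0^1\int_{\mathbb R^d}\psi_t\,(\alpha_t-\overline{\alpha_t})\,\mathrm d\rho_t\,\mathrm dt\qquad\text{for all }\psi\in\mathcal X_0^1.$$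
   Context: $\mathcal P^{ac}(\mathbb R^d)$ is the set of Borel probability measures on $\mathbb R^d$ absolutely continuous with respect to Lebesgue measure; such measures are identified with their densities. A curve $t\mapsto\rho_t$ is weakly continuous if $t\mapsto\int g\,\mathrm d\rho_t$ is continuous for every bounded continuous $g:\mathbb R^d\to\mathbb R$. Given such a curve $[0,1]\to\mathcal P^{ac}(\mathbb R^d)$, $\boldsymbol\rho$ is the probability measure on $[0,1]\times\mathbb R^d$ determined by $\int f\,\mathrm d\boldsymbol\rho=\int_0^1\int_{\mathbb R^d}f(t,x)\,\mathrm d\rho_t(x)\,\mathrm dt$; it is absolutely continuous and its density (with value $\rho_t(x)$ at $(t,x)$) is also denoted $\boldsymbol\rho$. For $\rho\in\mathcal P^{ac}(\mathbb R^d)$: $H^1(\rho)$ is the space of $f\in L_2(\mathbb R^d,\rho)$ whose weak partial derivatives $\partial_{x_i}f$ (with respect to Lebesgue measure) exist and lie in $L_2(\rho)$ for $i=1,\dots,d$; $H^1_0(\rho):=\{f\in H^1(\rho):\int f\,\mathrm d\rho=0\}$ (zero mean). $H^1_x(\boldsymbol\rho)$ is the space of $f=f(t,x)\in L_2([0,1]\times\mathbb R^d,\boldsymbol\rho)$ whose weak derivatives (with respect to Lebesgue measure) in each of the $d$ spatial directions $x_i$ exist and lie in $L_2(\boldsymbol\rho)$; $\nabla_x$ is the weak gradient in $x$. The space $\mathcal X_0^1$ is $$\mathcal X_0^1:=\{s\in H^1_x(\boldsymbol\rho): s(t,\cdot)\in H^1_0(\rho_t)\text{ for a.e. }t\in[0,1]\},$$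 with bilinear form $\langle f,g\rangle_{\mathcal X_0^1}:=\langle\nabla_xf,\nabla_xg\rangle_{L_2(\boldsymbol\rho)}$; for $s\in\mathcal X_0^1$ write $s_t:=s(t,\cdot)$. $\boldsymbol\rho$ satisfies the partial Poincaré inequality with constant $K>0$ if $\|g\|^2_{L_2(\boldsymbol\rho)}\le K\|\nabla_xg\|^2_{L_2(\boldsymbol\rho)}$ for all $g\in\mathcal X_0^1$. *)

theory Defs
  imports "HOL-Probability.Probability"
begin

text \<open>Elements of \<open>L2 M\<close> are measurable functions and not equivalence classes; statements about
  the quotient space are formulated up to equality almost everywhere.\<close>

definition L2 :: "'x measure \<Rightarrow> ('x \<Rightarrow> 'b::euclidean_space) set" where
  "L2 M = {f. f \<in> borel_measurable M \<and> integrable M (\<lambda>x. (norm (f x))\<^sup>2)}"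

definition L2_norm :: "'x measure \<Rightarrow> ('x \<Rightarrow> 'b::euclidean_space) \<Rightarrow> real" where
  "L2_norm M f = sqrt (\<integral>x. (norm (f x))\<^sup>2 \<partial>M)"

primrec C_k :: "nat \<Rightarrow> ('b::euclidean_space \<Rightarrow> real) \<Rightarrow> bool" where
  "C_k 0 f \<longleftrightarrow> continuous_on UNIV f"
| "C_k (Suc k) f \<longleftrightarrow> (\<forall>x. f differentiable at x) \<and>
     (\<forall>b\<in>Basis. C_k k (\<lambda>x. frechet_derivative f (at x) b))"

definition test_functions :: "'b::euclidean_space set \<Rightarrow> ('b \<Rightarrow> real) set" where
  "test_functions U = {\<phi>. (\<forall>k. C_k k \<phi>) \<and>
     compact (closure {x. \<phi> x \<noteq> 0}) \<and> closure {x. \<phi> x \<noteq> 0} \<subseteq> U}"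

definition locally_integrable_on :: "('b::euclidean_space \<Rightarrow> real) \<Rightarrow> 'b set \<Rightarrow> bool" where
  "locally_integrable_on f U \<longleftrightarrow> (\<forall>C. compact C \<longrightarrow> C \<subseteq> U \<longrightarrow> set_integrable lborel C f)"

text \<open>Weak derivative of \<open>f\<close> in direction \<open>v\<close>, with respect to Lebesgue measure; \<open>U\<close> is meant to be open.\<close>

definition has_weak_derivative ::
  "('b::euclidean_space \<Rightarrow> real) \<Rightarrow> ('b \<Rightarrow> real) \<Rightarrow> 'b \<Rightarrow> 'b set \<Rightarrow> bool" where
  "has_weak_derivative f g v U \<longleftrightarrow>
     locally_integrable_on f U \<and> locally_integrable_on g U \<and>
     (\<forall>\<phi>\<in>test_functions U.
        (LINT x:U|lborel. f x * frechet_derivative \<phi> (at x) v) = - (LINT x:U|lborel. g x * \<phi> x))"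

text \<open>If a weak derivative exists, the chosen representative is determined almost everywhere on
  \<open>U\<close>. Choosing a Borel function matters because \<open>has_weak_derivative\<close> does not constrain \<open>g\<close>
  outside \<open>U\<close>; below \<open>U\<close> is an open strip and integrals extend over the closed strip.\<close>

definition weak_derivative ::
  "('b::euclidean_space \<Rightarrow> real) \<Rightarrow> 'b \<Rightarrow> 'b set \<Rightarrow> 'b \<Rightarrow> real" where
  "weak_derivative f v U = (SOME g. g \<in> borel_measurable borel \<and> has_weak_derivative f g v U)"

definition P_ac :: "'a::euclidean_space measure set" where
  "P_ac = {\<mu>. prob_space \<mu> \<and> sets \<mu> = sets borel \<and> absolutely_continuous lborel \<mu>}"

definition weakly_continuous_curve :: "(real \<Rightarrow> 'a::euclidean_space measure) \<Rightarrow> bool" where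
  "weakly_continuous_curve \<rho> \<longleftrightarrow>
     (\<forall>g :: 'a \<Rightarrow> real. continuous_on UNIV g \<longrightarrow> bounded (range g) \<longrightarrow>
        continuous_on {0..1} (\<lambda>t. \<integral>x. g x \<partial>\<rho> t))"

abbreviation strip :: "(real \<times> 'a::euclidean_space) set" where
  "strip \<equiv> {0..1} \<times> UNIV"

abbreviation open_strip :: "(real \<times> 'a::euclidean_space) set" where
  "open_strip \<equiv> {0<..<1} \<times> UNIV"

text \<open>The measure on \<open>[0,1] \<times> \<real>\<^sup>d\<close> that integrates \<open>f\<close> to
  \<open>\<integral>\<^sub>0\<^sup>1 \<integral> f(t,x) d\<rho>\<^sub>t(x) dt\<close>, specified on Borel sets. For a weakly continuous curve
  \<open>t \<mapsto> \<rho>\<^sub>t(B)\<close> is Borel for each Borel \<open>B\<close>, so the set function is countably additive.\<close>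

definition spacetime :: "(real \<Rightarrow> 'a::euclidean_space measure) \<Rightarrow> (real \<times> 'a) measure" where
  "spacetime \<rho> = measure_of strip (sets (restrict_space borel strip))
     (\<lambda>A. \<integral>\<^sup>+t\<in>{0..1}. emeasure (\<rho> t) {x. (t, x) \<in> A} \<partial>lborel)"

definition spacetime_density :: "(real \<Rightarrow> 'a::euclidean_space measure) \<Rightarrow> real \<times> 'a \<Rightarrow> ennreal" where
  "spacetime_density \<rho> = RN_deriv (restrict_space lborel strip) (spacetime \<rho>)"

text \<open>Local integrability of \<open>1/\<rho>\<close> on the closed strip. In \<^typ>\<open>ennreal\<close>, \<open>inverse 0 = \<infinity>\<close>, so
  the density must be positive Lebesgue-almost everywhere.\<close>

definition reciprocal_density_L1_loc :: "(real \<Rightarrow> 'a::euclidean_space measure) \<Rightarrow> bool" where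
  "reciprocal_density_L1_loc \<rho> \<longleftrightarrow> (\<forall>C. compact C \<longrightarrow> C \<subseteq> strip \<longrightarrow>
     (\<integral>\<^sup>+z\<in>C. inverse (spacetime_density \<rho> z) \<partial>restrict_space lborel strip) < \<infinity>)"

definition H1 :: "'a::euclidean_space measure \<Rightarrow> ('a \<Rightarrow> real) set" where
  "H1 \<mu> = {f \<in> L2 \<mu>. \<forall>b\<in>Basis. \<exists>g\<in>L2 \<mu>. has_weak_derivative f g b UNIV}"

definition H1_0 :: "'a::euclidean_space measure \<Rightarrow> ('a \<Rightarrow> real) set" where
  "H1_0 \<mu> = {f \<in> H1 \<mu>. (\<integral>x. f x \<partial>\<mu>) = 0}"

definition H1_x :: "(real \<Rightarrow> 'a::euclidean_space measure) \<Rightarrow> (real \<times> 'a \<Rightarrow> real) set" where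
  "H1_x \<rho> = {f \<in> L2 (spacetime \<rho>).
     \<forall>b\<in>Basis. \<exists>g\<in>L2 (spacetime \<rho>). has_weak_derivative f g (0, b) open_strip}"

definition grad_x :: "(real \<times> 'a::euclidean_space \<Rightarrow> real) \<Rightarrow> real \<times> 'a \<Rightarrow> 'a" where
  "grad_x f z = (\<Sum>b\<in>Basis. weak_derivative f (0, b) open_strip z *\<^sub>R b)"

definition X_0_1 :: "(real \<Rightarrow> 'a::euclidean_space measure) \<Rightarrow> (real \<times> 'a \<Rightarrow> real) set" where
  "X_0_1 \<rho> = {s \<in> H1_x \<rho>. AE t in lborel. t \<in> {0..1} \<longrightarrow> (\<lambda>x. s (t, x)) \<in> H1_0 (\<rho> t)}"

definition partial_Poincare :: "(real \<Rightarrow> 'a::euclidean_space measure) \<Rightarrow> real \<Rightarrow> bool" where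
  "partial_Poincare \<rho> K \<longleftrightarrow> (\<forall>g\<in>X_0_1 \<rho>.
     (L2_norm (spacetime \<rho>) g)\<^sup>2 \<le> K * (L2_norm (spacetime \<rho>) (grad_x g))\<^sup>2)"

definition slice_mean ::
  "(real \<Rightarrow> 'a::euclidean_space measure) \<Rightarrow> (real \<times> 'a \<Rightarrow> real) \<Rightarrow> real \<Rightarrow> real" where
  "slice_mean \<rho> \<alpha> t = (\<integral>x. \<alpha> (t, x) \<partial>\<rho> t)"

definition weak_solution ::
  "(real \<Rightarrow> 'a::euclidean_space measure) \<Rightarrow> (real \<times> 'a \<Rightarrow> real) \<Rightarrow> (real \<times> 'a \<Rightarrow> real) \<Rightarrow> bool" where
  "weak_solution \<rho> \<alpha> s \<longleftrightarrow> (\<forall>\<psi>\<in>X_0_1 \<rho>.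
     (LBINT t:{0..1}. (\<integral>x. grad_x s (t, x) \<bullet> grad_x \<psi> (t, x) \<partial>\<rho> t)) =
     (LBINT t:{0..1}. (\<integral>x. \<psi> (t, x) * (\<alpha> (t, x) - slice_mean \<rho> \<alpha> t) \<partial>\<rho> t)))"

end

theory Submission
  imports Defs
begin

text \<open>The energy form \<open>\<langle>\<nabla>\<^sub>x f, \<nabla>\<^sub>x g\<rangle>\<close> makes \<open>X_0_1 \<rho>\<close> a Hilbert space, up to equality almost
  everywhere, and by the partial Poincare inequality the right-hand side of the weak equation is a
  bounded functional on it, so the claim is the Riesz representation theorem. Completeness is the
  main point: the Poincare inequality and completeness of \<open>L2\<close> give limits of a Cauchy sequence and
  of its weak derivatives in \<open>L2 (spacetime \<rho>)\<close>, and local integrability of \<open>1 / \<rho>\<close> turns this into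
  local \<open>L1\<close> convergence, under which weak derivatives pass to the limit. That almost every time
  slice of the limit lies in \<open>H1 (\<rho> t)\<close> follows by testing with products \<open>\<eta> t * \<phi> x\<close>, where \<open>\<phi>\<close>
  ranges over a countable dense set of test functions.\<close>

section \<open>Smooth functions\<close>

text \<open>Two measures compete. Weak derivatives are tested against Lebesgue measure, while norms
  and means refer to \<open>spacetime \<rho>\<close>, whose density may come close to zero. Absolute
  continuity carries null sets from the first to the second. The way back is the pointwise
  inequality |f| <= c * r * f^2 + 1 / (c * r) with r the density at the point: integrated over a
  compact set, it bounds an L1 norm by c times a squared L2 norm plus a constant over c, and c is
  free. The slice condition in \<open>X_0_1\<close> does not look closed under L2 limits. It is,
  because slices of an element of \<open>H1_x\<close> are in \<open>H1 (\<rho> t)\<close> for almost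
  every t anyway, so that only the vanishing of the means is left, and means are controlled by the
  L2 norm. The difficulty hidden in that claim is that each test function in x brings its own null
  set of times. Elements of the spaces are functions, so the energy form is only semidefinite. The
  representation theorem is therefore proved for a nonnegative symmetric form on a set of functions,
  without passing to a quotient. Weak continuity of the curve provides the measurability in t that
  turns the slices into a kernel.\<close>

lemma C_k_Suc_imp: "C_k (Suc k) f \<Longrightarrow> C_k k f"
proof (induction k arbitrary: f)
  case 0
  then show ?case
    by (auto intro!: continuous_at_imp_continuous_on differentiable_imp_continuous_within)
next
  case (Suc k)
  then show ?case by simp
qed

lemma C_k_const: "C_k k (\<lambda>x. c)"
  by (induction k arbitrary: c) (auto simp: frechet_derivative_const)

lemma frechet_derivative_eqI: "(f has_derivative f') (at x) \<Longrightarrow> frechet_derivative f (at x) = f'"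
  using frechet_derivative_at by metis

lemma C_k_add:
  assumes "C_k k f" "C_k k g"
  shows "C_k k (\<lambda>x. f x + g x)"
  using assms
proof (induction k arbitrary: f g)
  case 0
  then show ?case by (auto intro: continuous_on_add)
next
  case (Suc k)
  have "((\<lambda>x. f x + g x) has_derivative
      (\<lambda>h. frechet_derivative f (at x) h + frechet_derivative g (at x) h)) (at x)" for x
    using Suc.prems by (auto intro!: has_derivative_add simp: frechet_derivative_works[symmetric])
  note d = this frechet_derivative_eqI[OF this]
  show ?case
    using Suc d(1) by (auto simp: d(2) intro: differentiableI)
qed

lemma C_k_mult:
  assumes "C_k k f" "C_k k g"
  shows "C_k k (\<lambda>x. f x * g x)"
  using assms
proof (induction k arbitrary: f g)
  case 0
  then show ?case by (auto intro: continuous_on_mult)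
next
  case (Suc k)
  have "((\<lambda>x. f x * g x) has_derivative
      (\<lambda>h. f x * frechet_derivative g (at x) h + frechet_derivative f (at x) h * g x)) (at x)" for x
    using Suc.prems by (auto intro!: has_derivative_mult simp: frechet_derivative_works[symmetric])
  note d = this frechet_derivative_eqI[OF this]
  have "C_k k f" "C_k k g"
    using Suc.prems C_k_Suc_imp by blast+
  then show ?case
    using Suc d(1) by (auto simp: d(2) intro!: C_k_add differentiableI)
qed

lemma C_k_sum:
  assumes "finite I" "\<And>i. i \<in> I \<Longrightarrow> C_k k (f i)"
  shows "C_k k (\<lambda>x. \<Sum>i\<in>I. f i x)"
  using assms by (induction I rule: finite_induct) (auto intro: C_k_const C_k_add)

lemma C_k_prod:
  assumes "finite I" "\<And>i. i \<in> I \<Longrightarrow> C_k k (f i)"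
  shows "C_k k (\<lambda>x. \<Prod>i\<in>I. f i x)"
  using assms by (induction I rule: finite_induct) (auto intro: C_k_const C_k_mult)

lemma has_derivative_compose_affine:
  assumes "f differentiable at (L x + c)" "bounded_linear L"
  shows "((\<lambda>x. f (L x + c)) has_derivative (\<lambda>h. frechet_derivative f (at (L x + c)) (L h))) (at x)"
proof -
  have "((\<lambda>x. L x + c) has_derivative L) (at x)"
    using assms(2) by (auto intro!: derivative_eq_intros bounded_linear_imp_has_derivative)
  then show ?thesis
    using assms(1) by (auto intro: has_derivative_compose simp: frechet_derivative_works)
qed

lemma C_k_compose_affine:
  fixes f :: "'b::euclidean_space \<Rightarrow> real" and L :: "'c::euclidean_space \<Rightarrow> 'b"
  assumes "C_k k f" "bounded_linear L"
  shows "C_k k (\<lambda>x. f (L x + c))"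
  using assms(1)
proof (induction k arbitrary: f)
  case 0
  then have f: "continuous_on UNIV f" by simp
  have "continuous_on UNIV (\<lambda>x. L x + c)"
    by (intro continuous_on_add linear_continuous_on assms(2) continuous_on_const)
  then show ?case
    using continuous_on_compose2[OF f] by simp
next
  case (Suc k)
  have df: "f differentiable at (L x + c)" for x
    using Suc.prems by simp
  note d = has_derivative_compose_affine[OF df assms(2)]
  \<comment> \<open>\<open>C_k\<close> speaks of basis directions only, while the chain rule
    produces the direction \<open>L b\<close>. Linearity of the derivative expands it into basis
    directions, where the induction hypothesis applies.\<close>
  have rep: "frechet_derivative f (at y) h =
      (\<Sum>i\<in>Basis. (h \<bullet> i) * frechet_derivative f (at y) i)" for y h
  proof -
    interpret l: linear "frechet_derivative f (at y)"
      using Suc.prems by (auto intro: linear_frechet_derivative)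
    have "frechet_derivative f (at y) (\<Sum>i\<in>Basis. (h \<bullet> i) *\<^sub>R i) =
      (\<Sum>i\<in>Basis. (h \<bullet> i) * frechet_derivative f (at y) i)"
      unfolding l.sum l.scaleR by simp
    then show ?thesis by (simp add: euclidean_representation)
  qed
  have "frechet_derivative (\<lambda>x. f (L x + c)) (at x) b =
      (\<Sum>i\<in>Basis. (L b \<bullet> i) * frechet_derivative f (at (L x + c)) i)" for x b
    unfolding frechet_derivative_eqI[OF d] by (rule rep)
  moreover have "C_k k (\<lambda>x. \<Sum>i\<in>Basis. (L b \<bullet> i) * frechet_derivative f (at (L x + c)) i)" for b
  proof (intro C_k_sum[OF finite_Basis])
    fix i :: 'b assume "i \<in> Basis"
    then have "C_k k (\<lambda>x. frechet_derivative f (at (L x + c)) i)"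
      using Suc.prems by (intro Suc.IH[of "\<lambda>y. frechet_derivative f (at y) i"]) simp
    then show "C_k k (\<lambda>x. (L b \<bullet> i) * frechet_derivative f (at (L x + c)) i)"
      by (rule C_k_mult[OF C_k_const])
  qed
  ultimately show ?case
    by (auto intro: differentiableI[OF d])
qed

text \<open>\<open>flat_exp 0\<close> is the classical smooth function that is flat at
  \<open>0\<close>. The index \<open>n\<close> makes the family closed under differentiation up to
  linear combinations, so one induction proves all members smooth.\<close>

definition flat_exp :: "nat \<Rightarrow> real \<Rightarrow> real" where
  "flat_exp n x = (if x > 0 then exp (- (1 / x)) / x ^ n else 0)"

text \<open>The substitution u = 1 / x turns this into the exponential beating a power at
  infinity.\<close>

lemma flat_exp_tendsto_0: "(flat_exp n \<longlongrightarrow> 0) (at_right 0)"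
proof -
  have "((\<lambda>u::real. u ^ n / exp u) \<longlongrightarrow> 0) at_top"
    by (rule tendsto_power_div_exp_0)
  then have "((\<lambda>x::real. inverse x ^ n / exp (inverse x)) \<longlongrightarrow> 0) (at_right 0)"
    by (rule filterlim_compose) (rule filterlim_inverse_at_top_right)
  moreover have "\<forall>\<^sub>F x in at_right 0. inverse x ^ n / exp (inverse x) = flat_exp n x"
    by (rule eventually_at_rightI[of 0 1])
       (auto simp: flat_exp_def exp_minus field_simps power_one_over)
  ultimately show ?thesis
    using tendsto_cong by force
qed

lemma flat_exp_has_derivative:
  "(flat_exp n has_real_derivative flat_exp (n + 2) x - of_nat n * flat_exp (n + 1) x) (at x)"
proof (cases x "0::real" rule: linorder_cases)
  case less
  have "(flat_exp n has_real_derivative 0) (at x)"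
    by (rule has_field_derivative_transform_within_open[of "\<lambda>_. 0" _ _ "{..<0}"])
       (use less in \<open>auto simp: flat_exp_def\<close>)
  then show ?thesis using less by (simp add: flat_exp_def)
next
  case greater
  have "((\<lambda>x. exp (- (1 / x)) / x ^ n) has_real_derivative
      flat_exp (n + 2) x - of_nat n * flat_exp (n + 1) x) (at x)"
    using greater
    by (auto intro!: derivative_eq_intros simp: flat_exp_def field_simps power2_eq_square)
       (cases n; simp add: field_simps)
  then show ?thesis
    by (rule has_field_derivative_transform_within_open[of _ _ _ "{0<..}"])
       (use greater in \<open>auto simp: flat_exp_def\<close>)
next
  case equal
  have "((\<lambda>y. (flat_exp n y - flat_exp n 0) / (y - 0)) \<longlongrightarrow> 0) (at 0)"
  proof (subst filterlim_at_split, intro conjI)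
    show "((\<lambda>y. (flat_exp n y - flat_exp n 0) / (y - 0)) \<longlongrightarrow> 0) (at_left 0)"
      by (rule tendsto_eventually) (auto simp: flat_exp_def intro!: eventually_at_leftI[of "-1"])
    \<comment> \<open>To the right of \<open>0\<close> the difference quotient is itself a member of
      the family, so the limit is already known.\<close>
    have "\<forall>\<^sub>F y in at_right 0. flat_exp (n + 1) y = (flat_exp n y - flat_exp n 0) / (y - 0)"
      by (rule eventually_at_rightI[of 0 1]) (auto simp: flat_exp_def)
    then show "((\<lambda>y. (flat_exp n y - flat_exp n 0) / (y - 0)) \<longlongrightarrow> 0) (at_right 0)"
      using flat_exp_tendsto_0[of "n + 1"] tendsto_cong by force
  qed
  then show ?thesis
    using equal by (simp add: has_field_derivative_iff flat_exp_def)
qed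

lemma C_k_flat_exp: "C_k k (flat_exp n)"
proof (induction k arbitrary: n)
  case 0
  show ?case
    using flat_exp_has_derivative by (auto intro!: continuous_at_imp_continuous_on DERIV_isCont)
next
  case (Suc k)
  have "frechet_derivative (flat_exp n) (at x) 1 =
      flat_exp (n + 2) x + (- of_nat n) * flat_exp (n + 1) x" for x
    using frechet_derivative_eqI[OF flat_exp_has_derivative[unfolded has_field_derivative_def]]
    by simp
  moreover have "flat_exp n differentiable at x" for x
    using flat_exp_has_derivative[of n x] unfolding has_field_derivative_def
    by (rule differentiableI)
  ultimately show ?case
    using C_k_add[OF Suc[of "n + 2"] C_k_mult[OF C_k_const[of k "- real n"] Suc[of "n + 1"]]]
    unfolding C_k.simps Basis_real_def by (simp only: ball_simps simp_thms) auto
qed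

text \<open>Each factor is positive on one side of a face of the box and zero beyond it. Scaling by
  \<open>n\<close> drives \<open>flat_exp 0 (n * u)\<close> to \<open>1\<close> for every u > 0, so
  these bumps approximate the indicator of the open box from within and stay below
  \<open>1\<close>.\<close>

definition box_bump :: "'b::euclidean_space \<Rightarrow> 'b \<Rightarrow> nat \<Rightarrow> 'b \<Rightarrow> real" where
  "box_bump a b n x = (\<Prod>i\<in>Basis. flat_exp 0 (real n * (x \<bullet> i - a \<bullet> i)) * flat_exp 0 (real n * (b \<bullet> i - x \<bullet> i)))"

lemma flat_exp_0_bounds: "0 \<le> flat_exp 0 x" "flat_exp 0 x \<le> 1"
  by (auto simp: flat_exp_def)

lemma box_bump_bounds: "0 \<le> box_bump a b n x" "box_bump a b n x \<le> 1"
  unfolding box_bump_def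
  by (auto intro!: prod_nonneg prod_le_1 mult_nonneg_nonneg mult_le_one flat_exp_0_bounds)

lemma C_k_box_bump: "C_k k (box_bump a b n :: 'b::euclidean_space \<Rightarrow> real)"
proof -
  have 1: "C_k k (\<lambda>x::'b. flat_exp 0 (real n * (x \<bullet> i - a \<bullet> i)))" for i
    using C_k_compose_affine[OF C_k_flat_exp, of "\<lambda>x::'b. real n * (x \<bullet> i)" k 0 "- real n * (a \<bullet> i)"]
    by (simp add: algebra_simps bounded_linear_const_mult bounded_linear_inner_left)
  have 2: "C_k k (\<lambda>x::'b. flat_exp 0 (real n * (b \<bullet> i - x \<bullet> i)))" for i
    using C_k_compose_affine[OF C_k_flat_exp, of "\<lambda>x::'b. - real n * (x \<bullet> i)" k 0 "real n * (b \<bullet> i)"]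
    by (simp add: algebra_simps bounded_linear_minus bounded_linear_const_mult bounded_linear_inner_left)
  show ?thesis
    unfolding box_bump_def[abs_def] by (intro C_k_prod C_k_mult 1 2 finite_Basis)
qed

lemma box_bump_eq_0: "x \<notin> box a b \<Longrightarrow> box_bump a b n x = 0"
  unfolding box_bump_def by (auto simp: mem_box flat_exp_def zero_less_mult_iff)

lemma box_bump_tendsto: "(\<lambda>n. box_bump a b n x) \<longlonglongrightarrow> indicator (box a b) x"
proof (cases "x \<in> box a b")
  case False
  then show ?thesis by (simp add: box_bump_eq_0)
next
  case True
  have *: "(\<lambda>n. flat_exp 0 (real n * u)) \<longlonglongrightarrow> 1" if "u > 0" for u :: real
  proof -
    have "(\<lambda>n. exp (- (inverse (real n) * inverse u))) \<longlonglongrightarrow> exp (- (0 * inverse u))"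
      by (intro tendsto_intros lim_inverse_n)
    moreover have "\<forall>\<^sub>F n in sequentially. exp (- (inverse (real n) * inverse u)) = flat_exp 0 (real n * u)"
      using eventually_gt_at_top[of 0]
      by eventually_elim (use that in \<open>auto simp: flat_exp_def field_simps\<close>)
    ultimately show ?thesis
      using tendsto_cong by force
  qed
  have "(\<lambda>n. box_bump a b n x) \<longlonglongrightarrow> (\<Prod>i\<in>(Basis::'a set). 1 * 1)"
    unfolding box_bump_def
    by (intro tendsto_prod tendsto_mult *) (use True in \<open>auto simp: mem_box\<close>)
  then show ?thesis using True by simp
qed

lemma box_bump_test_function:
  assumes "cbox a b \<subseteq> U"
  shows "box_bump a b n \<in> test_functions U"
proof -
  have *: "closure {x. box_bump a b n x \<noteq> 0} \<subseteq> cbox a b"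
    by (intro closure_minimal) (use box_bump_eq_0 box_subset_cbox in blast)+
  have "compact (closure {x. box_bump a b n x \<noteq> 0})"
    using compact_Int_closed[OF compact_cbox[of a b] closed_closure] * by (metis Int_absorb1)
  then show ?thesis
    using * assms C_k_box_bump unfolding test_functions_def by blast
qed

section \<open>Test functions: regularity, supports and tensor products\<close>

lemma test_function_continuous: "\<phi> \<in> test_functions U \<Longrightarrow> continuous_on UNIV \<phi>"
  unfolding test_functions_def using C_k.simps(1) by blast

lemma test_function_differentiable: "\<phi> \<in> test_functions U \<Longrightarrow> \<phi> differentiable at x"
  unfolding test_functions_def using C_k.simps(2) by blast

lemma test_function_deriv_continuous:
  assumes "\<phi> \<in> test_functions U" "b \<in> Basis"
  shows "continuous_on UNIV (\<lambda>x. frechet_derivative \<phi> (at x) b)"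
proof -
  have "C_k (Suc 0) \<phi>" using assms unfolding test_functions_def by blast
  then show ?thesis using assms by simp
qed

text \<open>Off its closed support the function vanishes on a neighbourhood, hence so does its
  derivative. One compact set thus serves both functions that appear in the definition of a weak
  derivative.\<close>

lemma test_function_support:
  assumes "\<phi> \<in> test_functions U"
  obtains C where "compact C" "C \<subseteq> U" "\<forall>x. x \<notin> C \<longrightarrow> \<phi> x = 0"
    "\<forall>x v. x \<notin> C \<longrightarrow> frechet_derivative \<phi> (at x) v = 0"
proof -
  define C where "C = closure {x. \<phi> x \<noteq> 0}"
  have 0: "\<phi> x = 0" if "x \<notin> C" for x
    using that closure_subset[of "{x. \<phi> x \<noteq> 0}"] unfolding C_def by auto
  have "frechet_derivative \<phi> (at x) v = 0" if "x \<notin> C" for x v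
  proof -
    have "open (- C)" unfolding C_def by (intro open_Compl closed_closure)
    have "((\<lambda>_. 0) has_derivative (\<lambda>_. 0)) (at x)" by simp
    then have "(\<phi> has_derivative (\<lambda>_. 0)) (at x)"
      by (rule has_derivative_transform_within_open[of "\<lambda>_. 0" _ x UNIV "- C"])
        (use \<open>open (- C)\<close> that 0 in auto)
    then show ?thesis by (simp add: frechet_derivative_eqI)
  qed
  moreover have "compact C" "C \<subseteq> U"
    using assms unfolding C_def test_functions_def by simp_all
  ultimately show thesis
    using 0 by (intro that) auto
qed

lemma test_function_tensor:
  fixes \<eta> :: "real \<Rightarrow> real" and \<phi> :: "'b::euclidean_space \<Rightarrow> real"
  assumes \<eta>: "\<eta> \<in> test_functions T" and \<phi>: "\<phi> \<in> test_functions U"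
  shows "(\<lambda>(t, x). \<eta> t * \<phi> x) \<in> test_functions (T \<times> U)"
    and "frechet_derivative (\<lambda>(t, x). \<eta> t * \<phi> x) (at (t, x)) (0, v) = \<eta> t * frechet_derivative \<phi> (at x) v"
proof -
  \<comment> \<open>The summands \<open>+ 0\<close> present both factors as compositions with an
    affine map, the form that the lemmas on affine composition expect.\<close>
  have eq: "(\<lambda>(t, x). \<eta> t * \<phi> x) = (\<lambda>z. \<eta> (fst z + 0) * \<phi> (snd z + 0))"
    by auto
  have "C_k k (\<lambda>(t, x). \<eta> t * \<phi> x)" for k
    unfolding eq using assms unfolding test_functions_def
    by (intro C_k_mult C_k_compose_affine bounded_linear_fst bounded_linear_snd) auto
  moreover obtain C where C: "compact C" "C \<subseteq> T" "\<forall>x. x \<notin> C \<longrightarrow> \<eta> x = 0"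
    by (rule test_function_support[OF \<eta>])
  obtain D where D: "compact D" "D \<subseteq> U" "\<forall>x. x \<notin> D \<longrightarrow> \<phi> x = 0"
    by (rule test_function_support[OF \<phi>])
  have sub: "closure {x. (case x of (t, x) \<Rightarrow> \<eta> t * \<phi> x) \<noteq> 0} \<subseteq> C \<times> D"
    using C D by (intro closure_minimal compact_imp_closed compact_Times) auto
  moreover have "compact (closure {x. (case x of (t, x) \<Rightarrow> \<eta> t * \<phi> x) \<noteq> 0})"
    using compact_Int_closed[OF compact_Times[OF C(1) D(1)] closed_closure] sub by (metis Int_absorb1)
  ultimately show "(\<lambda>(t, x). \<eta> t * \<phi> x) \<in> test_functions (T \<times> U)"
    using C(2) D(2) unfolding test_functions_def by blast
  have "((\<lambda>z. \<eta> (fst z + 0) * \<phi> (snd z + 0)) has_derivative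
    (\<lambda>h. \<eta> (fst (t, x) + 0) * frechet_derivative \<phi> (at (snd (t, x) + 0)) (snd h) +
      frechet_derivative \<eta> (at (fst (t, x) + 0)) (fst h) * \<phi> (snd (t, x) + 0))) (at (t, x))"
    by (intro has_derivative_mult has_derivative_compose_affine bounded_linear_fst bounded_linear_snd
        test_function_differentiable[OF \<eta>] test_function_differentiable[OF \<phi>])
  then have "frechet_derivative (\<lambda>(t, x). \<eta> t * \<phi> x) (at (t, x)) (0, v) =
     \<eta> t * frechet_derivative \<phi> (at x) v + frechet_derivative \<eta> (at t) 0 * \<phi> x"
    unfolding eq[symmetric] by (simp add: frechet_derivative_eqI)
  moreover have "linear (frechet_derivative \<eta> (at t))"
    using test_function_differentiable[OF \<eta>] by (rule linear_frechet_derivative)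
  ultimately show "frechet_derivative (\<lambda>(t, x). \<eta> t * \<phi> x) (at (t, x)) (0, v) = \<eta> t * frechet_derivative \<phi> (at x) v"
    by (simp add: linear_0)
qed

section \<open>Weak derivatives\<close>

lemma locally_integrable_onD:
  "locally_integrable_on f U \<Longrightarrow> compact C \<Longrightarrow> C \<subseteq> U \<Longrightarrow> set_integrable lborel C f"
  unfolding locally_integrable_on_def by blast

lemma locally_integrable_on_add:
  assumes "locally_integrable_on f U" "locally_integrable_on g U"
  shows "locally_integrable_on (\<lambda>x. c * f x + g x) U"
  using assms unfolding locally_integrable_on_def
  by (auto intro!: set_integral_add set_integrable_mult_right)

lemma continuous_compact_support_bounded:
  fixes \<psi> :: "'b::euclidean_space \<Rightarrow> real"
  assumes \<psi>: "continuous_on UNIV \<psi>" and C: "compact C" "\<forall>x. x \<notin> C \<longrightarrow> \<psi> x = 0"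
  obtains B where "\<forall>x. \<bar>\<psi> x\<bar> \<le> B"
proof -
  have "bounded (\<psi> ` C)"
    by (intro compact_imp_bounded compact_continuous_image continuous_on_subset[OF \<psi>] C(1)) simp
  then obtain B where "\<forall>x\<in>C. \<bar>\<psi> x\<bar> \<le> B"
    unfolding bounded_iff by auto
  then have "\<bar>\<psi> x\<bar> \<le> max B 0" for x
    using C(2) by (cases "x \<in> C") (auto simp: le_max_iff_disj)
  then show thesis using that by blast
qed

text \<open>The factor \<open>\<psi>\<close> is only continuous, so that derivatives of test
  functions and differences of test functions are covered as well. The bound is what makes pairings
  continuous under L1 convergence on \<open>C\<close>.\<close>

lemma
  fixes f \<psi> :: "'b::euclidean_space \<Rightarrow> real"
  assumes f: "locally_integrable_on f U" and \<psi>: "continuous_on UNIV \<psi>"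
    and C: "compact C" "C \<subseteq> U" "\<forall>x. x \<notin> C \<longrightarrow> \<psi> x = 0"
  shows set_integrable_mult_compact_support: "set_integrable lborel U (\<lambda>x. f x * \<psi> x)"
    and abs_set_integral_mult_compact_support_le:
      "(\<forall>x. \<bar>\<psi> x\<bar> \<le> B) \<Longrightarrow> \<bar>LINT x:U|lborel. f x * \<psi> x\<bar> \<le> B * (LINT x:C|lborel. \<bar>f x\<bar>)"
proof -
  have int: "integrable lborel (\<lambda>x. indicator C x * f x)"
    using locally_integrable_onD[OF f C(1,2)] unfolding set_integrable_def by simp
  have eq: "indicator U x *\<^sub>R (f x * \<psi> x) = (indicator C x * f x) * \<psi> x" for x
    using C(2,3) by (auto simp: indicator_def)
  have [measurable]: "\<psi> \<in> borel_measurable borel"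
    using \<psi> by (rule borel_measurable_continuous_onI)
  have bd: "integrable lborel (\<lambda>x. (indicator C x * f x) * \<psi> x)
      \<and> \<bar>LINT x|lborel. (indicator C x * f x) * \<psi> x\<bar> \<le> B * (LINT x:C|lborel. \<bar>f x\<bar>)"
    if B: "\<forall>x. \<bar>\<psi> x\<bar> \<le> B" for B
  proof
    have B0: "0 \<le> B" using B abs_ge_zero order_trans by blast
    have le: "\<bar>(indicator C x * f x) * \<psi> x\<bar> \<le> B * \<bar>indicator C x * f x\<bar>" for x
      using B by (auto simp: abs_mult mult.commute intro: mult_right_mono)
    have intB: "integrable lborel (\<lambda>x. B * \<bar>indicator C x * f x\<bar>)"
      using int by auto
    show i: "integrable lborel (\<lambda>x. (indicator C x * f x) * \<psi> x)"
      by (rule Bochner_Integration.integrable_bound[OF intB])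
        (use borel_measurable_integrable[OF int] le B0 in \<open>auto simp: abs_mult\<close>)
    have "\<bar>LINT x|lborel. (indicator C x * f x) * \<psi> x\<bar> \<le> (LINT x|lborel. \<bar>(indicator C x * f x) * \<psi> x\<bar>)"
      by (rule integral_abs_bound)
    also have "\<dots> \<le> (LINT x|lborel. B * \<bar>indicator C x * f x\<bar>)"
      using le i by (intro integral_mono intB) auto
    also have "\<dots> = B * (LINT x:C|lborel. \<bar>f x\<bar>)"
      unfolding set_lebesgue_integral_def by (simp add: abs_mult)
    finally show "\<bar>LINT x|lborel. (indicator C x * f x) * \<psi> x\<bar> \<le> B * (LINT x:C|lborel. \<bar>f x\<bar>)" .
  qed
  obtain B' where "\<forall>x. \<bar>\<psi> x\<bar> \<le> B'"
    using \<psi> C(1,3) by (rule continuous_compact_support_bounded)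
  with bd show "set_integrable lborel U (\<lambda>x. f x * \<psi> x)"
    unfolding set_integrable_def eq by blast
  show "(\<forall>x. \<bar>\<psi> x\<bar> \<le> B) \<Longrightarrow> \<bar>LINT x:U|lborel. f x * \<psi> x\<bar> \<le> B * (LINT x:C|lborel. \<bar>f x\<bar>)"
    using bd unfolding set_lebesgue_integral_def eq by blast
qed

text \<open>Dominated convergence along the bumps of the box. The closed box has to lie in
  \<open>U\<close>: it contains the supports of the bumps, and local integrability of
  \<open>h\<close> is a statement about compact sets.\<close>

lemma set_integral_box_eq_0:
  fixes h :: "'b::euclidean_space \<Rightarrow> real"
  assumes h: "locally_integrable_on h U"
    and test: "\<And>\<phi>. \<phi> \<in> test_functions U \<Longrightarrow> (LINT x:U|lborel. h x * \<phi> x) = 0"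
    and ab: "cbox a b \<subseteq> U"
  shows "(LINT x|lborel. indicator (box a b) x * h x) = 0"
proof -
  have int: "integrable lborel (\<lambda>x. indicator (cbox a b) x * h x)"
    using locally_integrable_onD[OF h compact_cbox ab] unfolding set_integrable_def by simp
  have eq: "indicator U x *\<^sub>R (h x * box_bump a b n x) = (indicator (cbox a b) x * h x) * box_bump a b n x" for x n
    using ab box_subset_cbox[of a b] box_bump_eq_0[of x a b n] by (auto simp: indicator_def)
  have eq2: "indicator (box a b) x * h x = (indicator (cbox a b) x * h x) * indicator (box a b) x" for x
    using box_subset_cbox[of a b] by (auto simp: indicator_def)
  have [measurable]: "box_bump a b n \<in> borel_measurable borel" for n
    using C_k_box_bump[of 0 a b n] by (auto intro: borel_measurable_continuous_onI)
  have "(\<lambda>n. LINT x|lborel. (indicator (cbox a b) x * h x) * box_bump a b n x)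
      \<longlonglongrightarrow> (LINT x|lborel. (indicator (cbox a b) x * h x) * indicator (box a b) x)"
  proof (rule integral_dominated_convergence[where w="\<lambda>x. \<bar>indicator (cbox a b) x * h x\<bar>"])
    show "AE x in lborel. (\<lambda>n. indicator (cbox a b) x * h x * box_bump a b n x)
        \<longlonglongrightarrow> indicator (cbox a b) x * h x * indicator (box a b) x"
      by (intro AE_I2 tendsto_mult tendsto_const box_bump_tendsto)
    show "AE x in lborel. norm (indicator (cbox a b) x * h x * box_bump a b n x)
        \<le> \<bar>indicator (cbox a b) x * h x\<bar>" for n
      using box_bump_bounds[of a b n] by (auto simp: abs_mult intro!: AE_I2 mult_left_le)
  qed (use borel_measurable_integrable[OF int] int in auto)
  moreover have "(LINT x|lborel. (indicator (cbox a b) x * h x) * box_bump a b n x) = 0" for n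
    using test[OF box_bump_test_function[OF ab]] unfolding set_lebesgue_integral_def eq .
  ultimately show ?thesis
    unfolding eq2 by (simp add: LIMSEQ_const_iff)
qed

text \<open>The Borel sets on which \<open>h\<close> has integral zero form a Dynkin system, and
  open boxes are an intersection stable generator. The integral over the whole space is assumed
  separately since it is needed for complements and the space is no box.\<close>

lemma AE_eq_0_of_box_integrals:
  fixes h :: "'b::euclidean_space \<Rightarrow> real"
  assumes h: "integrable lborel h"
    and box: "\<And>a b. (LINT x|lborel. indicator (box a b) x * h x) = 0"
    and all: "(LINT x|lborel. h x) = 0"
  shows "AE x in lborel. h x = 0"
proof (rule sigma_finite_measure.density_zero[OF sigma_finite_lborel h])
  have int: "integrable lborel (\<lambda>x. indicator A x * h x)" if "A \<in> sets borel" for A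
    using integrable_mult_indicator[of A lborel h] that h by simp
  let ?E = "range (\<lambda>(a, b). box a b :: 'b set)"
  fix A :: "'b set" assume "A \<in> sets lborel"
  then have A: "A \<in> sigma_sets UNIV ?E"
    by (simp add: borel_eq_box)
  have E: "Int_stable ?E" "?E \<subseteq> Pow UNIV"
    by (auto simp: Int_stable_def box_Int_box)
  from E A show "set_lebesgue_integral lborel A h = 0"
  proof (induction rule: sigma_sets_induct_disjoint)
    case (basic A)
    then show ?case using box by (auto simp: set_lebesgue_integral_def)
  next
    case empty
    then show ?case by (simp add: set_lebesgue_integral_def)
  next
    case (compl A)
    then have A: "A \<in> sets lborel" by (simp add: borel_eq_box)
    have "(LINT x:UNIV - A|lborel. h x) = (LINT x|lborel. h x - indicator A x *\<^sub>R h x)"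
      unfolding set_lebesgue_integral_def
      by (intro Bochner_Integration.integral_cong) (auto simp: indicator_def)
    also have "\<dots> = 0"
      using h A all compl.IH
      by (subst Bochner_Integration.integral_diff)
         (auto simp: set_lebesgue_integral_def intro: int)
    finally show ?case .
  next
    case (union A)
    then have "A i \<in> sets lborel" for i by (auto simp: borel_eq_box)
    then have "(LINT x:(\<Union>i. A i)|lborel. h x) = (\<Sum>i. (LINT x:A i|lborel. h x))"
      using union.hyps(1) h
      by (intro lebesgue_integral_countable_add)
         (auto simp: disjoint_family_on_def set_integrable_def intro!: int)
    then show ?case using union.IH by simp
  qed
qed

text \<open>Cutting \<open>h\<close> off to a box whose closure lies in \<open>U\<close> makes it
  globally integrable, and intersecting with another box leaves a box, so the criterion by box
  integrals applies. Countably many closed boxes exhaust \<open>U\<close>.\<close>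

lemma fundamental_lemma_variations:
  fixes h :: "'b::euclidean_space \<Rightarrow> real"
  assumes U: "open U" and h: "locally_integrable_on h U"
    and test: "\<And>\<phi>. \<phi> \<in> test_functions U \<Longrightarrow> (LINT x:U|lborel. h x * \<phi> x) = 0"
  shows "AE x in lborel. x \<in> U \<longrightarrow> h x = 0"
proof -
  have cb: "AE x in lborel. x \<in> cbox p q \<longrightarrow> h x = 0" if pq: "cbox p q \<subseteq> U" for p q
  proof -
    have 0: "(LINT x|lborel. indicator (box a b) x * h x) = 0" if "cbox a b \<subseteq> U" for a b
      using set_integral_box_eq_0[OF h test that] .
    have "set_integrable lborel (cbox p q) h"
      using locally_integrable_onD[OF h compact_cbox pq] .
    then have "set_integrable lborel (box p q) h"
      by (rule set_integrable_subset) (auto simp: box_subset_cbox)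
    then have int: "integrable lborel (\<lambda>x. indicator (box p q) x * h x)"
      by (simp add: set_integrable_def)
    have "AE x in lborel. indicator (box p q) x * h x = 0"
    proof (rule AE_eq_0_of_box_integrals[OF int])
      show "(LINT x|lborel. indicator (box p q) x * h x) = 0"
        using pq by (rule 0)
      fix a b
      show "(LINT x|lborel. indicator (box a b) x * (indicator (box p q) x * h x)) = 0"
      proof (cases "box a b \<inter> box p q = {}")
        case True
        then have "(\<lambda>x. indicator (box a b) x * (indicator (box p q) x * h x)) = (\<lambda>_. 0)"
          by (auto simp: fun_eq_iff split: split_indicator)
        then show ?thesis by simp
      next
        case False
        obtain c d where cd: "box a b \<inter> box p q = box c d"
          using box_Int_box by (rule that)
        \<comment> \<open>The fact \<open>0\<close> asks for the closed box \<open>cbox c d\<close>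
          inside \<open>U\<close>. It is reached through closures, and \<open>closure_box\<close> is
          about nonempty boxes, hence the case distinction.\<close>
        have "closure (box c d) \<subseteq> closure (box p q)"
          unfolding cd[symmetric] by (intro closure_mono) simp
        moreover have "closure (box c d) = cbox c d" "closure (box p q) = cbox p q"
          using False cd by (auto intro!: closure_box)
        ultimately have "(LINT x|lborel. indicator (box c d) x * h x) = 0"
          using pq by (intro 0) simp
        moreover have "(\<lambda>x. indicator (box a b) x * (indicator (box p q) x * h x)) = (\<lambda>x. indicator (box c d) x * h x)"
          unfolding cd[symmetric] by (simp add: indicator_inter_arith mult.assoc)
        ultimately show ?thesis by (simp only:)
      qed
    qed
    \<comment> \<open>The bumps see the open box only; its frontier is negligible.\<close>
    moreover have "cbox p q - box p q \<in> null_sets lborel"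
      using negligible_frontier_interval[of p q]
      by (simp add: negligible_iff_null_sets null_sets_completion_iff)
    then have "AE x in lborel. x \<notin> cbox p q - box p q"
      by (rule AE_not_in)
    ultimately show ?thesis by eventually_elim (auto simp: indicator_def split: if_splits)
  qed
  obtain \<D> where D: "countable \<D>" "\<And>X. X \<in> \<D> \<Longrightarrow> X \<subseteq> U" "\<And>X. X \<in> \<D> \<Longrightarrow> \<exists>a b. X = cbox a b" "\<Union>\<D> = U"
    using open_countable_Union_open_cbox[OF U] by (metis PowD subsetD)
  have "AE x in lborel. \<forall>X\<in>\<D>. x \<in> X \<longrightarrow> h x = 0"
  proof (subst AE_ball_countable[OF D(1)], intro ballI)
    fix X assume "X \<in> \<D>"
    then obtain a b where "X = cbox a b" "X \<subseteq> U" using D by metis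
    then show "AE x in lborel. x \<in> X \<longrightarrow> h x = 0" using cb by simp
  qed
  then show ?thesis using D(4) by (auto elim: eventually_mono)
qed

section \<open>Uniqueness, linearity and closedness of weak derivatives\<close>

lemma has_weak_derivative_unique:
  assumes U: "open U" and g: "has_weak_derivative f g v U" "has_weak_derivative f g' v U"
  shows "AE x in lborel. x \<in> U \<longrightarrow> g x = g' x"
proof -
  have "locally_integrable_on (\<lambda>x. g x - g' x) U"
    using locally_integrable_on_add[of g' U g "-1"] g by (simp add: has_weak_derivative_def)
  moreover have "(LINT x:U|lborel. (g x - g' x) * \<phi> x) = 0" if \<phi>: "\<phi> \<in> test_functions U" for \<phi>
  proof -
    obtain C where C: "compact C" "C \<subseteq> U" "\<forall>x. x \<notin> C \<longrightarrow> \<phi> x = 0"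
      by (rule test_function_support[OF \<phi>])
    have "set_integrable lborel U (\<lambda>x. g x * \<phi> x)" "set_integrable lborel U (\<lambda>x. g' x * \<phi> x)"
      using g by (auto simp: has_weak_derivative_def
          intro!: set_integrable_mult_compact_support[OF _ test_function_continuous[OF \<phi>] C])
    then show ?thesis
      using g \<phi> by (simp add: left_diff_distrib set_integral_diff(2) has_weak_derivative_def)
  qed
  ultimately show ?thesis
    using fundamental_lemma_variations[OF U] by fastforce
qed

lemma test_function_pairings_integrable:
  assumes f: "locally_integrable_on f U" and \<phi>: "\<phi> \<in> test_functions U" and v: "v \<in> Basis"
  shows "set_integrable lborel U (\<lambda>x. f x * \<phi> x)"
    and "set_integrable lborel U (\<lambda>x. f x * frechet_derivative \<phi> (at x) v)"
proof -
  obtain C where C: "compact C" "C \<subseteq> U" "\<forall>x. x \<notin> C \<longrightarrow> \<phi> x = 0"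
      "\<forall>x v. x \<notin> C \<longrightarrow> frechet_derivative \<phi> (at x) v = 0"
    by (rule test_function_support[OF \<phi>])
  show "set_integrable lborel U (\<lambda>x. f x * \<phi> x)"
    using set_integrable_mult_compact_support[OF f test_function_continuous[OF \<phi>] C(1,2,3)] .
  show "set_integrable lborel U (\<lambda>x. f x * frechet_derivative \<phi> (at x) v)"
    using set_integrable_mult_compact_support[OF f test_function_deriv_continuous[OF \<phi> v] C(1,2)] C(4)
    by blast
qed

lemma has_weak_derivative_add:
  assumes f: "has_weak_derivative f g v U" "has_weak_derivative f' g' v U" and v: "v \<in> Basis"
  shows "has_weak_derivative (\<lambda>x. c * f x + f' x) (\<lambda>x. c * g x + g' x) v U"
proof -
  have li: "locally_integrable_on f U" "locally_integrable_on g U"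
    "locally_integrable_on f' U" "locally_integrable_on g' U"
    using f by (auto simp: has_weak_derivative_def)
  have "(LINT x:U|lborel. (c * f x + f' x) * frechet_derivative \<phi> (at x) v) =
      - (LINT x:U|lborel. (c * g x + g' x) * \<phi> x)" if \<phi>: "\<phi> \<in> test_functions U" for \<phi>
    using f \<phi> by (simp add: distrib_right mult.assoc set_integral_add(2) set_integrable_mult_right
        test_function_pairings_integrable[OF _ \<phi> v] li has_weak_derivative_def)
  then show ?thesis
    using li by (auto simp: has_weak_derivative_def locally_integrable_on_add)
qed

text \<open>For a fixed test function both sides of the defining identity involve one compact set
  and bounded factors, so they are continuous under L1 convergence on that set.\<close>

lemma has_weak_derivative_limit:
  assumes fg: "\<And>n. has_weak_derivative (f n) (g n) v U" and v: "v \<in> Basis"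
    and li: "locally_integrable_on F U" "locally_integrable_on G U"
    and limf: "\<And>C. compact C \<Longrightarrow> C \<subseteq> U \<Longrightarrow> (\<lambda>n. LINT x:C|lborel. \<bar>f n x - F x\<bar>) \<longlonglongrightarrow> 0"
    and limg: "\<And>C. compact C \<Longrightarrow> C \<subseteq> U \<Longrightarrow> (\<lambda>n. LINT x:C|lborel. \<bar>g n x - G x\<bar>) \<longlonglongrightarrow> 0"
  shows "has_weak_derivative F G v U"
proof -
  have lim: "(\<lambda>n. LINT x:U|lborel. h n x * \<psi> x) \<longlonglongrightarrow> (LINT x:U|lborel. H x * \<psi> x)"
    if h: "\<And>n. locally_integrable_on (h n) U" "locally_integrable_on H U"
      and \<psi>: "continuous_on UNIV \<psi>" and C: "compact C" "C \<subseteq> U" "\<forall>x. x \<notin> C \<longrightarrow> \<psi> x = 0"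
      and limh: "(\<lambda>n. LINT x:C|lborel. \<bar>h n x - H x\<bar>) \<longlonglongrightarrow> 0" for h H \<psi> C
  proof -
    obtain B where B: "\<forall>x. \<bar>\<psi> x\<bar> \<le> B"
      using \<psi> C(1,3) by (rule continuous_compact_support_bounded)
    note si = set_integrable_mult_compact_support[OF _ \<psi> C]
    have li': "locally_integrable_on (\<lambda>x. h n x - H x) U" for n
      using locally_integrable_on_add[OF h(2) h(1), of "-1"] by simp
    have le: "norm ((LINT x:U|lborel. h n x * \<psi> x) - (LINT x:U|lborel. H x * \<psi> x))
        \<le> B * (LINT x:C|lborel. \<bar>h n x - H x\<bar>)" for n
      using abs_set_integral_mult_compact_support_le[OF li' \<psi> C B] h
      by (simp add: left_diff_distrib set_integral_diff(2) si)
    have "(\<lambda>n. B * (LINT x:C|lborel. \<bar>h n x - H x\<bar>)) \<longlonglongrightarrow> 0"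
      using tendsto_mult[OF tendsto_const limh] by simp
    then have "(\<lambda>n. (LINT x:U|lborel. h n x * \<psi> x) - (LINT x:U|lborel. H x * \<psi> x)) \<longlonglongrightarrow> 0"
      by (rule Lim_null_comparison[OF always_eventually, rotated]) (use le in simp)
    then show ?thesis by (rule LIM_zero_cancel)
  qed
  have "(LINT x:U|lborel. F x * frechet_derivative \<phi> (at x) v) = - (LINT x:U|lborel. G x * \<phi> x)"
    if \<phi>: "\<phi> \<in> test_functions U" for \<phi>
  proof -
    obtain C where C: "compact C" "C \<subseteq> U" "\<forall>x. x \<notin> C \<longrightarrow> \<phi> x = 0"
        "\<forall>x v. x \<notin> C \<longrightarrow> frechet_derivative \<phi> (at x) v = 0"
      by (rule test_function_support[OF \<phi>])
    have li': "locally_integrable_on (f n) U" "locally_integrable_on (g n) U" for n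
      using fg by (auto simp: has_weak_derivative_def)
    have l1: "(\<lambda>n. LINT x:U|lborel. f n x * frechet_derivative \<phi> (at x) v)
        \<longlonglongrightarrow> (LINT x:U|lborel. F x * frechet_derivative \<phi> (at x) v)"
      using li(1) li'(1) C(1,2) limf[OF C(1,2)] C(4)
      by (intro lim[OF _ _ test_function_deriv_continuous[OF \<phi> v]]) auto
    have l2: "(\<lambda>n. - (LINT x:U|lborel. g n x * \<phi> x)) \<longlonglongrightarrow> - (LINT x:U|lborel. G x * \<phi> x)"
      using li(2) li'(2) C(1,2) limg[OF C(1,2)] C(3)
      by (intro tendsto_minus lim[OF _ _ test_function_continuous[OF \<phi>]]) auto
    have e: "(\<lambda>n. - (LINT x:U|lborel. g n x * \<phi> x))
        = (\<lambda>n. LINT x:U|lborel. f n x * frechet_derivative \<phi> (at x) v)"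
      using fg \<phi> by (auto simp: has_weak_derivative_def)
    show ?thesis
      by (rule LIMSEQ_unique[OF l1 l2[unfolded e]])
  qed
  then show ?thesis using li by (auto simp: has_weak_derivative_def)
qed

section \<open>The space-time measure\<close>

text \<open>A form of Young's inequality with a free weight. Below, the weight is a multiple of the
  space-time density in \<open>nn_integral_lborel_le_spacetime\<close> and a power of two in
  \<open>L2_complete\<close>.\<close>

lemma abs_le_weighted_square:
  fixes y c :: real
  assumes c: "0 < c"
  shows "\<bar>y\<bar> \<le> c * y\<^sup>2 + 1 / c"
proof -
  have "0 \<le> (c * \<bar>y\<bar> - 1)\<^sup>2 + c * \<bar>y\<bar>"
    using c by simp
  then have "c * \<bar>y\<bar> \<le> c\<^sup>2 * y\<^sup>2 + 1"
    by (simp add: power2_diff power_mult_distrib)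
  also have "\<dots> = c * (c * y\<^sup>2 + 1 / c)"
    using c by (simp add: algebra_simps power2_eq_square)
  finally show ?thesis
    using c by (simp only: mult_le_cancel_left_pos)
qed

text \<open>The indicator of an open set is a pointwise limit of bounded continuous functions, here
  the truncated multiples of the distance to the complement. Weak continuity makes their integrals
  continuous in t.\<close>

lemma measurable_emeasure_open_weakly_continuous:
  fixes \<rho> :: "real \<Rightarrow> 'a::euclidean_space measure"
  assumes P: "\<And>t. t \<in> {0..1} \<Longrightarrow> prob_space (\<rho> t)" "\<And>t. t \<in> {0..1} \<Longrightarrow> sets (\<rho> t) = sets borel"
    and wc: "weakly_continuous_curve \<rho>" and U: "open U"
  shows "(\<lambda>t. indicator {0..1} t * measure (\<rho> t) U) \<in> borel_measurable borel"
\<comment> \<open>The distance to the empty set is \<open>0\<close> by convention, so for an empty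
  complement the approximating functions would all vanish.\<close>
proof (cases "U = UNIV")
  case True
  have "(\<lambda>t. indicator {0..1} t * measure (\<rho> t) U) = indicator {0..1}"
    using prob_space.prob_space[OF P(1)] sets_eq_imp_space_eq[OF P(2)] True
    by (auto simp: fun_eq_iff split: split_indicator)
  then show ?thesis by simp
next
  case False
  define g where "g n x = min 1 (real n * infdist x (- U))" for n x
  have g01: "0 \<le> g n x" "g n x \<le> 1" for n x
    by (auto simp: g_def infdist_nonneg)
  have cont: "continuous_on UNIV (g n)" for n
    unfolding g_def[abs_def] by (intro continuous_intros)
  have [measurable]: "g n \<in> borel_measurable borel" for n
    using cont by (rule borel_measurable_continuous_onI)
  have glim: "(\<lambda>n. g n x) \<longlonglongrightarrow> indicator U x" for x
  proof (cases "x \<in> U")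
    case True
    then have pos: "infdist x (- U) > 0"
      using U False infdist_pos_not_in_closed[of "- U" x] by auto
    then obtain N where N: "1 < real N * infdist x (- U)"
      using reals_Archimedean3 by blast
    have "g n x = 1" if "n \<ge> N" for n
    proof -
      have "real N * infdist x (- U) \<le> real n * infdist x (- U)"
        using that pos by (intro mult_right_mono) auto
      then show ?thesis using N by (simp add: g_def)
    qed
    then have "(\<lambda>n. g n x) \<longlonglongrightarrow> 1"
      by (intro tendsto_eventually eventually_sequentiallyI)
    then show ?thesis using True by simp
  next
    case False
    then show ?thesis by (simp add: g_def)
  qed
  show ?thesis
  proof (rule borel_measurable_LIMSEQ_real)
    show "(\<lambda>t. indicator {0..1} t *\<^sub>R (\<integral>x. g n x \<partial>\<rho> t)) \<in> borel_measurable borel" for n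
    proof (rule borel_measurable_continuous_on_indicator)
      have "bounded (range (g n))"
        using g01 by (auto simp: bounded_iff intro!: exI[of _ 1])
      then show "continuous_on {0..1} (\<lambda>t. \<integral>x. g n x \<partial>\<rho> t)"
        using wc cont unfolding weakly_continuous_curve_def by blast
    qed simp
    fix t :: real
    show "(\<lambda>n. indicator {0..1} t *\<^sub>R (\<integral>x. g n x \<partial>\<rho> t)) \<longlonglongrightarrow> indicator {0..1} t * measure (\<rho> t) U"
    proof (cases "t \<in> {0..1}")
      case True
      interpret prob_space "\<rho> t" using P True by blast
      note [measurable_cong] = P(2)[OF True]
      note [measurable] = borel_open[OF U]
      have "(\<lambda>n. \<integral>x. g n x \<partial>\<rho> t) \<longlonglongrightarrow> (\<integral>x. indicator U x \<partial>\<rho> t)"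
        using g01 by (intro integral_dominated_convergence[where w="\<lambda>_. 1"] AE_I2 glim)
          auto
      moreover have "U \<in> sets (\<rho> t)" "space (\<rho> t) = UNIV"
        using P(2)[OF True] sets_eq_imp_space_eq[OF P(2)[OF True]] U by auto
      ultimately show ?thesis using True by simp
    qed simp
  qed
qed

text \<open>Filling in the zero measure outside the unit interval makes the family total, at the
  price of being a subprobability kernel only. Open sets generate the Borel sets and are
  intersection stable, so measurability on them is enough.\<close>

lemma measurable_weakly_continuous_kernel:
  fixes \<rho> :: "real \<Rightarrow> 'a::euclidean_space measure"
  assumes P: "\<And>t. t \<in> {0..1} \<Longrightarrow> prob_space (\<rho> t)" "\<And>t. t \<in> {0..1} \<Longrightarrow> sets (\<rho> t) = sets borel"
    and wc: "weakly_continuous_curve \<rho>"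
  shows "(\<lambda>t. if t \<in> {0..1} then \<rho> t else null_measure borel) \<in> borel \<rightarrow>\<^sub>M subprob_algebra borel"
    (is "?k \<in> _")
proof (rule measurable_subprob_algebra_generated)
  show "sets borel = sigma_sets UNIV {S :: 'a set. open S}"
    by (simp add: borel_def)
  show "Int_stable {S :: 'a set. open S}"
    by (auto simp: Int_stable_def)
  show "subprob_space (?k t)" for t
    using P by (auto intro: prob_space_imp_subprob_space subprob_spaceI)
  show "sets (?k t) = sets borel" for t
    using P by auto
  have *: "(\<lambda>t. emeasure (?k t) U) \<in> borel_measurable borel" if U: "open U" for U
  proof -
    have "emeasure (?k t) U = ennreal (indicator {0..1} t * measure (\<rho> t) U)" for t
      using finite_measure.emeasure_eq_measure[OF prob_space.finite_measure[OF P(1)]]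
      by (auto simp: indicator_def)
    then show ?thesis
      using measurable_emeasure_open_weakly_continuous[OF P wc U] by simp
  qed
  show "(\<lambda>t. emeasure (?k t) UNIV) \<in> borel_measurable borel"
    by (rule *) simp
  show "(\<lambda>t. emeasure (?k t) A) \<in> borel_measurable borel" if "A \<in> {S. open S}" for A
    using that by (intro *) simp
qed simp

section \<open>The space-time measure built from a kernel\<close>

locale ac_curve =
  fixes \<rho> :: "real \<Rightarrow> 'a::euclidean_space measure"
  assumes P_ac: "\<And>t. t \<in> {0..1} \<Longrightarrow> \<rho> t \<in> P_ac"
    and weakly_continuous: "weakly_continuous_curve \<rho>"
begin

lemma prob_space_slice: "t \<in> {0..1} \<Longrightarrow> prob_space (\<rho> t)"
  and sets_slice: "t \<in> {0..1} \<Longrightarrow> sets (\<rho> t) = sets borel"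
  and null_sets_slice: "t \<in> {0..1} \<Longrightarrow> null_sets lborel \<subseteq> null_sets (\<rho> t)"
  using P_ac unfolding P_ac_def absolutely_continuous_def by auto

lemma space_slice: "t \<in> {0..1} \<Longrightarrow> space (\<rho> t) = UNIV"
  using sets_eq_imp_space_eq[OF sets_slice] by simp

text \<open>The measure \<open>\<rho> t\<close> moved to the slice at time t of the product space.
  Kernels into the product itself let the integration theorems for bind produce the space-time
  integral.\<close>

definition slice_kernel :: "real \<Rightarrow> (real \<times> 'a) measure" where
  "slice_kernel t = distr (if t \<in> {0..1} then \<rho> t else null_measure borel) borel (Pair t)"

lemma measurable_slice_kernel [measurable]: "slice_kernel \<in> lborel \<rightarrow>\<^sub>M subprob_algebra borel"
proof -
  have "slice_kernel \<in> borel \<rightarrow>\<^sub>M subprob_algebra borel"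
    unfolding slice_kernel_def[abs_def]
  proof (rule measurable_distr2)
    show "(\<lambda>t. if t \<in> {0..1} then \<rho> t else null_measure borel) \<in> borel \<rightarrow>\<^sub>M subprob_algebra borel"
      using measurable_weakly_continuous_kernel[OF prob_space_slice sets_slice weakly_continuous] .
    show "(\<lambda>(x, y). (x, y)) \<in> borel \<Otimes>\<^sub>M borel \<rightarrow>\<^sub>M (borel :: (real \<times> 'a) measure)"
      by (simp add: borel_prod)
  qed
  then show ?thesis by simp
qed

lemma strip_borel: "(strip :: (real \<times> 'a) set) \<in> sets borel"
  by (intro borel_closed closed_Times) auto

lemma open_open_strip: "open (open_strip :: (real \<times> 'a) set)"
  by (intro open_Times) auto

lemma measurable_Pair_borel: "Pair t \<in> borel \<rightarrow>\<^sub>M (borel :: (real \<times> 'a) measure)"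
proof -
  have "Pair t \<in> borel \<rightarrow>\<^sub>M borel \<Otimes>\<^sub>M (borel :: 'a measure)"
    by measurable
  then show ?thesis
    by (simp add: borel_prod)
qed

lemma measurable_Pair_slice: "t \<in> {0..1} \<Longrightarrow> Pair t \<in> \<rho> t \<rightarrow>\<^sub>M borel"
  using measurable_Pair_borel measurable_cong_sets[OF sets_slice refl] by blast

lemma nn_integral_slice_kernel:
  assumes "f \<in> borel_measurable borel"
  shows "(\<integral>\<^sup>+z. f z \<partial>slice_kernel t) = (\<integral>\<^sup>+x. f (t, x) \<partial>\<rho> t) * indicator {0..1} t"
  using assms measurable_Pair_slice
  by (auto simp: slice_kernel_def nn_integral_distr nn_integral_null_measure)

text \<open>\<open>measure_of\<close> yields the intended values only for a countably additive set
  function. Additivity comes for free once the set function is recognised as the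
  \<open>emeasure\<close> of a measure that already exists.\<close>

lemma spacetime_eq_bind: "spacetime \<rho> = restrict_space (lborel \<bind> slice_kernel) strip"
proof -
  let ?N = "lborel \<bind> slice_kernel" and ?S = "strip :: (real \<times> 'a) set"
  have setsN: "sets ?N = sets borel"
    by (rule sets_bind[OF sets_kernel[OF measurable_slice_kernel]]) auto
  have Pow: "sets (restrict_space borel ?S) \<subseteq> Pow ?S"
    by (auto simp: sets_restrict_space)
  have SN: "?S \<inter> space ?N \<in> sets ?N"
    using strip_borel setsN by (simp add: sets_eq_imp_space_eq[OF setsN])
  have "restrict_space ?N ?S =
      measure_of (space (restrict_space ?N ?S)) (sets (restrict_space ?N ?S)) (emeasure (restrict_space ?N ?S))"
    by (simp add: measure_of_of_measure)
  also have "\<dots> = measure_of ?S (sets (restrict_space borel ?S)) (emeasure (restrict_space ?N ?S))"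
    using sets_restrict_space_cong[OF setsN]
    by (simp add: space_restrict_space sets_eq_imp_space_eq[OF setsN])
  also have "\<dots> = spacetime \<rho>"
    unfolding spacetime_def
  proof (rule measure_of_eq[OF Pow])
    fix A assume "A \<in> sigma_sets ?S (sets (restrict_space borel ?S))"
    then have "A \<in> sets (restrict_space borel ?S)"
      by (metis sets.sigma_sets_eq space_borel space_restrict_space Int_UNIV_right)
    then have A: "A \<in> sets borel" "A \<subseteq> ?S"
      using strip_borel by (auto simp: sets_restrict_space_iff)
    have "emeasure (restrict_space ?N ?S) A = emeasure ?N A"
      using SN A(2) by (rule emeasure_restrict_space)
    also have "\<dots> = (\<integral>\<^sup>+t. emeasure (slice_kernel t) A \<partial>lborel)"
      using A by (intro emeasure_bind[where N=borel]) auto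
    also have "\<dots> = (\<integral>\<^sup>+t\<in>{0..1}. emeasure (\<rho> t) {x. (t, x) \<in> A} \<partial>lborel)"
    proof (intro nn_integral_cong)
      fix t :: real
      show "emeasure (slice_kernel t) A = emeasure (\<rho> t) {x. (t, x) \<in> A} * indicator {0..1} t"
        using A(1) measurable_Pair_slice[of t] space_slice[of t]
        by (auto simp: slice_kernel_def emeasure_distr vimage_def)
    qed
    finally show "emeasure (restrict_space ?N ?S) A
        = (\<integral>\<^sup>+t\<in>{0..1}. emeasure (\<rho> t) {x. (t, x) \<in> A} \<partial>lborel)" .
  qed
  finally show ?thesis by simp
qed

section \<open>Measurability and integration over space-time, slice by slice\<close>

lemma sets_spacetime [measurable_cong]: "sets (spacetime \<rho>) = sets (restrict_space borel strip)"
  unfolding spacetime_eq_bind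
  by (intro sets_restrict_space_cong sets_bind[OF sets_kernel[OF measurable_slice_kernel]]) auto

lemma space_spacetime: "space (spacetime \<rho>) = strip"
  using sets_eq_imp_space_eq[OF sets_spacetime] by (simp add: space_restrict_space)

lemma measurable_spacetime_iff:
  fixes f :: "real \<times> 'a \<Rightarrow> 'b::{real_normed_vector, second_countable_topology}"
  shows "f \<in> borel_measurable (spacetime \<rho>) \<longleftrightarrow> (\<lambda>z. indicator strip z *\<^sub>R f z) \<in> borel_measurable borel"
  using borel_measurable_restrict_space_iff[of strip "borel :: (real \<times> 'a) measure" f] strip_borel
    measurable_cong_sets[OF sets_spacetime refl, of "borel :: 'b measure"]
  by simp

lemma measurable_spacetimeI:
  "f \<in> borel_measurable borel \<Longrightarrow> f \<in> borel_measurable (spacetime \<rho>)"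
  using measurable_restrict_space1[of f borel] measurable_cong_sets[OF sets_spacetime refl] by blast

lemma nn_integral_spacetime:
  assumes "f \<in> borel_measurable borel"
  shows "(\<integral>\<^sup>+z. f z \<partial>spacetime \<rho>) = (\<integral>\<^sup>+t\<in>{0..1}. (\<integral>\<^sup>+x. f (t, x) \<partial>\<rho> t) \<partial>lborel)"
proof -
  let ?N = "lborel \<bind> slice_kernel"
  have setsN: "sets ?N = sets borel"
    by (rule sets_bind[OF sets_kernel[OF measurable_slice_kernel]]) auto
  have f[measurable]: "(\<lambda>z. f z * indicator strip z) \<in> borel_measurable borel"
    using assms strip_borel by (intro borel_measurable_times_ennreal) auto
  have "(\<integral>\<^sup>+z. f z \<partial>spacetime \<rho>) = (\<integral>\<^sup>+z. f z * indicator strip z \<partial>?N)"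
    unfolding spacetime_eq_bind using strip_borel setsN
    by (intro nn_integral_restrict_space) (simp add: sets_eq_imp_space_eq[OF setsN])
  also have "\<dots> = (\<integral>\<^sup>+t. \<integral>\<^sup>+z. f z * indicator strip z \<partial>slice_kernel t \<partial>lborel)"
    by (intro nn_integral_bind[where B=borel]) auto
  also have "\<dots> = (\<integral>\<^sup>+t\<in>{0..1}. (\<integral>\<^sup>+x. f (t, x) \<partial>\<rho> t) \<partial>lborel)"
    by (intro nn_integral_cong) (subst nn_integral_slice_kernel, auto split: split_indicator)
  finally show ?thesis .
qed

lemma prob_space_spacetime: "prob_space (spacetime \<rho>)"
proof
  have "emeasure (spacetime \<rho>) (space (spacetime \<rho>)) = (\<integral>\<^sup>+z. 1 \<partial>spacetime \<rho>)"
    by simp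
  also have "\<dots> = (\<integral>\<^sup>+t\<in>{0..1}. (\<integral>\<^sup>+x. 1 \<partial>\<rho> t) \<partial>lborel)"
    by (intro nn_integral_spacetime) simp
  also have "\<dots> = (\<integral>\<^sup>+t. indicator {0..1::real} t \<partial>lborel)"
    using prob_space.emeasure_space_1[OF prob_space_slice]
    by (intro nn_integral_cong) (auto simp: indicator_def)
  finally show "emeasure (spacetime \<rho>) (space (spacetime \<rho>)) = 1"
    by simp
qed

text \<open>By Fubini almost every slice of a Lebesgue null set is Lebesgue null, hence null for
  \<open>\<rho> t\<close>. The faces at times \<open>0\<close> and \<open>1\<close> join the
  exceptional set, because weak derivatives are determined on the open strip only.\<close>

lemma AE_spacetimeI:
  assumes "AE z in lborel. z \<in> open_strip \<longrightarrow> P z"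
  shows "AE z in spacetime \<rho>. P z"
proof -
  obtain N where N: "N \<in> null_sets lborel" "{z. \<not> (z \<in> open_strip \<longrightarrow> P z)} \<subseteq> N"
    using assms by (auto simp: eventually_ae_filter)
  have "({0, 1} \<times> UNIV :: (real \<times> 'a) set) \<in> null_sets lborel"
    using lborel.emeasure_pair_measure_Times[of "{0, 1}" "lborel :: real measure" "UNIV :: 'a set"]
    by (auto simp: null_sets_def lborel_prod closed_Times emeasure_lborel_countable intro!: borel_closed)
  then have N': "N \<union> {0, 1} \<times> UNIV \<in> null_sets lborel" (is "?N \<in> _")
    using N(1) by (rule null_sets.Un[rotated])
  have N'': "?N \<in> sets borel" using N' by auto
  have "AE t in lborel. AE x in lborel. (t, x) \<notin> ?N"
    by (rule lborel_pair.AE_pair[of "\<lambda>z. z \<notin> ?N", unfolded lborel_prod, OF AE_not_in[OF N']])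
  then have 0: "AE t in lborel. t \<in> {0..1} \<longrightarrow> (\<integral>\<^sup>+x. indicator ?N (t, x) \<partial>\<rho> t) = 0"
  proof eventually_elim
    fix t :: real assume ae: "AE x in lborel. (t, x) \<notin> ?N"
    have m: "(\<lambda>x. (t, x)) \<in> borel \<rightarrow>\<^sub>M (borel :: (real \<times> 'a) measure)"
      by (intro borel_measurable_continuous_onI continuous_intros)
    have s: "{x. (t, x) \<in> ?N} \<in> sets borel"
      using measurable_sets[OF m N''] by (simp add: vimage_def)
    have "{x. (t, x) \<in> ?N} \<in> null_sets lborel"
      using ae s by (subst AE_iff_null_sets) auto
    then show "t \<in> {0..1} \<longrightarrow> (\<integral>\<^sup>+x. indicator ?N (t, x) \<partial>\<rho> t) = 0"
    proof safe
      assume t: "t \<in> {0..1}"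
      have "(\<integral>\<^sup>+x. indicator ?N (t, x) \<partial>\<rho> t) = (\<integral>\<^sup>+x. indicator {x. (t, x) \<in> ?N} x \<partial>\<rho> t)"
        by (intro nn_integral_cong) (simp add: indicator_def)
      also have "\<dots> = emeasure (\<rho> t) {x. (t, x) \<in> ?N}"
        using s sets_slice[OF t] by simp
      also have "\<dots> = 0"
        using \<open>{x. (t, x) \<in> ?N} \<in> null_sets lborel\<close> null_sets_slice[OF t] by blast
      finally show "(\<integral>\<^sup>+x. indicator ?N (t, x) \<partial>\<rho> t) = 0" .
    qed
  qed
  have "(\<integral>\<^sup>+z. indicator ?N z \<partial>spacetime \<rho>) = (\<integral>\<^sup>+t\<in>{0..1}. (\<integral>\<^sup>+x. indicator ?N (t, x) \<partial>\<rho> t) \<partial>lborel)"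
    using N'' by (intro nn_integral_spacetime) auto
  also have "\<dots> = (\<integral>\<^sup>+(t::real). 0 \<partial>lborel)"
    by (rule nn_integral_cong_AE) (use 0 in \<open>eventually_elim, auto split: split_indicator\<close>)
  finally have "(\<integral>\<^sup>+z. indicator ?N z \<partial>spacetime \<rho>) = 0"
    by simp
  then have a: "AE z in spacetime \<rho>. indicator ?N z = (0 :: ennreal)"
    using nn_integral_0_iff_AE[OF measurable_spacetimeI[OF borel_measurable_indicator[OF N'']]] by simp
  have b: "AE z in spacetime \<rho>. z \<in> strip"
    using AE_space[of "spacetime \<rho>"] by (simp only: space_spacetime)
  show ?thesis
    using eventually_conj[OF a b]
  proof (rule eventually_mono)
    fix z :: "real \<times> 'a" assume z: "indicator ?N z = (0 :: ennreal) \<and> z \<in> strip"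
    then have nN: "z \<notin> N" and "z \<notin> {0, 1} \<times> UNIV"
      by (auto simp: indicator_eq_0_iff)
    with z have "fst z \<noteq> 0" "fst z \<noteq> 1" "0 \<le> fst z" "fst z \<le> 1"
      by (auto simp: mem_Times_iff)
    then have "z \<in> open_strip"
      by (simp add: mem_Times_iff)
    then show "P z"
      using N(2) nN by blast
  qed
qed

text \<open>Measurability for \<open>spacetime \<rho>\<close> says nothing off the strip. The
  extension by zero is a Borel function on the whole product, as the kernel lemmas require.\<close>

lemma measurable_extend_strip:
  fixes f :: "real \<times> 'a \<Rightarrow> 'b::{real_normed_vector, second_countable_topology}"
  assumes "f \<in> borel_measurable (spacetime \<rho>)"
  obtains f' where "f' \<in> borel_measurable borel" "\<forall>z\<in>strip. f' z = f z"
  using assms that[of "\<lambda>z. indicator strip z *\<^sub>R f z"] unfolding measurable_spacetime_iff by simp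

lemma measurable_spacetime_slice:
  fixes f :: "real \<times> 'a \<Rightarrow> 'b::{real_normed_vector, second_countable_topology}"
  assumes "f \<in> borel_measurable (spacetime \<rho>)" "t \<in> {0..1}"
  shows "(\<lambda>x. f (t, x)) \<in> borel_measurable (\<rho> t)"
proof -
  obtain f' where f': "f' \<in> borel_measurable borel" "\<forall>z\<in>strip. f' z = f z"
    using assms(1) by (rule measurable_extend_strip)
  have "(\<lambda>x. f' (t, x)) \<in> borel_measurable (\<rho> t)"
    using measurable_compose[OF measurable_Pair_slice f'(1)] assms(2) .
  then show ?thesis using f'(2) assms(2) by simp
qed

lemma spacetime_cong:
  assumes "\<And>z. z \<in> strip \<Longrightarrow> f z = g z"
  shows "integral\<^sup>L (spacetime \<rho>) f = integral\<^sup>L (spacetime \<rho>) g"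
    "integrable (spacetime \<rho>) f \<longleftrightarrow> integrable (spacetime \<rho>) g"
  using assms by (auto simp: space_spacetime intro!: Bochner_Integration.integral_cong Bochner_Integration.integrable_cong)

lemma integral_slice_kernel:
  fixes f :: "real \<times> 'a \<Rightarrow> real"
  assumes "f \<in> borel_measurable borel"
  shows "(\<integral>z. f z \<partial>slice_kernel t) = indicator {0..1} t * (\<integral>x. f (t, x) \<partial>\<rho> t)"
proof (cases "t \<in> {0..1}")
  case True
  then show ?thesis
    using assms measurable_Pair_slice by (simp add: slice_kernel_def integral_distr)
next
  case False
  have "Pair t \<in> null_measure borel \<rightarrow>\<^sub>M (borel :: (real \<times> 'a) measure)"
    using measurable_Pair_borel by (simp add: measurable_cong_sets[OF sets_null_measure refl])
  then show ?thesis
    using False assms by (auto simp: slice_kernel_def integral_distr)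
qed

lemma measurable_slice_integral:
  fixes f :: "real \<times> 'a \<Rightarrow> real"
  assumes f: "f \<in> borel_measurable borel"
  shows "(\<lambda>t. indicator {0..1} t * (\<integral>x. f (t, x) \<partial>\<rho> t)) \<in> borel_measurable borel"
  using measurable_compose[OF measurable_slice_kernel integral_measurable_subprob_algebra[OF f]]
  by (simp add: integral_slice_kernel[OF f])

lemma measurable_slice_nn_integral:
  assumes f: "f \<in> borel_measurable borel"
  shows "(\<lambda>t. (\<integral>\<^sup>+x. f (t, x) \<partial>\<rho> t) * indicator {0..1} t) \<in> borel_measurable borel"
  using measurable_compose[OF measurable_slice_kernel nn_integral_measurable_subprob_algebra[OF f]]
  by (simp add: nn_integral_slice_kernel[OF f])

lemma AE_slice_nn_integral_finite:
  assumes f: "f \<in> borel_measurable borel" "(\<integral>\<^sup>+z. f z \<partial>spacetime \<rho>) < \<infinity>"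
  shows "AE t in lborel. t \<in> {0..1} \<longrightarrow> (\<integral>\<^sup>+x. f (t, x) \<partial>\<rho> t) < \<infinity>"
proof -
  have "AE t in lborel. (\<integral>\<^sup>+x. f (t, x) \<partial>\<rho> t) * indicator {0..1} t \<noteq> \<infinity>"
    using f(2) measurable_slice_nn_integral[OF f(1)] unfolding nn_integral_spacetime[OF f(1)]
    by (intro nn_integral_PInf_AE) auto
  then show ?thesis
    by eventually_elim (auto simp: less_top)
qed

lemma AE_slice_integrable:
  fixes f :: "real \<times> 'a \<Rightarrow> real"
  assumes f: "integrable (spacetime \<rho>) f"
  shows "AE t in lborel. t \<in> {0..1} \<longrightarrow> integrable (\<rho> t) (\<lambda>x. f (t, x))"
proof -
  obtain f' where f': "f' \<in> borel_measurable borel" "\<forall>z\<in>strip. f' z = f z"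
    using borel_measurable_integrable[OF f] by (rule measurable_extend_strip)
  have "(\<integral>\<^sup>+z. norm (f' z) \<partial>spacetime \<rho>) = (\<integral>\<^sup>+z. norm (f z) \<partial>spacetime \<rho>)"
    using f'(2) by (intro nn_integral_cong) (auto simp: space_spacetime)
  then have "AE t in lborel. t \<in> {0..1} \<longrightarrow> (\<integral>\<^sup>+x. norm (f' (t, x)) \<partial>\<rho> t) < \<infinity>"
    using f'(1) f by (intro AE_slice_nn_integral_finite) (auto simp: integrable_iff_bounded)
  then show ?thesis
  proof eventually_elim
    fix t :: real assume fin: "t \<in> {0..1} \<longrightarrow> (\<integral>\<^sup>+x. norm (f' (t, x)) \<partial>\<rho> t) < \<infinity>"
    show "t \<in> {0..1} \<longrightarrow> integrable (\<rho> t) (\<lambda>x. f (t, x))"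
    proof
      assume t: "t \<in> {0..1}"
      then show "integrable (\<rho> t) (\<lambda>x. f (t, x))"
        using fin f'(2) measurable_spacetime_slice[OF borel_measurable_integrable[OF f] t]
        by (simp add: integrable_iff_bounded)
    qed
  qed
qed

text \<open>Fubini is available for extended nonnegative integrals. Inner integrals are finite at
  almost every time, and there they coincide with the Bochner integrals of the slices.\<close>

lemma integral_spacetime_nonneg:
  fixes f :: "real \<times> 'a \<Rightarrow> real"
  assumes f: "integrable (spacetime \<rho>) f" "f \<in> borel_measurable borel" "\<And>z. 0 \<le> f z"
  shows "set_integrable lborel {0..1} (\<lambda>t. \<integral>x. f (t, x) \<partial>\<rho> t)"
    and "(\<integral>z. f z \<partial>spacetime \<rho>) = (LBINT t:{0..1}. (\<integral>x. f (t, x) \<partial>\<rho> t))"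
proof -
  have eq: "(\<integral>\<^sup>+z. f z \<partial>spacetime \<rho>) = (\<integral>\<^sup>+t. indicator {0..1} t * (\<integral>x. f (t, x) \<partial>\<rho> t) \<partial>lborel)"
  proof (subst nn_integral_spacetime)
    show "(\<integral>\<^sup>+t\<in>{0..1}. (\<integral>\<^sup>+x. f (t, x) \<partial>\<rho> t) \<partial>lborel)
        = (\<integral>\<^sup>+t. indicator {0..1} t * (\<integral>x. f (t, x) \<partial>\<rho> t) \<partial>lborel)"
      by (rule nn_integral_cong_AE) (use AE_slice_integrable[OF f(1)] in
        \<open>eventually_elim, use f(3) in \<open>auto simp: nn_integral_eq_integral split: split_indicator\<close>\<close>)
  qed (use f(2) in simp)
  have nn: "0 \<le> indicator {0..1} t * (\<integral>x. f (t, x) \<partial>\<rho> t)" for t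
    using f(3) by (auto intro: mult_nonneg_nonneg)
  note m = measurable_slice_integral[OF f(2)]
  have "(\<integral>\<^sup>+z. f z \<partial>spacetime \<rho>) < \<infinity>"
    using f by (simp add: integrable_iff_bounded)
  then show "set_integrable lborel {0..1} (\<lambda>t. \<integral>x. f (t, x) \<partial>\<rho> t)"
    using m nn f(3) unfolding set_integrable_def eq by (simp add: integrable_iff_bounded abs_mult)
  have "(\<integral>z. f z \<partial>spacetime \<rho>) = enn2real (\<integral>\<^sup>+z. f z \<partial>spacetime \<rho>)"
    using f by (intro integral_eq_nn_integral) (auto intro!: measurable_spacetimeI)
  also have "\<dots> = (\<integral>t. indicator {0..1} t * (\<integral>x. f (t, x) \<partial>\<rho> t) \<partial>lborel)"
    unfolding eq using nn m by (intro integral_eq_nn_integral[symmetric]) auto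
  finally show "(\<integral>z. f z \<partial>spacetime \<rho>) = (LBINT t:{0..1}. (\<integral>x. f (t, x) \<partial>\<rho> t))"
    unfolding set_lebesgue_integral_def by simp
qed

lemma
  fixes f :: "real \<times> 'a \<Rightarrow> real"
  assumes f: "integrable (spacetime \<rho>) f"
  shows set_integrable_slice_integral: "set_integrable lborel {0..1} (\<lambda>t. \<integral>x. f (t, x) \<partial>\<rho> t)"
    and integral_spacetime: "(\<integral>z. f z \<partial>spacetime \<rho>) = (LBINT t:{0..1}. (\<integral>x. f (t, x) \<partial>\<rho> t))"
proof -
  obtain f' where f': "f' \<in> borel_measurable borel" "\<forall>z\<in>strip. f' z = f z"
    using borel_measurable_integrable[OF f] by (rule measurable_extend_strip)
  have int: "integrable (spacetime \<rho>) f'"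
    using f spacetime_cong(2)[of f' f] f'(2) by simp
  let ?p = "\<lambda>z. max 0 (f' z)" and ?n = "\<lambda>z. max 0 (- f' z)"
  have p: "integrable (spacetime \<rho>) ?p" "?p \<in> borel_measurable borel" "\<And>z. 0 \<le> ?p z"
    and n: "integrable (spacetime \<rho>) ?n" "?n \<in> borel_measurable borel" "\<And>z. 0 \<le> ?n z"
    using int f'(1) by auto
  note ip = integral_spacetime_nonneg[OF p] and i_n = integral_spacetime_nonneg[OF n]
  \<comment> \<open>The slice integrals of the positive and the negative part may be subtracted only
    where both parts are integrable; at the remaining times a Bochner integral can have the default
    value \<open>0\<close>.\<close>
  have ae: "AE t in lborel. t \<in> {0..1} \<longrightarrow>
      (\<integral>x. f (t, x) \<partial>\<rho> t) = (\<integral>x. ?p (t, x) \<partial>\<rho> t) - (\<integral>x. ?n (t, x) \<partial>\<rho> t)"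
    using AE_slice_integrable[OF p(1)] AE_slice_integrable[OF n(1)]
  proof eventually_elim
    case (elim t)
    show ?case
    proof
      assume t: "t \<in> {0..1}"
      have "(\<integral>x. f (t, x) \<partial>\<rho> t) = (\<integral>x. ?p (t, x) - ?n (t, x) \<partial>\<rho> t)"
        using t f'(2) by (intro Bochner_Integration.integral_cong) auto
      also have "\<dots> = (\<integral>x. ?p (t, x) \<partial>\<rho> t) - (\<integral>x. ?n (t, x) \<partial>\<rho> t)"
        using elim t by (intro Bochner_Integration.integral_diff) auto
      finally show "(\<integral>x. f (t, x) \<partial>\<rho> t) = (\<integral>x. ?p (t, x) \<partial>\<rho> t) - (\<integral>x. ?n (t, x) \<partial>\<rho> t)" .
    qed
  qed
  have m: "(\<lambda>t. indicator {0..1} t *\<^sub>R (\<integral>x. f (t, x) \<partial>\<rho> t)) \<in> borel_measurable lborel"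
  proof -
    have "(\<lambda>t. indicator {0..1} t *\<^sub>R (\<integral>x. f (t, x) \<partial>\<rho> t)) = (\<lambda>t. indicator {0..1} t * (\<integral>x. f' (t, x) \<partial>\<rho> t))"
      using f'(2) by (auto simp: fun_eq_iff split: split_indicator)
    then show ?thesis using measurable_slice_integral[OF f'(1)] by simp
  qed
  have sd: "set_integrable lborel {0..1} (\<lambda>t. (\<integral>x. ?p (t, x) \<partial>\<rho> t) - (\<integral>x. ?n (t, x) \<partial>\<rho> t))"
    using ip(1) i_n(1) by (rule set_integral_diff(1))
  show "set_integrable lborel {0..1} (\<lambda>t. \<integral>x. f (t, x) \<partial>\<rho> t)"
    unfolding set_integrable_def
    by (rule Bochner_Integration.integrable_cong_AE_imp[OF sd[unfolded set_integrable_def] m])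
      (use ae in \<open>eventually_elim, auto split: split_indicator\<close>)
  have "(\<integral>z. f z \<partial>spacetime \<rho>) = (\<integral>z. ?p z - ?n z \<partial>spacetime \<rho>)"
    using f'(2) by (intro spacetime_cong(1)) auto
  also have "\<dots> = (LBINT t:{0..1}. (\<integral>x. ?p (t, x) \<partial>\<rho> t)) - (LBINT t:{0..1}. (\<integral>x. ?n (t, x) \<partial>\<rho> t))"
    using p(1) n(1) ip(2) i_n(2) by simp
  also have "\<dots> = (LBINT t:{0..1}. (\<integral>x. ?p (t, x) \<partial>\<rho> t) - (\<integral>x. ?n (t, x) \<partial>\<rho> t))"
    using set_integral_diff(2)[OF ip(1) i_n(1)] by simp
  also have "\<dots> = (LBINT t:{0..1}. (\<integral>x. f (t, x) \<partial>\<rho> t))"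
    unfolding set_lebesgue_integral_def
    by (rule integral_cong_AE[OF borel_measurable_integrable[OF sd[unfolded set_integrable_def]] m])
      (use ae in \<open>eventually_elim, auto split: split_indicator\<close>)
  finally show "(\<integral>z. f z \<partial>spacetime \<rho>) = (LBINT t:{0..1}. (\<integral>x. f (t, x) \<partial>\<rho> t))" .
qed

section \<open>The space-time density and the comparison with Lebesgue measure\<close>

lemma density_spacetime: "density (restrict_space lborel strip) (spacetime_density \<rho>) = spacetime \<rho>"
  unfolding spacetime_density_def
proof (rule sigma_finite_measure.density_RN_deriv)
  show "sigma_finite_measure (restrict_space lborel (strip :: (real \<times> 'a) set))"
    using strip_borel by (intro sigma_finite_measure_restrict_space sigma_finite_lborel) auto
  show s: "sets (spacetime \<rho>) = sets (restrict_space lborel strip)"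
    using sets_spacetime sets_restrict_space_cong[of borel lborel] by simp
  show "absolutely_continuous (restrict_space lborel strip) (spacetime \<rho>)"
    unfolding absolutely_continuous_def
  proof
    fix A assume A: "A \<in> null_sets (restrict_space lborel (strip :: (real \<times> 'a) set))"
    then have "A \<in> null_sets lborel"
      using strip_borel by (auto simp: null_sets_restrict_space)
    then have "AE z in spacetime \<rho>. z \<notin> A"
      by (intro AE_spacetimeI) (auto dest: AE_not_in)
    moreover have "A \<in> sets (spacetime \<rho>)"
      unfolding s using A by auto
    ultimately show "A \<in> null_sets (spacetime \<rho>)"
      by (subst AE_iff_null_sets) auto
  qed
qed

text \<open>Take the weight \<open>c * r\<close> in \<open>abs_le_weighted_square\<close>, where r
  is the density at z. The term with r * (f z)^2 integrates to a space-time integral, and the other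
  term leaves the reciprocal density on \<open>C\<close>.\<close>

lemma nn_integral_lborel_le_spacetime:
  fixes f :: "real \<times> 'a \<Rightarrow> real"
  assumes f: "f \<in> borel_measurable borel" and C: "C \<in> sets borel" "C \<subseteq> strip" and c: "c > 0"
  shows "(\<integral>\<^sup>+z\<in>C. \<bar>f z\<bar> \<partial>lborel) \<le> ennreal c * (\<integral>\<^sup>+z. ennreal ((f z)\<^sup>2) \<partial>spacetime \<rho>)
    + ennreal (1 / c) * (\<integral>\<^sup>+z\<in>C. inverse (spacetime_density \<rho> z) \<partial>restrict_space lborel strip)"
proof -
  let ?L = "restrict_space lborel (strip :: (real \<times> 'a) set)" and ?r = "spacetime_density \<rho>"
  have rm[measurable]: "?r \<in> borel_measurable ?L"
    unfolding spacetime_density_def by measurable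
  have fm[measurable]: "f \<in> borel_measurable ?L"
    using f by (intro measurable_restrict_space1) simp
  have Cm[measurable]: "C \<in> sets ?L"
    using C strip_borel by (subst sets_restrict_space_iff) auto
  have pt: "ennreal \<bar>f z\<bar> * indicator C z
      \<le> ennreal c * (?r z * ennreal ((f z)\<^sup>2)) + ennreal (1 / c) * (inverse (?r z) * indicator C z)" for z
  \<comment> \<open>The degenerate values of the density are harmless in \<open>ennreal\<close>:
    where it is \<open>0\<close>, its inverse is infinite and the second term dominates on
    \<open>C\<close>; where it is infinite, the first term is infinite unless
    \<open>f z = 0\<close>.\<close>
  proof (cases "?r z")
    case (real r)
    show ?thesis
    proof (cases "r = 0")
      case True
      then show ?thesis using real c by (auto simp: ennreal_mult_top split: split_indicator)
    next
      case False
      then have r: "r > 0" using real by simp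
      have "\<bar>f z\<bar> \<le> c * (r * (f z)\<^sup>2) + 1 / c * inverse r"
      proof -
        have "\<bar>f z\<bar> \<le> (c * r) * (f z)\<^sup>2 + 1 / (c * r)"
          using c r by (intro abs_le_weighted_square) simp
        also have "\<dots> = c * (r * (f z)\<^sup>2) + 1 / c * inverse r"
          by (simp add: divide_inverse)
        finally show ?thesis .
      qed
      moreover have "inverse (ennreal r) = ennreal (inverse r)"
        using r by (simp add: inverse_ennreal)
      ultimately show ?thesis
        using real c r by (auto simp: ennreal_mult'[symmetric] ennreal_plus[symmetric]
            simp del: ennreal_plus split: split_indicator intro!: ennreal_leI)
    qed
  next
    case top
    show ?thesis
    proof (cases "f z = 0")
      case False
      then have "?r z * ennreal ((f z)\<^sup>2) = top"
        using top by (simp add: ennreal_top_mult)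
      then show ?thesis using c by (simp add: ennreal_mult_top)
    qed simp
  qed
  have "(\<integral>\<^sup>+z\<in>C. \<bar>f z\<bar> \<partial>lborel) = (\<integral>\<^sup>+z. ennreal \<bar>f z\<bar> * indicator C z \<partial>?L)"
    using strip_borel C(2)
    by (subst nn_integral_restrict_space) (auto intro!: nn_integral_cong split: split_indicator)
  also have "\<dots> \<le> (\<integral>\<^sup>+z. ennreal c * (?r z * ennreal ((f z)\<^sup>2)) + ennreal (1 / c) * (inverse (?r z) * indicator C z) \<partial>?L)"
    by (intro nn_integral_mono pt)
  also have "\<dots> = ennreal c * (\<integral>\<^sup>+z. ?r z * ennreal ((f z)\<^sup>2) \<partial>?L)
      + ennreal (1 / c) * (\<integral>\<^sup>+z\<in>C. inverse (?r z) \<partial>?L)"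
    by (simp add: nn_integral_add nn_integral_cmult)
  also have "(\<integral>\<^sup>+z. ?r z * ennreal ((f z)\<^sup>2) \<partial>?L) = (\<integral>\<^sup>+z. ennreal ((f z)\<^sup>2) \<partial>spacetime \<rho>)"
    by (subst density_spacetime[symmetric], subst nn_integral_density) auto
  finally show ?thesis .
qed

end

section \<open>Square integrable functions\<close>

lemma L2_iff: "f \<in> L2 M \<longleftrightarrow> f \<in> borel_measurable M \<and> integrable M (\<lambda>x. (f x)\<^sup>2)"
  for f :: "'x \<Rightarrow> real"
  by (simp add: L2_def)

lemma L2_integrable_mult:
  fixes f g :: "'x \<Rightarrow> real"
  assumes "f \<in> L2 M" "g \<in> L2 M"
  shows "integrable M (\<lambda>x. f x * g x)"
proof (rule Bochner_Integration.integrable_bound)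
  show "integrable M (\<lambda>x. (f x)\<^sup>2 + (g x)\<^sup>2)"
    using assms by (auto simp: L2_iff)
  have "\<bar>f x * g x\<bar> \<le> (f x)\<^sup>2 + (g x)\<^sup>2" for x
  proof -
    have "2 * (\<bar>f x\<bar> * \<bar>g x\<bar>) \<le> (f x)\<^sup>2 + (g x)\<^sup>2"
      using sum_squares_bound[of "\<bar>f x\<bar>" "\<bar>g x\<bar>"] by simp
    moreover have "0 \<le> \<bar>f x\<bar> * \<bar>g x\<bar>" by simp
    ultimately show ?thesis unfolding abs_mult by linarith
  qed
  then show "AE x in M. norm (f x * g x) \<le> norm ((f x)\<^sup>2 + (g x)\<^sup>2)"
    by (intro AE_I2) (simp add: order_trans[OF _ abs_ge_self])
qed (use assms in \<open>auto simp: L2_iff\<close>)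

lemma L2_add:
  fixes f g :: "'x \<Rightarrow> real"
  assumes "f \<in> L2 M" "g \<in> L2 M"
  shows "(\<lambda>x. c * f x + g x) \<in> L2 M"
proof -
  have "(\<lambda>x. (c * f x + g x)\<^sup>2) = (\<lambda>x. c\<^sup>2 * (f x)\<^sup>2 + (2 * c) * (f x * g x) + (g x)\<^sup>2)"
    by (auto simp: power2_eq_square algebra_simps)
  then show ?thesis
    using assms L2_integrable_mult[OF assms] by (auto simp: L2_iff)
qed

lemma (in finite_measure) L2_integrable:
  fixes f :: "'a \<Rightarrow> real"
  assumes "f \<in> L2 M"
  shows "integrable M f"
  using L2_integrable_mult[OF assms, of "\<lambda>_. 1"] by (simp add: L2_iff)

lemma L2_cong_AE:
  fixes f g :: "'x \<Rightarrow> real"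
  assumes f: "f \<in> L2 M" and g: "g \<in> borel_measurable M" and eq: "AE x in M. f x = g x"
  shows "g \<in> L2 M"
proof -
  have "AE x in M. (f x)\<^sup>2 = (g x)\<^sup>2"
    using eq by eventually_elim simp
  moreover have "integrable M (\<lambda>x. (f x)\<^sup>2)"
    using f by (simp add: L2_iff)
  ultimately have "integrable M (\<lambda>x. (g x)\<^sup>2)"
    using g by (intro Bochner_Integration.integrable_cong_AE_imp[of M "\<lambda>x. (f x)\<^sup>2" "\<lambda>x. (g x)\<^sup>2"]) simp_all
  then show ?thesis using g by (simp add: L2_iff)
qed

text \<open>Separability in the uniform distance, with the dense set chosen inside the given family.
  A code \<open>(n, k, h)\<close> states that the function varies by less than 1 / (k + 1) at scale
  1 / (n + 1), and that on a finite net of that scale it is within 1 / (k + 1) of a table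
  \<open>h\<close> of values from a countable dense set. There are countably many codes, functions
  with a common code are uniformly close, and \<open>r\<close> selects one representative for each
  code that occurs.\<close>

lemma countable_uniformly_dense:
  fixes F :: "'i \<Rightarrow> 'b::metric_space \<Rightarrow> 'c::{metric_space, second_countable_topology}"
  assumes K: "compact K" and cont: "\<And>i. i \<in> S \<Longrightarrow> continuous_on K (F i)"
  obtains T where "countable T" "T \<subseteq> S"
    "\<And>i e. i \<in> S \<Longrightarrow> 0 < e \<Longrightarrow> \<exists>j\<in>T. \<forall>x\<in>K. dist (F i x) (F j x) < e"
proof -
  obtain D :: "'c set" where D: "countable D" "\<And>X. open X \<Longrightarrow> X \<noteq> {} \<Longrightarrow> \<exists>d\<in>D. d \<in> X"
    using countable_dense_exists[where 'a='c] by blast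
  have "\<exists>N. finite N \<and> N \<subseteq> K \<and> K \<subseteq> (\<Union>x\<in>N. ball x (1 / Suc n))" for n :: nat
    using K compact_imp_seq_compact seq_compact_imp_totally_bounded by (metis zero_less_divide_1_iff of_nat_0_less_iff zero_less_Suc)
  then obtain N where N: "\<And>n. finite (N n)" "\<And>n. N n \<subseteq> K" "\<And>n. K \<subseteq> (\<Union>x\<in>N n. ball x (1 / Suc n))"
    by metis
  define good where "good n k h i \<longleftrightarrow>
    (\<forall>x\<in>K. \<forall>y\<in>K. dist x y < 1 / Suc n \<longrightarrow> dist (F i x) (F i y) < 1 / Suc k) \<and>
    (\<forall>x\<in>N n. dist (F i x) (h x) < 1 / Suc k)" for n k :: nat and h i
  define I where "I = {(n, k, h). h \<in> N n \<rightarrow>\<^sub>E D \<and> (\<exists>i\<in>S. good n k h i)}"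
  define r where "r = (\<lambda>(n, k, h). SOME i. i \<in> S \<and> good n k h i)"
  have r: "r (n, k, h) \<in> S \<and> good n k h (r (n, k, h))" if "(n, k, h) \<in> I" for n k h
    unfolding r_def prod.case by (rule someI_ex) (use that in \<open>auto simp: I_def\<close>)
  have "I \<subseteq> (SIGMA n:UNIV. UNIV \<times> (N n \<rightarrow>\<^sub>E D))"
    by (auto simp: I_def)
  moreover have "countable (SIGMA n:UNIV. (UNIV :: nat set) \<times> (N n \<rightarrow>\<^sub>E D))"
    by (intro countable_SIGMA countable_PiE N(1) D(1) countableI_type)
  ultimately have "countable I"
    by (rule countable_subset)
  then have "countable (r ` I)"
    by simp
  moreover have "r ` I \<subseteq> S"
    using r by auto
  moreover have "\<exists>j\<in>r ` I. \<forall>x\<in>K. dist (F i x) (F j x) < e" if i: "i \<in> S" and e: "0 < e" for i and e :: real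
  proof -
    obtain k where k: "4 / e < real k"
      using reals_Archimedean2 by blast
    \<comment> \<open>The path from \<open>F i x\<close> to \<open>F ?j x\<close> has four legs: to
      a net point y, to the table entry at y, to the value of the representative at y, and back to
      x.\<close>
    then have ke: "4 * (1 / Suc k) < e"
      using e by (simp add: field_simps)
    have "uniformly_continuous_on K (F i)"
      using cont[OF i] K by (rule compact_uniformly_continuous)
    then obtain d where d: "d > 0" "\<And>x y. x \<in> K \<Longrightarrow> y \<in> K \<Longrightarrow> dist x y < d \<Longrightarrow> dist (F i x) (F i y) < 1 / Suc k"
      unfolding uniformly_continuous_on_def by (metis dist_commute of_nat_0_less_iff zero_less_Suc zero_less_divide_1_iff)
    obtain n where n: "1 / Suc n < d"
      using d(1) nat_approx_posE by blast
    have "\<exists>c\<in>D. dist (F i x) c < 1 / Suc k" for x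
      using D(2)[of "ball (F i x) (1 / Suc k)"] by auto
    then obtain c where c: "\<And>x. c x \<in> D" "\<And>x. dist (F i x) (c x) < 1 / Suc k"
      by metis
    define h where "h = restrict c (N n)"
    have "good n k h i"
      using d(2) n c(2) by (auto simp: good_def h_def)
    then have I: "(n, k, h) \<in> I"
      using i c(1) by (auto simp: I_def h_def)
    let ?j = "r (n, k, h)"
    have j: "good n k h ?j" using r[OF I] by blast
    have "dist (F i x) (F ?j x) < e" if x: "x \<in> K" for x
    proof -
      obtain y where y: "y \<in> N n" "dist y x < 1 / Suc n"
        using N(3)[of n] x by auto
      then have "y \<in> K" using N(2) by blast
      have "dist (F i x) (F i y) < 1 / Suc k" "dist (F ?j x) (F ?j y) < 1 / Suc k"
        "dist (F i y) (h y) < 1 / Suc k" "dist (F ?j y) (h y) < 1 / Suc k"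
        using \<open>good n k h i\<close> j x y \<open>y \<in> K\<close> unfolding good_def by (auto simp: dist_commute)
      then show ?thesis
        using ke dist_triangle[of "F i x" "F ?j x" "F i y"] dist_triangle[of "F i y" "F ?j x" "h y"]
          dist_triangle[of "h y" "F ?j x" "F ?j y"]
        by (simp add: dist_commute)
    qed
    then show ?thesis using I by blast
  qed
  ultimately show thesis by (rule that)
qed

section \<open>The spaces \<open>H1_x\<close> and \<open>X_0_1\<close>\<close>

lemma has_weak_derivative_cong:
  assumes "\<And>x. x \<in> U \<Longrightarrow> f x = f' x" "\<And>x. x \<in> U \<Longrightarrow> g x = g' x" "has_weak_derivative f g v U"
  shows "has_weak_derivative f' g' v U"
proof -
  have li: "locally_integrable_on h' U"
    if "\<And>x. x \<in> U \<Longrightarrow> h x = h' x" "locally_integrable_on h U" for h h' :: "'a \<Rightarrow> real"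
    unfolding locally_integrable_on_def
  proof (intro allI impI)
    fix C :: "'a set" assume C: "compact C" "C \<subseteq> U"
    have "set_integrable lborel C h"
      using that(2) C by (rule locally_integrable_onD)
    moreover have "(\<lambda>x. indicator C x *\<^sub>R h x) = (\<lambda>x. indicator C x *\<^sub>R h' x)"
      using that(1) C(2) by (auto simp: fun_eq_iff split: split_indicator)
    ultimately show "set_integrable lborel C h'"
      unfolding set_integrable_def by simp
  qed
  have "(LINT x:U|lborel. f' x * frechet_derivative \<phi> (at x) v) = (LINT x:U|lborel. f x * frechet_derivative \<phi> (at x) v)"
    "(LINT x:U|lborel. g' x * \<phi> x) = (LINT x:U|lborel. g x * \<phi> x)" for \<phi>
    unfolding set_lebesgue_integral_def using assms(1,2)
    by (auto intro!: Bochner_Integration.integral_cong split: split_indicator)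
  then show ?thesis
    using assms(3) li[OF assms(1)] li[OF assms(2)] unfolding has_weak_derivative_def by simp
qed

locale ac_curve_recip = ac_curve +
  assumes reciprocal: "reciprocal_density_L1_loc \<rho>"
begin

sublocale st: prob_space "spacetime \<rho>"
  by (rule prob_space_spacetime)

lemma zero_pair_Basis: "b \<in> Basis \<Longrightarrow> (0, b) \<in> (Basis :: (real \<times> 'a) set)"
  by (simp add: Basis_prod_def)

text \<open>\<open>I\<close> is the integral of the reciprocal density over \<open>C\<close>. It is
  fixed before \<open>f\<close> and \<open>c\<close>, so for a sequence tending to zero in L2 one
  first takes \<open>c\<close> large and then lets the sequence run.\<close>

lemma set_integral_abs_le_spacetime:
  assumes C: "compact C" "C \<subseteq> strip"
  obtains I where "0 \<le> I"
    "\<And>f :: real \<times> 'a \<Rightarrow> real. f \<in> L2 (spacetime \<rho>) \<Longrightarrow> set_integrable lborel C f"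
    "\<And>(f :: real \<times> 'a \<Rightarrow> real) c. f \<in> L2 (spacetime \<rho>) \<Longrightarrow> 0 < c \<Longrightarrow>
      (LINT z:C|lborel. \<bar>f z\<bar>) \<le> c * (\<integral>z. (f z)\<^sup>2 \<partial>spacetime \<rho>) + I / c"
proof -
  define J where "J = (\<integral>\<^sup>+z\<in>C. inverse (spacetime_density \<rho> z) \<partial>restrict_space lborel strip)"
  have J: "J < \<infinity>"
    using reciprocal C unfolding reciprocal_density_L1_loc_def J_def by blast
  have CB: "C \<in> sets borel"
    using C(1) by (intro borel_closed compact_imp_closed)
  have key: "set_integrable lborel C f \<and>
      (\<forall>c>0. (LINT z:C|lborel. \<bar>f z\<bar>) \<le> c * (\<integral>z. (f z)\<^sup>2 \<partial>spacetime \<rho>) + enn2real J / c)"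
    if f: "f \<in> L2 (spacetime \<rho>)" for f :: "real \<times> 'a \<Rightarrow> real"
  proof -
    obtain f' where f': "f' \<in> borel_measurable borel" "\<forall>z\<in>strip. f' z = f z"
      using f unfolding L2_iff by (metis measurable_extend_strip)
    have fz: "f' z = f z" if "z \<in> strip" for z
      using f'(2) that by blast
    have int: "integrable (spacetime \<rho>) (\<lambda>z. (f' z)\<^sup>2)"
      using f fz unfolding L2_iff by (subst spacetime_cong(2)[of _ "\<lambda>z. (f z)\<^sup>2"]) simp_all
    have eq: "(\<integral>z. (f' z)\<^sup>2 \<partial>spacetime \<rho>) = (\<integral>z. (f z)\<^sup>2 \<partial>spacetime \<rho>)"
      using fz by (intro spacetime_cong(1)) simp
    let ?A = "\<integral>z. (f' z)\<^sup>2 \<partial>spacetime \<rho>"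
    have le: "(\<integral>\<^sup>+z\<in>C. \<bar>f' z\<bar> \<partial>lborel) \<le> ennreal (c * ?A + enn2real J / c)" if "0 < c" for c
    proof -
      have "(\<integral>\<^sup>+z. ennreal ((f' z)\<^sup>2) \<partial>spacetime \<rho>) = ennreal ?A"
        using int by (intro nn_integral_eq_integral) auto
      moreover have "J = ennreal (enn2real J)" using J by simp
      ultimately have "ennreal c * (\<integral>\<^sup>+z. ennreal ((f' z)\<^sup>2) \<partial>spacetime \<rho>) + ennreal (1 / c) * J
          = ennreal c * ennreal ?A + ennreal (1 / c) * ennreal (enn2real J)"
        by (simp only:)
      also have "\<dots> = ennreal (c * ?A + enn2real J / c)"
        using that by (simp add: ennreal_mult'[symmetric] ennreal_plus[symmetric] del: ennreal_plus)
      finally have "ennreal c * (\<integral>\<^sup>+z. ennreal ((f' z)\<^sup>2) \<partial>spacetime \<rho>) + ennreal (1 / c) * J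
          = ennreal (c * ?A + enn2real J / c)" .
      then show ?thesis
        using nn_integral_lborel_le_spacetime[OF f'(1) CB C(2) that] unfolding J_def by simp
    qed
    have ind: "indicator C z *\<^sub>R f z = indicator C z * f' z" for z
      using f'(2) C(2) by (auto split: split_indicator)
    have nn: "(\<integral>\<^sup>+z\<in>C. \<bar>f' z\<bar> \<partial>lborel) = (\<integral>\<^sup>+z. norm (indicator C z * f' z) \<partial>lborel)"
      by (intro nn_integral_cong) (auto split: split_indicator)
    have "(\<integral>\<^sup>+z\<in>C. \<bar>f' z\<bar> \<partial>lborel) < \<infinity>"
      using le[of 1] by (simp add: le_less_trans)
    then have si: "integrable lborel (\<lambda>z. indicator C z * f' z)"
      unfolding nn using f'(1) CB by (intro integrableI_bounded) auto
    have "(LINT z:C|lborel. \<bar>f z\<bar>) \<le> c * ?A + enn2real J / c" if c: "0 < c" for c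
    proof -
      have "(LINT z:C|lborel. \<bar>f z\<bar>) = (LINT z|lborel. norm (indicator C z * f' z))"
        unfolding set_lebesgue_integral_def using f'(2) C(2)
        by (intro Bochner_Integration.integral_cong) (auto split: split_indicator)
      moreover have "ennreal \<dots> = (\<integral>\<^sup>+z\<in>C. \<bar>f' z\<bar> \<partial>lborel)"
        unfolding nn using si by (intro nn_integral_eq_integral[symmetric]) auto
      ultimately have "ennreal (LINT z:C|lborel. \<bar>f z\<bar>) \<le> ennreal (c * ?A + enn2real J / c)"
        using le[OF c] by simp
      then show ?thesis
        using c by (subst (asm) ennreal_le_iff) auto
    qed
    then show ?thesis
      using si eq unfolding set_integrable_def ind by simp
  qed
  show thesis
    by (rule that[of "enn2real J"]) (use key in auto)
qed

lemma L2_locally_integrable: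
  assumes "f \<in> L2 (spacetime \<rho>)"
  shows "locally_integrable_on f open_strip"
  unfolding locally_integrable_on_def
proof safe
  fix C :: "(real \<times> 'a) set" assume C: "compact C" "C \<subseteq> open_strip"
  then have "C \<subseteq> strip" by auto
  with C(1) show "set_integrable lborel C f"
    by (rule set_integral_abs_le_spacetime) (use assms in blast)
qed

lemma set_integral_abs_tendsto_0:
  fixes f :: "nat \<Rightarrow> real \<times> 'a \<Rightarrow> real"
  assumes C: "compact C" "C \<subseteq> strip" and f: "\<And>n. f n \<in> L2 (spacetime \<rho>)"
    and lim: "(\<lambda>n. \<integral>z. (f n z)\<^sup>2 \<partial>spacetime \<rho>) \<longlonglongrightarrow> 0"
  shows "(\<lambda>n. LINT z:C|lborel. \<bar>f n z\<bar>) \<longlonglongrightarrow> 0"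
proof -
  obtain I where I: "0 \<le> I" "\<And>n c. 0 < c \<Longrightarrow>
      (LINT z:C|lborel. \<bar>f n z\<bar>) \<le> c * (\<integral>z. (f n z)\<^sup>2 \<partial>spacetime \<rho>) + I / c"
    using C by (rule set_integral_abs_le_spacetime) (use f in blast)
  have nn: "0 \<le> (LINT z:C|lborel. \<bar>f n z\<bar>)" for n
    unfolding set_lebesgue_integral_def by (intro integral_nonneg_AE) auto
  show ?thesis
  proof (rule LIMSEQ_I)
    fix e :: real assume e: "0 < e"
    \<comment> \<open>Makes \<open>I / c\<close> at most half of \<open>e\<close>; the added
      \<open>1\<close> keeps \<open>c\<close> positive when \<open>I = 0\<close>.\<close>
    define c where "c = 2 * (I + 1) / e"
    have c: "c > 0" using I(1) e by (simp add: c_def)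
    have "I / c \<le> e / 2"
      using I(1) e by (simp add: c_def field_simps)
    obtain N where N: "\<And>n. n \<ge> N \<Longrightarrow> norm ((\<integral>z. (f n z)\<^sup>2 \<partial>spacetime \<rho>) - 0) < e / (2 * c)"
      using LIMSEQ_D[OF lim, of "e / (2 * c)"] e c by auto
    have "norm ((LINT z:C|lborel. \<bar>f n z\<bar>) - 0) < e" if "n \<ge> N" for n
    proof -
      have "(\<integral>z. (f n z)\<^sup>2 \<partial>spacetime \<rho>) < e / (2 * c)"
        using N[OF that] by simp
      then have "c * (\<integral>z. (f n z)\<^sup>2 \<partial>spacetime \<rho>) < e / 2"
        using c by (simp add: field_simps)
      then show ?thesis
        using I(2)[OF c, of n] \<open>I / c \<le> e / 2\<close> nn[of n] unfolding real_norm_def by linarith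
    qed
    then show "\<exists>N. \<forall>n\<ge>N. norm ((LINT z:C|lborel. \<bar>f n z\<bar>) - 0) < e" by blast
  qed
qed

section \<open>Spatial weak derivatives of elements of \<open>H1_x\<close>\<close>

abbreviation D :: "'a \<Rightarrow> (real \<times> 'a \<Rightarrow> real) \<Rightarrow> real \<times> 'a \<Rightarrow> real" where
  "D b f \<equiv> weak_derivative f (0, b) open_strip"

lemma
  assumes f: "f \<in> H1_x \<rho>" and b: "b \<in> Basis"
  shows weak_derivative_measurable: "D b f \<in> borel_measurable borel"
    and has_weak_derivative_weak_derivative: "has_weak_derivative f (D b f) (0, b) open_strip"
    and weak_derivative_AE: "has_weak_derivative f g (0, b) open_strip \<Longrightarrow>
      AE z in spacetime \<rho>. D b f z = g z"
    and weak_derivative_L2: "D b f \<in> L2 (spacetime \<rho>)"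
proof -
  obtain g0 where g0: "g0 \<in> L2 (spacetime \<rho>)" "has_weak_derivative f g0 (0, b) open_strip"
    using f b unfolding H1_x_def by blast
  \<comment> \<open>The choice in \<open>weak_derivative\<close> ranges over functions that are
    Borel everywhere, while membership in \<open>L2\<close> controls \<open>g0\<close> on the strip
    only; cutting off to the strip supplies a witness.\<close>
  have "\<exists>g. g \<in> borel_measurable borel \<and> has_weak_derivative f g (0, b) open_strip"
  proof (intro exI conjI)
    show "(\<lambda>z. indicator strip z *\<^sub>R g0 z) \<in> borel_measurable borel"
      using g0(1) by (simp only: measurable_spacetime_iff[symmetric] L2_iff)
    show "has_weak_derivative f (\<lambda>z. indicator strip z *\<^sub>R g0 z) (0, b) open_strip"
      by (rule has_weak_derivative_cong[OF _ _ g0(2)]) auto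
  qed
  then have "D b f \<in> borel_measurable borel \<and> has_weak_derivative f (D b f) (0, b) open_strip"
    unfolding weak_derivative_def by (rule someI_ex)
  then show m: "D b f \<in> borel_measurable borel"
    and D: "has_weak_derivative f (D b f) (0, b) open_strip" by auto
  show ae: "AE z in spacetime \<rho>. D b f z = g z" if "has_weak_derivative f g (0, b) open_strip" for g
    using has_weak_derivative_unique[OF open_open_strip D that] by (rule AE_spacetimeI)
  show "D b f \<in> L2 (spacetime \<rho>)"
    by (rule L2_cong_AE[OF g0(1) measurable_spacetimeI[OF m]])
      (use ae[OF g0(2)] in \<open>eventually_elim, simp\<close>)
qed

lemma H1_xI:
  assumes "f \<in> L2 (spacetime \<rho>)"
    "\<And>b. b \<in> Basis \<Longrightarrow> g b \<in> L2 (spacetime \<rho>) \<and> has_weak_derivative f (g b) (0, b) open_strip"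
  shows "f \<in> H1_x \<rho>"
  using assms unfolding H1_x_def by blast

lemma H1_x_L2: "f \<in> H1_x \<rho> \<Longrightarrow> f \<in> L2 (spacetime \<rho>)"
  unfolding H1_x_def by blast

lemma
  assumes f: "f \<in> H1_x \<rho>" "g \<in> H1_x \<rho>"
  shows H1_x_add: "(\<lambda>z. c * f z + g z) \<in> H1_x \<rho>"
    and weak_derivative_add: "b \<in> Basis \<Longrightarrow>
      AE z in spacetime \<rho>. D b (\<lambda>z. c * f z + g z) z = c * D b f z + D b g z"
proof -
  have *: "has_weak_derivative (\<lambda>z. c * f z + g z) (\<lambda>z. c * D b f z + D b g z) (0, b) open_strip"
    if "b \<in> Basis" for b
    using has_weak_derivative_weak_derivative[OF f(1) that] has_weak_derivative_weak_derivative[OF f(2) that]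
    by (rule has_weak_derivative_add[OF _ _ zero_pair_Basis[OF that]])
  show H: "(\<lambda>z. c * f z + g z) \<in> H1_x \<rho>"
    using * L2_add[OF H1_x_L2[OF f(1)] H1_x_L2[OF f(2)]]
      L2_add[OF weak_derivative_L2[OF f(1)] weak_derivative_L2[OF f(2)]]
    by (intro H1_xI[of _ "\<lambda>b z. c * D b f z + D b g z"]) simp_all
  show "AE z in spacetime \<rho>. D b (\<lambda>z. c * f z + g z) z = c * D b f z + D b g z" if "b \<in> Basis"
    using weak_derivative_AE[OF H that *[OF that]] .
qed

lemma has_weak_derivative_L2_limit:
  assumes fg: "\<And>n. f n \<in> L2 (spacetime \<rho>)" "\<And>n. g n \<in> L2 (spacetime \<rho>)"
      "\<And>n. has_weak_derivative (f n) (g n) (0, b) open_strip" and b: "b \<in> Basis"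
    and FG: "F \<in> L2 (spacetime \<rho>)" "G \<in> L2 (spacetime \<rho>)"
    and lim: "(\<lambda>n. \<integral>z. (f n z - F z)\<^sup>2 \<partial>spacetime \<rho>) \<longlonglongrightarrow> 0"
      "(\<lambda>n. \<integral>z. (g n z - G z)\<^sup>2 \<partial>spacetime \<rho>) \<longlonglongrightarrow> 0"
  shows "has_weak_derivative F G (0, b) open_strip"
proof -
  have l: "(\<lambda>n. LINT z:C|lborel. \<bar>h n z - H z\<bar>) \<longlonglongrightarrow> 0"
    if "compact C" "C \<subseteq> open_strip" and h: "\<And>n. h n \<in> L2 (spacetime \<rho>)" "H \<in> L2 (spacetime \<rho>)"
      and lim: "(\<lambda>n. \<integral>z. (h n z - H z)\<^sup>2 \<partial>spacetime \<rho>) \<longlonglongrightarrow> 0"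
    for C and h :: "nat \<Rightarrow> real \<times> 'a \<Rightarrow> real" and H
  proof (rule set_integral_abs_tendsto_0[OF that(1) _ _ lim])
    show "C \<subseteq> strip" using that(2) by auto
    show "(\<lambda>z. h n z - H z) \<in> L2 (spacetime \<rho>)" for n
      using L2_add[OF h(2) h(1), of "-1"] by simp
  qed
  show ?thesis
    by (rule has_weak_derivative_limit[OF fg(3) zero_pair_Basis[OF b]
        L2_locally_integrable[OF FG(1)] L2_locally_integrable[OF FG(2)]
        l[OF _ _ fg(1) FG(1) lim(1)] l[OF _ _ fg(2) FG(2) lim(2)]])
qed

end

section \<open>From weak derivatives in space-time to weak derivatives of time slices\<close>

lemma locally_integrable_on_UNIVI:
  assumes "\<And>m :: nat. set_integrable lborel (cball 0 (real m)) f"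
  shows "locally_integrable_on f UNIV"
  unfolding locally_integrable_on_def
proof (intro allI impI)
  fix C :: "'a set" assume "compact C"
  then have "bounded C" and C: "C \<in> sets lborel"
    by (auto intro: compact_imp_bounded borel_closed compact_imp_closed)
  then obtain r where r: "C \<subseteq> cball 0 r"
    using bounded_subset_ballD[of C 0] ball_subset_cball by blast
  obtain m :: nat where "r \<le> real m" using real_arch_simple by blast
  with r have "C \<subseteq> cball 0 (real m)" by (meson order_trans subset_cball)
  with assms C show "set_integrable lborel C f"
    by (rule set_integrable_subset)
qed

context ac_curve_recip
begin

text \<open>Countably many test functions are uniformly dense together with their derivatives, so the
  exceptional sets of times add up to a null set.\<close>

lemma countable_dense_test_functions:
  assumes b: "b \<in> (Basis :: 'a set)"
  obtains T where "countable T" "T \<subseteq> test_functions (UNIV :: 'a set)"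
    "\<And>\<phi>. \<phi> \<in> test_functions UNIV \<Longrightarrow> \<exists>K. compact K \<and> (\<forall>e>0. \<exists>\<psi>\<in>T. \<forall>x.
      (x \<notin> K \<longrightarrow> \<phi> x = 0 \<and> \<psi> x = 0 \<and> frechet_derivative \<phi> (at x) b = 0 \<and> frechet_derivative \<psi> (at x) b = 0) \<and>
      \<bar>\<phi> x - \<psi> x\<bar> \<le> e \<and> \<bar>frechet_derivative \<phi> (at x) b - frechet_derivative \<psi> (at x) b\<bar> \<le> e)"
proof -
  \<comment> \<open>A fixed ball for all functions in \<open>S m\<close> gives compactness for the
    density argument, and a common set \<open>K\<close> that does not depend on the accuracy
    \<open>e\<close>.\<close>
  define S where "S m = {\<phi> \<in> test_functions (UNIV :: 'a set).
      \<forall>x. x \<notin> cball 0 (real m) \<longrightarrow> \<phi> x = 0 \<and> frechet_derivative \<phi> (at x) b = 0}" for m :: nat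
  \<comment> \<open>Pairing a function with its derivative lets one uniform approximation control
    both.\<close>
  define F where "F \<phi> x = (\<phi> x, frechet_derivative \<phi> (at x) b)" for \<phi> :: "'a \<Rightarrow> real" and x
  have "\<exists>T. countable T \<and> T \<subseteq> S m \<and>
      (\<forall>\<phi> e. \<phi> \<in> S m \<longrightarrow> 0 < e \<longrightarrow> (\<exists>\<psi>\<in>T. \<forall>x\<in>cball 0 (real m). dist (F \<phi> x) (F \<psi> x) < e))" for m
  proof -
    have "continuous_on (cball 0 (real m)) (F \<phi>)" if "\<phi> \<in> S m" for \<phi>
      unfolding F_def using that b unfolding S_def
      by (intro continuous_on_Pair)
        (auto intro: continuous_on_subset[OF test_function_continuous] continuous_on_subset[OF test_function_deriv_continuous])
    then obtain T where "countable T" "T \<subseteq> S m"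
      "\<And>\<phi> e. \<phi> \<in> S m \<Longrightarrow> 0 < e \<Longrightarrow> \<exists>\<psi>\<in>T. \<forall>x\<in>cball 0 (real m). dist (F \<phi> x) (F \<psi> x) < e"
      using countable_uniformly_dense[OF compact_cball[of 0 "real m"], of "S m" F] by auto
    then show ?thesis by blast
  qed
  then obtain T where T: "\<And>m. countable (T m)" "\<And>m. T m \<subseteq> S m"
    "\<And>m \<phi> e. \<phi> \<in> S m \<Longrightarrow> 0 < e \<Longrightarrow> \<exists>\<psi>\<in>T m. \<forall>x\<in>cball 0 (real m). dist (F \<phi> x) (F \<psi> x) < e"
    by metis
  show thesis
  proof
    show "countable (\<Union>m. T m)" using T(1) by simp
    show "(\<Union>m. T m) \<subseteq> test_functions UNIV" using T(2) unfolding S_def by blast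
    fix \<phi> :: "'a \<Rightarrow> real" assume \<phi>: "\<phi> \<in> test_functions UNIV"
    obtain C where C: "compact C" "C \<subseteq> UNIV" "\<forall>x. x \<notin> C \<longrightarrow> \<phi> x = 0"
      "\<forall>x v. x \<notin> C \<longrightarrow> frechet_derivative \<phi> (at x) v = 0"
      by (rule test_function_support[OF \<phi>])
    obtain r where r: "C \<subseteq> cball 0 r"
      using bounded_subset_ballD[OF compact_imp_bounded[OF C(1)], of 0] ball_subset_cball by blast
    obtain m :: nat where "r \<le> real m" using real_arch_simple by blast
    with r have m: "C \<subseteq> cball 0 (real m)" by (meson order_trans subset_cball)
    then have \<phi>S: "\<phi> \<in> S m"
      using \<phi> C unfolding S_def by blast
    have "\<exists>\<psi>\<in>\<Union>m. T m. \<forall>x. (x \<notin> cball 0 (real m) \<longrightarrow> \<phi> x = 0 \<and> \<psi> x = 0 \<and>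
          frechet_derivative \<phi> (at x) b = 0 \<and> frechet_derivative \<psi> (at x) b = 0) \<and>
        \<bar>\<phi> x - \<psi> x\<bar> \<le> e \<and> \<bar>frechet_derivative \<phi> (at x) b - frechet_derivative \<psi> (at x) b\<bar> \<le> e"
      if e: "e > 0" for e
    proof -
      obtain \<psi> where \<psi>: "\<psi> \<in> T m" "\<forall>x\<in>cball 0 (real m). dist (F \<phi> x) (F \<psi> x) < e"
        using T(3)[OF \<phi>S e] by blast
      then have \<psi>S: "\<psi> \<in> S m" using T(2) by blast
      have le: "\<bar>\<phi> x - \<psi> x\<bar> \<le> e \<and> \<bar>frechet_derivative \<phi> (at x) b - frechet_derivative \<psi> (at x) b\<bar> \<le> e" for x
      proof (cases "x \<in> cball 0 (real m)")
        case True
        then have "dist (F \<phi> x) (F \<psi> x) < e" using \<psi>(2) by blast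
        then show ?thesis
          using dist_fst_le[of "F \<phi> x" "F \<psi> x"] dist_snd_le[of "F \<phi> x" "F \<psi> x"]
          by (simp add: F_def dist_real_def)
      next
        case False
        then show ?thesis using \<phi>S \<psi>S e unfolding S_def by simp
      qed
      show ?thesis
      proof (intro bexI[of _ \<psi>] allI conjI impI)
        show "\<psi> \<in> (\<Union>m. T m)" using \<psi>(1) by blast
      qed (use \<phi>S \<psi>S le in \<open>auto simp: S_def\<close>)
    qed
    then show "\<exists>K. compact K \<and> (\<forall>e>0. \<exists>\<psi>\<in>\<Union>m. T m. \<forall>x.
      (x \<notin> K \<longrightarrow> \<phi> x = 0 \<and> \<psi> x = 0 \<and> frechet_derivative \<phi> (at x) b = 0 \<and> frechet_derivative \<psi> (at x) b = 0) \<and>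
      \<bar>\<phi> x - \<psi> x\<bar> \<le> e \<and> \<bar>frechet_derivative \<phi> (at x) b - frechet_derivative \<psi> (at x) b\<bar> \<le> e)"
      using compact_cball by blast
  qed
qed

text \<open>Tested with the product of \<open>\<eta>\<close> and \<open>\<phi>\<close>, the
  space-time identity becomes by Fubini an identity for the integral over t of \<open>\<eta>\<close>
  times a function of t alone. As \<open>\<eta>\<close> is arbitrary, the one-dimensional
  fundamental lemma makes that function vanish almost everywhere.\<close>

lemma weak_derivative_slices_fixed_test:
  assumes f: "f \<in> L2 (spacetime \<rho>)" and g: "g \<in> L2 (spacetime \<rho>)"
    and D: "has_weak_derivative f g (0, b) open_strip" and b: "b \<in> Basis"
    and \<phi>: "\<phi> \<in> test_functions (UNIV :: 'a set)"
  shows "AE t in lborel. t \<in> {0<..<1} \<longrightarrow>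
    (LINT x|lborel. f (t, x) * frechet_derivative \<phi> (at x) b + g (t, x) * \<phi> x) = 0"
proof -
  let ?d = "\<lambda>x. frechet_derivative \<phi> (at x) b"
  obtain C where C: "compact C" "C \<subseteq> UNIV" "\<forall>x. x \<notin> C \<longrightarrow> \<phi> x = 0"
    "\<forall>x v. x \<notin> C \<longrightarrow> frechet_derivative \<phi> (at x) v = 0"
    by (rule test_function_support[OF \<phi>])
  let ?Q = "{0..1::real} \<times> C"
  have QC: "compact ?Q" "?Q \<subseteq> strip"
    using C(1) by (auto intro!: compact_Times)
  have int: "integrable lborel (\<lambda>z. (indicator ?Q z * k z) * \<psi> (snd z))"
    if k: "k \<in> L2 (spacetime \<rho>)" and \<psi>: "continuous_on UNIV \<psi>" "\<forall>x. x \<notin> C \<longrightarrow> \<psi> x = 0"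
    for k :: "real \<times> 'a \<Rightarrow> real" and \<psi> :: "'a \<Rightarrow> real"
  proof -
    obtain B where B: "\<forall>x. \<bar>\<psi> x\<bar> \<le> B"
      using \<psi>(1) C(1) \<psi>(2) by (rule continuous_compact_support_bounded)
    have "set_integrable lborel ?Q k"
      using QC by (rule set_integral_abs_le_spacetime) (use k in blast)
    then have ki: "integrable lborel (\<lambda>z. indicator ?Q z * k z)"
      by (simp add: set_integrable_def)
    have "continuous_on UNIV (\<lambda>z :: real \<times> 'a. \<psi> (snd z))"
      by (intro continuous_on_compose2[OF \<psi>(1)] continuous_intros) auto
    then have "(\<lambda>z :: real \<times> 'a. \<psi> (snd z)) \<in> borel_measurable borel"
      by (rule borel_measurable_continuous_onI)
    then have m: "(\<lambda>z. (indicator ?Q z * k z) * \<psi> (snd z)) \<in> borel_measurable lborel"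
      using borel_measurable_times[OF borel_measurable_integrable[OF ki], of "\<lambda>z. \<psi> (snd z)"] by simp
    have le: "norm ((indicator ?Q z * k z) * \<psi> (snd z)) \<le> norm (B * (indicator ?Q z * k z))" for z
    proof -
      have "\<bar>\<psi> (snd z)\<bar> \<le> \<bar>B\<bar>" using B by (meson abs_ge_self order_trans)
      then have "\<bar>indicator ?Q z * k z\<bar> * \<bar>\<psi> (snd z)\<bar> \<le> \<bar>indicator ?Q z * k z\<bar> * \<bar>B\<bar>"
        by (rule mult_left_mono) simp
      then show ?thesis
        by (simp only: real_norm_def abs_mult mult_ac)
    qed
    show ?thesis
      by (rule Bochner_Integration.integrable_bound[OF integrable_mult_right[OF ki] m AE_I2[OF le]])
  qed
  \<comment> \<open>The indicator of the compact set makes \<open>h\<close> integrable over the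
    whole product, as Fubini demands. It changes nothing inside the strip, since
    \<open>\<phi>\<close> and its derivative vanish off \<open>C\<close>.\<close>
  define h where "h z = (indicator ?Q z * f z) * ?d (snd z) + (indicator ?Q z * g z) * \<phi> (snd z)" for z
  have h: "integrable (lborel \<Otimes>\<^sub>M lborel) h"
    unfolding h_def lborel_prod
    using int[OF f test_function_deriv_continuous[OF \<phi> b]] int[OF g test_function_continuous[OF \<phi>]] C(3,4)
    by (intro Bochner_Integration.integrable_add) blast+
  have heq: "h (t, x) = f (t, x) * ?d x + g (t, x) * \<phi> x" if "t \<in> {0<..<1}" for t x
    using that C(3,4) by (cases "x \<in> C") (auto simp: h_def)
  define H where "H t = (LINT x|lborel. h (t, x))" for t
  have H: "integrable lborel H"
    unfolding H_def by (rule lborel_pair.integrable_fst'[OF h])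
  have "AE t in lborel. t \<in> {0<..<1} \<longrightarrow> H t = 0"
  proof (rule fundamental_lemma_variations)
    show "locally_integrable_on H {0<..<1}"
      unfolding locally_integrable_on_def set_integrable_def
      using H by (intro allI impI integrable_mult_indicator)
        (auto intro: borel_closed compact_imp_closed)
    fix \<eta> :: "real \<Rightarrow> real" assume \<eta>: "\<eta> \<in> test_functions {0<..<1}"
    obtain E where E: "compact E" "E \<subseteq> {0<..<1}" "\<forall>t. t \<notin> E \<longrightarrow> \<eta> t = 0"
      by (rule test_function_support[OF \<eta>])
    let ?\<eta>\<phi> = "\<lambda>(t, x). \<eta> t * \<phi> x"
    have \<eta>\<phi>: "?\<eta>\<phi> \<in> test_functions open_strip"
      using \<eta> \<phi> by (rule test_function_tensor)
    note p = test_function_pairings_integrable[OF _ \<eta>\<phi> zero_pair_Basis[OF b]]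
    note pf = p(2)[OF L2_locally_integrable[OF f]] and pg = p(1)[OF L2_locally_integrable[OF g]]
    have eq: "indicator open_strip z *\<^sub>R (f z * frechet_derivative ?\<eta>\<phi> (at z) (0, b) + g z * ?\<eta>\<phi> z)
        = \<eta> (fst z) * h z" for z
    proof (cases z)
      case (Pair t x)
      show ?thesis
      proof (cases "t \<in> {0<..<1}")
        case True
        then show ?thesis
          unfolding Pair test_function_tensor(2)[OF \<eta> \<phi>] by (simp add: heq algebra_simps)
      next
        case False
        then have "\<eta> t = 0" using E by blast
        then show ?thesis using False Pair by simp
      qed
    qed
    have ip: "integrable (lborel \<Otimes>\<^sub>M lborel) (\<lambda>z. \<eta> (fst z) * h z)"
      using set_integral_add(1)[OF pf pg] unfolding set_integrable_def eq lborel_prod .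
    have "(LINT t:{0<..<1}|lborel. H t * \<eta> t) = (LINT t|lborel. (LINT x|lborel. \<eta> (fst (t, x)) * h (t, x)))"
      unfolding set_lebesgue_integral_def H_def using E
      by (intro Bochner_Integration.integral_cong) (auto split: split_indicator)
    also have "\<dots> = (LINT z|lborel. \<eta> (fst z) * h z)"
      using lborel_pair.integral_fst'[OF ip] by (simp add: lborel_prod)
    also have "\<dots> = (LINT z:open_strip|lborel. f z * frechet_derivative ?\<eta>\<phi> (at z) (0, b) + g z * ?\<eta>\<phi> z)"
      unfolding set_lebesgue_integral_def eq ..
    also have "\<dots> = (LINT z:open_strip|lborel. f z * frechet_derivative ?\<eta>\<phi> (at z) (0, b))
        + (LINT z:open_strip|lborel. g z * ?\<eta>\<phi> z)"
      using pf pg by (rule set_integral_add(2))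
    also have "\<dots> = 0"
      using D \<eta>\<phi> unfolding has_weak_derivative_def by simp
    finally show "(LINT t:{0<..<1}|lborel. H t * \<eta> t) = 0" .
  qed simp
  then show ?thesis
    by eventually_elim (auto simp: H_def heq)
qed

text \<open>Fubini on the product of the time interval with a ball gives a null set of times for
  each ball; balls of natural radius suffice, so there are countably many.\<close>

lemma AE_slice_locally_integrable:
  assumes f: "f \<in> L2 (spacetime \<rho>)"
  shows "AE t in lborel. t \<in> {0..1} \<longrightarrow> locally_integrable_on (\<lambda>x. f (t, x)) UNIV"
proof -
  have "AE t in lborel. integrable lborel (\<lambda>x. indicator ({0..1} \<times> cball 0 (real m)) (t, x) *\<^sub>R f (t, x))" for m :: nat
  proof -
    have "compact ({0..1::real} \<times> cball (0::'a) (real m))" "{0..1} \<times> cball (0::'a) (real m) \<subseteq> strip"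
      by (auto intro!: compact_Times)
    then have "set_integrable lborel ({0..1} \<times> cball (0::'a) (real m)) f"
      by (rule set_integral_abs_le_spacetime) (use f in blast)
    then have "integrable (lborel \<Otimes>\<^sub>M lborel) (\<lambda>z. indicator ({0..1} \<times> cball (0::'a) (real m)) z *\<^sub>R f z)"
      by (simp only: set_integrable_def lborel_prod)
    then show ?thesis
      by (rule lborel_pair.AE_integrable_fst')
  qed
  then have "AE t in lborel. \<forall>m :: nat. integrable lborel (\<lambda>x. indicator ({0..1} \<times> cball 0 (real m)) (t, x) *\<^sub>R f (t, x))"
    by (simp add: AE_all_countable)
  then show ?thesis
  proof eventually_elim
    case (elim t)
    show ?case
    proof
      assume t: "t \<in> {0..1}"
      show "locally_integrable_on (\<lambda>x. f (t, x)) UNIV"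
      proof (rule locally_integrable_on_UNIVI)
        fix m :: nat
        have eq: "indicator ({0..1} \<times> cball 0 (real m)) (t, x) = (indicator (cball 0 (real m)) x :: real)" for x :: 'a
          using t by (auto split: split_indicator)
        show "set_integrable lborel (cball 0 (real m)) (\<lambda>x. f (t, x))"
          using elim[rule_format, of m] unfolding set_integrable_def eq .
      qed
    qed
  qed
qed

lemma AE_slice_has_weak_derivative:
  assumes f: "f \<in> L2 (spacetime \<rho>)" and g: "g \<in> L2 (spacetime \<rho>)"
    and D: "has_weak_derivative f g (0, b) open_strip" and b: "b \<in> Basis"
  shows "AE t in lborel. t \<in> {0..1} \<longrightarrow> has_weak_derivative (\<lambda>x. f (t, x)) (\<lambda>x. g (t, x)) b UNIV"
proof -
  obtain T where T: "countable T" "T \<subseteq> test_functions (UNIV :: 'a set)"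
    "\<And>\<phi>. \<phi> \<in> test_functions UNIV \<Longrightarrow> \<exists>K. compact K \<and> (\<forall>e>0. \<exists>\<psi>\<in>T. \<forall>x.
      (x \<notin> K \<longrightarrow> \<phi> x = 0 \<and> \<psi> x = 0 \<and> frechet_derivative \<phi> (at x) b = 0 \<and> frechet_derivative \<psi> (at x) b = 0) \<and>
      \<bar>\<phi> x - \<psi> x\<bar> \<le> e \<and> \<bar>frechet_derivative \<phi> (at x) b - frechet_derivative \<psi> (at x) b\<bar> \<le> e)"
    using b by (rule countable_dense_test_functions) blast
  have "AE t in lborel. \<forall>\<psi>\<in>T. t \<in> {0<..<1} \<longrightarrow>
    (LINT x|lborel. f (t, x) * frechet_derivative \<psi> (at x) b + g (t, x) * \<psi> x) = 0"
    using T(2) by (subst AE_ball_countable[OF T(1)]) (blast intro: weak_derivative_slices_fixed_test[OF f g D b])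
  moreover have "AE t in lborel. t \<noteq> 0" "AE t in lborel. t \<noteq> (1::real)"
    by (rule AE_lborel_singleton)+
  ultimately show ?thesis
    using AE_slice_locally_integrable[OF f] AE_slice_locally_integrable[OF g]
  proof eventually_elim
    case (elim t)
    show ?case
    proof
      assume t: "t \<in> {0..1}"
      let ?f = "\<lambda>x. f (t, x)" and ?g = "\<lambda>x. g (t, x)"
      let ?P = "\<lambda>\<phi>. (LINT x:UNIV|lborel. ?f x * frechet_derivative \<phi> (at x) b) + (LINT x:UNIV|lborel. ?g x * \<phi> x)"
      have li: "locally_integrable_on ?f UNIV" "locally_integrable_on ?g UNIV"
        using elim t by auto
      note i1 = test_function_pairings_integrable(2)[OF li(1) _ b]
        and i2 = test_function_pairings_integrable(1)[OF li(2) _ b]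
      have PT: "?P \<psi> = 0" if "\<psi> \<in> T" for \<psi>
      proof -
        have "?P \<psi> = (LINT x:UNIV|lborel. ?f x * frechet_derivative \<psi> (at x) b + ?g x * \<psi> x)"
          using T(2) that by (intro set_integral_add(2)[symmetric] i1 i2) auto
        then show ?thesis
          using elim t that by (simp add: set_lebesgue_integral_def)
      qed
      have "?P \<phi> = 0" if \<phi>: "\<phi> \<in> test_functions UNIV" for \<phi>
      proof -
        obtain K where K: "compact K" "\<And>e. e > 0 \<Longrightarrow> \<exists>\<psi>\<in>T. \<forall>x.
          (x \<notin> K \<longrightarrow> \<phi> x = 0 \<and> \<psi> x = 0 \<and> frechet_derivative \<phi> (at x) b = 0 \<and> frechet_derivative \<psi> (at x) b = 0) \<and>
          \<bar>\<phi> x - \<psi> x\<bar> \<le> e \<and> \<bar>frechet_derivative \<phi> (at x) b - frechet_derivative \<psi> (at x) b\<bar> \<le> e"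
          using T(3)[OF \<phi>] by blast
        \<comment> \<open>Replacing \<open>\<phi>\<close> by a member of \<open>T\<close> within
          \<open>e\<close> costs at most \<open>e * M\<close>. As \<open>K\<close> is fixed before
          \<open>e\<close>, so is \<open>M\<close>, and \<open>e\<close> may tend to zero.\<close>
        define M where "M = (LINT x:K|lborel. \<bar>?f x\<bar>) + (LINT x:K|lborel. \<bar>?g x\<bar>)"
        have small: "\<bar>?P \<phi>\<bar> \<le> e * M" if e: "e > 0" for e
        proof -
          obtain \<psi> where \<psi>: "\<psi> \<in> T"
            "\<And>x. x \<notin> K \<Longrightarrow> \<phi> x = 0 \<and> \<psi> x = 0 \<and> frechet_derivative \<phi> (at x) b = 0 \<and> frechet_derivative \<psi> (at x) b = 0"
            "\<And>x. \<bar>\<phi> x - \<psi> x\<bar> \<le> e" "\<And>x. \<bar>frechet_derivative \<phi> (at x) b - frechet_derivative \<psi> (at x) b\<bar> \<le> e"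
            using K(2)[OF e] by blast
          have \<psi>t: "\<psi> \<in> test_functions UNIV" using \<psi>(1) T(2) by blast
          have "?P \<phi> = ?P \<phi> - ?P \<psi>" using PT[OF \<psi>(1)] by simp
          also have "\<dots> = (LINT x:UNIV|lborel. ?f x * (frechet_derivative \<phi> (at x) b - frechet_derivative \<psi> (at x) b))
              + (LINT x:UNIV|lborel. ?g x * (\<phi> x - \<psi> x))"
            using set_integral_diff(2)[OF i1[OF \<phi>] i1[OF \<psi>t]] set_integral_diff(2)[OF i2[OF \<phi>] i2[OF \<psi>t]]
            by (simp add: right_diff_distrib)
          finally have "\<bar>?P \<phi>\<bar> \<le> \<bar>LINT x:UNIV|lborel. ?f x * (frechet_derivative \<phi> (at x) b - frechet_derivative \<psi> (at x) b)\<bar>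
              + \<bar>LINT x:UNIV|lborel. ?g x * (\<phi> x - \<psi> x)\<bar>"
            by linarith
          also have "\<dots> \<le> e * (LINT x:K|lborel. \<bar>?f x\<bar>) + e * (LINT x:K|lborel. \<bar>?g x\<bar>)"
          proof (intro add_mono)
            show "\<bar>LINT x:UNIV|lborel. ?f x * (frechet_derivative \<phi> (at x) b - frechet_derivative \<psi> (at x) b)\<bar>
                \<le> e * (LINT x:K|lborel. \<bar>?f x\<bar>)"
              by (rule abs_set_integral_mult_compact_support_le[OF li(1) _ K(1)])
                (use \<psi> in \<open>auto intro!: continuous_on_diff test_function_deriv_continuous[OF \<phi> b] test_function_deriv_continuous[OF \<psi>t b]\<close>)
            show "\<bar>LINT x:UNIV|lborel. ?g x * (\<phi> x - \<psi> x)\<bar> \<le> e * (LINT x:K|lborel. \<bar>?g x\<bar>)"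
              by (rule abs_set_integral_mult_compact_support_le[OF li(2) _ K(1)])
                (use \<psi> in \<open>auto intro!: continuous_on_diff test_function_continuous[OF \<phi>] test_function_continuous[OF \<psi>t]\<close>)
          qed
          finally show ?thesis unfolding M_def by (simp add: algebra_simps)
        qed
        have "((\<lambda>e. e * M) \<longlongrightarrow> 0 * M) (at_right 0)"
          by (intro tendsto_intros)
        moreover have "\<forall>\<^sub>F e in at_right 0. \<bar>?P \<phi>\<bar> \<le> e * M"
          by (rule eventually_at_rightI[of 0 1]) (use small in auto)
        ultimately have "\<bar>?P \<phi>\<bar> \<le> 0 * M"
          by (rule tendsto_lowerbound) simp
        then show ?thesis by simp
      qed
      then show "has_weak_derivative ?f ?g b UNIV"
        using li unfolding has_weak_derivative_def by (simp add: eq_neg_iff_add_eq_0)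
    qed
  qed
qed

lemma AE_slice_L2:
  fixes f :: "real \<times> 'a \<Rightarrow> real"
  assumes f: "f \<in> L2 (spacetime \<rho>)"
  shows "AE t in lborel. t \<in> {0..1} \<longrightarrow> (\<lambda>x. f (t, x)) \<in> L2 (\<rho> t)"
proof -
  have "integrable (spacetime \<rho>) (\<lambda>z. (f z)\<^sup>2)" using f by (simp add: L2_iff)
  from AE_slice_integrable[OF this] show ?thesis
    by eventually_elim (use f measurable_spacetime_slice in \<open>auto simp: L2_iff\<close>)
qed

lemma AE_slice_H1:
  assumes f: "f \<in> H1_x \<rho>"
  shows "AE t in lborel. t \<in> {0..1} \<longrightarrow> (\<lambda>x. f (t, x)) \<in> H1 (\<rho> t)"
proof -
  have "AE t in lborel. \<forall>b\<in>Basis. t \<in> {0..1} \<longrightarrow> (\<lambda>x. D b f (t, x)) \<in> L2 (\<rho> t) \<and>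
      has_weak_derivative (\<lambda>x. f (t, x)) (\<lambda>x. D b f (t, x)) b UNIV"
  proof (subst AE_ball_countable[OF countable_finite[OF finite_Basis]], intro ballI)
    fix b :: 'a assume b: "b \<in> Basis"
    show "AE t in lborel. t \<in> {0..1} \<longrightarrow> (\<lambda>x. D b f (t, x)) \<in> L2 (\<rho> t) \<and>
      has_weak_derivative (\<lambda>x. f (t, x)) (\<lambda>x. D b f (t, x)) b UNIV"
      using AE_slice_L2[OF weak_derivative_L2[OF f b]]
        AE_slice_has_weak_derivative[OF H1_x_L2[OF f] weak_derivative_L2[OF f b] has_weak_derivative_weak_derivative[OF f b] b]
      by eventually_elim simp
  qed
  with AE_slice_L2[OF H1_x_L2[OF f]] show ?thesis
    by eventually_elim (auto simp: H1_def)
qed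

text \<open>Slices of an element of \<open>H1_x\<close> are regular at almost every time, so only
  the means have to be checked when sums and limits are shown to stay in the space.\<close>

lemma X_0_1_iff:
  "f \<in> X_0_1 \<rho> \<longleftrightarrow> f \<in> H1_x \<rho> \<and> (AE t in lborel. t \<in> {0..1} \<longrightarrow> (\<integral>x. f (t, x) \<partial>\<rho> t) = 0)"
proof safe
  assume "f \<in> X_0_1 \<rho>"
  then show "f \<in> H1_x \<rho>" and "AE t in lborel. t \<in> {0..1} \<longrightarrow> (\<integral>x. f (t, x) \<partial>\<rho> t) = 0"
    by (auto simp: X_0_1_def H1_0_def elim: eventually_mono)
next
  assume f: "f \<in> H1_x \<rho>" and m: "AE t in lborel. t \<in> {0..1} \<longrightarrow> (\<integral>x. f (t, x) \<partial>\<rho> t) = 0"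
  have "AE t in lborel. t \<in> {0..1} \<longrightarrow> (\<lambda>x. f (t, x)) \<in> H1_0 (\<rho> t)"
    using AE_slice_H1[OF f] m by eventually_elim (auto simp: H1_0_def)
  with f show "f \<in> X_0_1 \<rho>" by (simp add: X_0_1_def)
qed

end

section \<open>Completeness and the Riesz representation\<close>

text \<open>Serves the Cauchy-Schwarz inequality twice, for L2 and for an abstract form. With
  \<open>c = 0\<close> it also states that a nonnegative quadratic without constant term has no
  linear term, which is the first-order condition at a minimiser.\<close>

lemma nonneg_quadratic_discriminant:
  fixes a b c :: real
  assumes a: "0 \<le> a" and q: "\<And>t. 0 \<le> t\<^sup>2 * a + 2 * t * b + c"
  shows "b\<^sup>2 \<le> a * c"
proof (cases "a = 0")
  case True
  have "b = 0"
  proof (rule ccontr)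
    assume "b \<noteq> 0"
    \<comment> \<open>With \<open>a = 0\<close> this parameter gives the affine function the value
      \<open>-1\<close>.\<close>
    then show False
      using q[of "- (c + 1) / (2 * b)"] True by (simp add: field_simps)
  qed
  then show ?thesis using True by simp
next
  case False
  with a have "a > 0" by simp
  have "(- b / a)\<^sup>2 * a + 2 * (- b / a) * b + c = c - b\<^sup>2 / a"
    using \<open>a > 0\<close> by (simp add: field_simps power2_eq_square)
  with q[of "- b / a"] have "b\<^sup>2 / a \<le> c" by simp
  then show ?thesis using \<open>a > 0\<close> by (simp add: field_simps)
qed

lemma L2_Cauchy_Schwarz:
  fixes f g :: "'x \<Rightarrow> real"
  assumes "f \<in> L2 M" "g \<in> L2 M"
  shows "(\<integral>x. f x * g x \<partial>M)\<^sup>2 \<le> (\<integral>x. (f x)\<^sup>2 \<partial>M) * (\<integral>x. (g x)\<^sup>2 \<partial>M)"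
proof (rule nonneg_quadratic_discriminant)
  fix t :: real
  have i: "integrable M (\<lambda>x. (f x)\<^sup>2)" "integrable M (\<lambda>x. (g x)\<^sup>2)" "integrable M (\<lambda>x. f x * g x)"
    using assms L2_integrable_mult[OF assms] by (auto simp: L2_iff)
  have "0 \<le> (\<integral>x. (t * f x + g x)\<^sup>2 \<partial>M)" by simp
  also have "(\<integral>x. (t * f x + g x)\<^sup>2 \<partial>M) = (\<integral>x. t\<^sup>2 * (f x)\<^sup>2 + (2 * t) * (f x * g x) + (g x)\<^sup>2 \<partial>M)"
    by (intro Bochner_Integration.integral_cong) (auto simp: power2_eq_square algebra_simps)
  also have "\<dots> = t\<^sup>2 * (\<integral>x. (f x)\<^sup>2 \<partial>M) + 2 * t * (\<integral>x. f x * g x \<partial>M) + (\<integral>x. (g x)\<^sup>2 \<partial>M)"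
    using i by simp
  finally show "0 \<le> t\<^sup>2 * (\<integral>x. (f x)\<^sup>2 \<partial>M) + 2 * t * (\<integral>x. f x * g x \<partial>M) + (\<integral>x. (g x)\<^sup>2 \<partial>M)" .
qed simp

text \<open>The Riesz-Fischer argument: along a fast subsequence the successive differences are
  summable in L1, so it converges almost everywhere, and Fatou's lemma turns the pointwise limit
  into an L2 limit.\<close>

lemma (in finite_measure) L2_complete:
  fixes f :: "nat \<Rightarrow> 'a \<Rightarrow> real"
  assumes f: "\<And>n. f n \<in> L2 M"
    and Cauchy: "\<And>e. 0 < e \<Longrightarrow> \<exists>N. \<forall>m\<ge>N. \<forall>n\<ge>N. (\<integral>x. (f m x - f n x)\<^sup>2 \<partial>M) < e"
  obtains F where "F \<in> L2 M" "(\<lambda>n. \<integral>x. (f n x - F x)\<^sup>2 \<partial>M) \<longlonglongrightarrow> 0"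
proof -
  have "\<exists>N. \<forall>m\<ge>N. \<forall>n\<ge>N. (\<integral>x. (f m x - f n x)\<^sup>2 \<partial>M) < (1/4) ^ k" for k :: nat
    by (rule Cauchy) simp
  then obtain r where r: "\<And>k m n. m \<ge> r k \<Longrightarrow> n \<ge> r k \<Longrightarrow> (\<integral>x. (f m x - f n x)\<^sup>2 \<partial>M) < (1/4) ^ k"
    by metis
  \<comment> \<open>The indices \<open>r\<close> need not increase with \<open>k\<close>; the
    partial sum dominates all of them up to \<open>k\<close>.\<close>
  define R where "R k = (\<Sum>i\<le>k. r i)" for k
  have rR: "r j \<le> R k" if "j \<le> k" for j k
    unfolding R_def using that by (intro member_le_sum) auto
  define g where "g k = f (R k)" for k
  have diff: "(\<lambda>x. f m x - f n x) \<in> L2 M" for m n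
    using L2_add[OF f[of n] f[of m], of "-1"] by simp
  have fm[measurable]: "f n \<in> borel_measurable M" for n
    using f by (simp add: L2_iff)
  then have gm[measurable]: "g n \<in> borel_measurable M" for n
    by (simp add: g_def)
  have "AE x in M. (\<Sum>k. ennreal \<bar>g (Suc k) x - g k x\<bar>) \<noteq> \<infinity>"
  proof (rule nn_integral_PInf_AE)
    show "(\<lambda>x. \<Sum>k. ennreal \<bar>g (Suc k) x - g k x\<bar>) \<in> borel_measurable M" by measurable
    \<comment> \<open>With weight \<open>2 ^ k\<close>, the squared difference of integral below
      \<open>(1/4) ^ k\<close> contributes \<open>(1/2) ^ k\<close>, and the constant
      \<open>(1/2) ^ k\<close> contributes that much times the total mass.\<close>
    let ?c = "1 + measure M (space M)"
    have le: "(\<integral>\<^sup>+x. ennreal \<bar>g (Suc k) x - g k x\<bar> \<partial>M) \<le> ennreal (?c * (1/2) ^ k)" for k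
    proof -
      let ?d = "\<lambda>x. g (Suc k) x - g k x"
      have d: "?d \<in> L2 M" using diff by (simp add: g_def)
      have di: "integrable M ?d" by (rule L2_integrable[OF d])
      have "\<bar>?d x\<bar> \<le> 2 ^ k * (?d x)\<^sup>2 + (1/2) ^ k" for x
        using abs_le_weighted_square[of "2 ^ k" "?d x"] by (simp add: power_one_over)
      then have "(\<integral>x. \<bar>?d x\<bar> \<partial>M) \<le> (\<integral>x. 2 ^ k * (?d x)\<^sup>2 + (1/2) ^ k \<partial>M)"
        using di d by (intro integral_mono) (auto simp: L2_iff)
      also have "\<dots> = 2 ^ k * (\<integral>x. (?d x)\<^sup>2 \<partial>M) + (1/2) ^ k * measure M (space M)"
        using d by (simp add: L2_iff mult.commute)
      also have "\<dots> \<le> 2 ^ k * (1/4) ^ k + (1/2) ^ k * measure M (space M)"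
        using r[of k "R (Suc k)" "R k"] rR[of k "Suc k"] rR[of k k]
        by (intro add_right_mono mult_left_mono) (auto simp: g_def)
      also have "(2::real) ^ k * (1/4) ^ k = (1/2) ^ k"
        by (simp add: power_mult_distrib[symmetric])
      finally have "(\<integral>x. \<bar>?d x\<bar> \<partial>M) \<le> ?c * (1/2) ^ k" by (simp add: algebra_simps)
      moreover have "(\<integral>\<^sup>+x. ennreal \<bar>?d x\<bar> \<partial>M) = ennreal (\<integral>x. \<bar>?d x\<bar> \<partial>M)"
        using di by (intro nn_integral_eq_integral) auto
      ultimately show ?thesis by (simp add: ennreal_leI)
    qed
    have "(\<integral>\<^sup>+x. (\<Sum>k. ennreal \<bar>g (Suc k) x - g k x\<bar>) \<partial>M) = (\<Sum>k. \<integral>\<^sup>+x. ennreal \<bar>g (Suc k) x - g k x\<bar> \<partial>M)"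
      by (intro nn_integral_suminf) measurable
    also have "\<dots> \<le> (\<Sum>k. ennreal (?c * (1/2) ^ k))"
      by (intro suminf_le le) auto
    also have "\<dots> = ennreal (\<Sum>k. ?c * (1/2) ^ k)"
      by (intro suminf_ennreal2 summable_mult summable_geometric) auto
    also have "\<dots> < \<infinity>" by simp
    finally show "(\<integral>\<^sup>+x. (\<Sum>k. ennreal \<bar>g (Suc k) x - g k x\<bar>) \<partial>M) \<noteq> \<infinity>" by simp
  qed
  then have conv: "AE x in M. convergent (\<lambda>k. g k x)"
  proof eventually_elim
    case (elim x)
    then have "summable (\<lambda>k. \<bar>g (Suc k) x - g k x\<bar>)"
      by (intro summable_suminf_not_top) auto
    then have "summable (\<lambda>k. g (Suc k) x - g k x)"
      by (rule summable_rabs_cancel)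
    then have "convergent (\<lambda>n. \<Sum>k<n. g (Suc k) x - g k x)"
      by (simp add: summable_iff_convergent)
    then have "convergent (\<lambda>n. g n x - g 0 x)"
      by (simp only: sum_lessThan_telescope[of "\<lambda>k. g k x"])
    then show ?case
      using convergent_diff_const_right_iff by blast
  qed
  define F where "F x = lim (\<lambda>k. g k x)" for x
  have Fm[measurable]: "F \<in> borel_measurable M"
    unfolding F_def[abs_def] by (rule borel_measurable_lim_metric) (rule gm)
  \<comment> \<open>Fatou along the subsequence: the bound on the distance from \<open>f n\<close>
    to \<open>g k\<close> holds for all \<open>k\<close> from \<open>j\<close> on and survives the
    limit in \<open>k\<close>. Since \<open>n\<close> is arbitrary beyond \<open>r j\<close>, the
    whole sequence converges.\<close>
  have key: "(\<integral>\<^sup>+x. ennreal ((f n x - F x)\<^sup>2) \<partial>M) \<le> ennreal ((1/4) ^ j)" if n: "n \<ge> r j" for n j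
  proof -
    have "(\<integral>\<^sup>+x. ennreal ((f n x - F x)\<^sup>2) \<partial>M) = (\<integral>\<^sup>+x. liminf (\<lambda>k. ennreal ((f n x - g k x)\<^sup>2)) \<partial>M)"
    proof (rule nn_integral_cong_AE)
      show "AE x in M. ennreal ((f n x - F x)\<^sup>2) = liminf (\<lambda>k. ennreal ((f n x - g k x)\<^sup>2))"
        using conv
      proof eventually_elim
        case (elim x)
        then have "(\<lambda>k. g k x) \<longlonglongrightarrow> F x"
          unfolding F_def by (simp add: convergent_LIMSEQ_iff)
        then have "(\<lambda>k. ennreal ((f n x - g k x)\<^sup>2)) \<longlonglongrightarrow> ennreal ((f n x - F x)\<^sup>2)"
          by (intro tendsto_intros)
        then show ?case
          by (intro lim_imp_Liminf[symmetric]) auto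
      qed
    qed
    also have "\<dots> \<le> liminf (\<lambda>k. \<integral>\<^sup>+x. ennreal ((f n x - g k x)\<^sup>2) \<partial>M)"
      by (intro nn_integral_liminf) measurable
    also have "\<dots> \<le> liminf (\<lambda>k. ennreal ((1/4) ^ j))"
    proof (rule Liminf_mono)
      show "\<forall>\<^sub>F k in sequentially. (\<integral>\<^sup>+x. ennreal ((f n x - g k x)\<^sup>2) \<partial>M) \<le> ennreal ((1/4) ^ j)"
        using eventually_ge_at_top[of j]
      proof eventually_elim
        case (elim k)
        have "(\<integral>\<^sup>+x. ennreal ((f n x - g k x)\<^sup>2) \<partial>M) = ennreal (\<integral>x. (f n x - g k x)\<^sup>2 \<partial>M)"
          using diff[of n "R k"] by (intro nn_integral_eq_integral) (auto simp: L2_iff g_def)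
        also have "\<dots> \<le> ennreal ((1/4) ^ j)"
          using r[OF n rR[OF elim]] by (intro ennreal_leI) (simp add: g_def)
        finally show ?case .
      qed
    qed
    also have "\<dots> = ennreal ((1/4) ^ j)"
      by (rule Liminf_const) simp
    finally show ?thesis .
  qed
  have diffF: "integrable M (\<lambda>x. (f n x - F x)\<^sup>2) \<and> (\<integral>x. (f n x - F x)\<^sup>2 \<partial>M) \<le> (1/4) ^ j" if n: "n \<ge> r j" for n j
  proof
    show i: "integrable M (\<lambda>x. (f n x - F x)\<^sup>2)"
      using key[OF n] by (intro integrableI_bounded) (auto simp: le_less_trans)
    have "ennreal (\<integral>x. (f n x - F x)\<^sup>2 \<partial>M) = (\<integral>\<^sup>+x. ennreal ((f n x - F x)\<^sup>2) \<partial>M)"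
      using i by (intro nn_integral_eq_integral[symmetric]) auto
    with key[OF n] have "ennreal (\<integral>x. (f n x - F x)\<^sup>2 \<partial>M) \<le> ennreal ((1/4) ^ j)"
      by (simp only:)
    then show "(\<integral>x. (f n x - F x)\<^sup>2 \<partial>M) \<le> (1/4) ^ j"
      by (subst (asm) ennreal_le_iff) simp
  qed
  show thesis
  proof
    have "(\<lambda>x. f (r 0) x - F x) \<in> L2 M"
      using diffF[of 0 "r 0"] by (simp add: L2_iff)
    from L2_add[OF this f[of "r 0"], of "-1"] show "F \<in> L2 M" by simp
    show "(\<lambda>n. \<integral>x. (f n x - F x)\<^sup>2 \<partial>M) \<longlonglongrightarrow> 0"
    proof (rule LIMSEQ_I)
      fix e :: real assume "0 < e"
      then obtain j where j: "(1/4) ^ j < e"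
        using real_arch_pow_inv[of e "1/4"] by auto
      have "norm ((\<integral>x. (f n x - F x)\<^sup>2 \<partial>M) - 0) < e" if "n \<ge> r j" for n
        using diffF[OF that] j by simp
      then show "\<exists>N. \<forall>n\<ge>N. norm ((\<integral>x. (f n x - F x)\<^sup>2 \<partial>M) - 0) < e" by blast
    qed
  qed
qed

text \<open>The representing element minimises the energy \<open>B f f - 2 l f\<close>; the parallelogram identity
  makes every minimising sequence Cauchy.\<close>

lemma riesz_representation_minimization:
  fixes V :: "('x \<Rightarrow> real) set"
  assumes ne: "V \<noteq> {}"
    and comb: "\<And>f g c. f \<in> V \<Longrightarrow> g \<in> V \<Longrightarrow> (\<lambda>x. c * f x + g x) \<in> V"
    and B_lin: "\<And>f g h c. f \<in> V \<Longrightarrow> g \<in> V \<Longrightarrow> h \<in> V \<Longrightarrow> B (\<lambda>x. c * f x + g x) h = c * B f h + B g h"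
    and B_sym: "\<And>f g. B f g = B g f"
    and B_nonneg: "\<And>f. f \<in> V \<Longrightarrow> 0 \<le> B f f"
    and l_lin: "\<And>f g c. f \<in> V \<Longrightarrow> g \<in> V \<Longrightarrow> l (\<lambda>x. c * f x + g x) = c * l f + l g"
    and C: "0 \<le> C"
    and l_bound: "\<And>f. f \<in> V \<Longrightarrow> (l f)\<^sup>2 \<le> C * B f f"
    and complete: "\<And>u. (\<And>n :: nat. u n \<in> V) \<Longrightarrow>
      (\<And>e. 0 < e \<Longrightarrow> \<exists>N. \<forall>m\<ge>N. \<forall>n\<ge>N. B (\<lambda>x. -1 * u n x + u m x) (\<lambda>x. -1 * u n x + u m x) < e) \<Longrightarrow>
      \<exists>v\<in>V. (\<lambda>n. B (\<lambda>x. -1 * v x + u n x) (\<lambda>x. -1 * v x + u n x)) \<longlonglongrightarrow> 0"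
  shows "\<exists>v\<in>V. \<forall>w\<in>V. B v w = l w"
proof -
  define J where "J f = B f f - 2 * l f" for f
  have B_exp: "B (\<lambda>x. c * f x + g x) (\<lambda>x. c * f x + g x) = c\<^sup>2 * B f f + 2 * c * B f g + B g g"
    if "f \<in> V" "g \<in> V" for f g c
  proof -
    define h where "h = (\<lambda>x. c * f x + g x)"
    have h: "h \<in> V" unfolding h_def using comb[OF that] .
    have "B h k = c * B f k + B g k" if "k \<in> V" for k
      unfolding h_def using B_lin \<open>f \<in> V\<close> \<open>g \<in> V\<close> that .
    from this[OF h] this[OF that(1)] this[OF that(2)]
    show ?thesis
      using B_sym[of f h] B_sym[of g h] B_sym[of g f]
      unfolding h_def[symmetric] by (simp add: power2_eq_square algebra_simps)
  qed
  have J_exp: "J (\<lambda>x. c * f x + g x) = J g + 2 * c * (B f g - l f) + c\<^sup>2 * B f f"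
    if "f \<in> V" "g \<in> V" for f g c
    unfolding J_def B_exp[OF that] l_lin[OF that] by (simp add: algebra_simps)
  have CS: "(B f g)\<^sup>2 \<le> B f f * B g g" if "f \<in> V" "g \<in> V" for f g
    using B_nonneg[OF that(1)] B_nonneg[OF comb[OF that]] B_exp[OF that]
    by (intro nonneg_quadratic_discriminant) simp_all
  have J_bound: "- C \<le> J f" if "f \<in> V" for f
  proof -
    \<comment> \<open>Boundedness gives 4 * (l f)^2 <= 4 * C * B f f, and the right-hand side is at
      most the square of the sum.\<close>
    have "(2 * l f)\<^sup>2 \<le> (B f f + C)\<^sup>2"
      using l_bound[OF that] sum_squares_bound[of "B f f" C]
      by (simp add: power2_eq_square algebra_simps)
    then have "\<bar>2 * l f\<bar> \<le> \<bar>B f f + C\<bar>"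
      by (simp only: abs_le_square_iff)
    then show ?thesis
      using B_nonneg[OF that] C by (simp add: J_def)
  qed
  define m where "m = Inf (J ` V)"
  have bdd: "bdd_below (J ` V)"
    using J_bound by (intro bdd_belowI[of _ "- C"]) auto
  have m_le: "m \<le> J f" if "f \<in> V" for f
    unfolding m_def using bdd that by (intro cInf_lower) auto
  have "\<exists>f\<in>V. J f < m + 1 / Suc n" for n :: nat
    using cInf_lessD[of "J ` V" "m + 1 / Suc n"] ne unfolding m_def by auto
  then obtain u where u: "\<And>n. u n \<in> V" "\<And>n. J (u n) < m + 1 / Suc n"
    by metis
  have parallelogram: "B (\<lambda>x. -1 * f x + g x) (\<lambda>x. -1 * f x + g x) \<le> 2 * (J f + J g - 2 * m)"
    if fg: "f \<in> V" "g \<in> V" for f g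
  proof -
    \<comment> \<open>Along the segment from f to g the functional \<open>J\<close> is a quadratic
      with leading coefficient \<open>B d d\<close>. Its value at the midpoint is at least
      \<open>m\<close>, which bounds that coefficient by the values at the two ends.\<close>
    define d where "d = (\<lambda>x. -1 * f x + g x)"
    have d: "d \<in> V" unfolding d_def using comb[OF fg] .
    have "(\<lambda>x. 1 * d x + f x) = g" by (auto simp: d_def)
    then have "J g = J f + 2 * (B d f - l d) + B d d"
      using J_exp[OF d fg(1), of 1] by simp
    moreover have "m \<le> J f + (B d f - l d) + B d d / 4"
      using m_le[OF comb[OF d fg(1), of "1/2"]] unfolding J_exp[OF d fg(1)]
      by (simp add: power2_eq_square)
    ultimately show ?thesis
      unfolding d_def[symmetric] by argo
  qed
  have "\<exists>v\<in>V. (\<lambda>n. B (\<lambda>x. -1 * v x + u n x) (\<lambda>x. -1 * v x + u n x)) \<longlonglongrightarrow> 0"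
  proof (rule complete[OF u(1)])
    fix e :: real assume e: "0 < e"
    \<comment> \<open>Both excesses over \<open>m\<close> are below 1 / (N + 1), and the
      parallelogram bound doubles their sum.\<close>
    obtain N :: nat where N: "1 / Suc N < e / 4"
      using e nat_approx_posE[of "e / 4"] by auto
    have "B (\<lambda>x. -1 * u n x + u k x) (\<lambda>x. -1 * u n x + u k x) < e" if "k \<ge> N" "n \<ge> N" for k n
    proof -
      have "1 / Suc k \<le> 1 / Suc N" "1 / Suc n \<le> 1 / Suc N"
        using that by (auto simp: field_simps)
      then show ?thesis
        using parallelogram[OF u(1)[of n] u(1)[of k]] u(2)[of n] u(2)[of k] N by argo
    qed
    then show "\<exists>N. \<forall>k\<ge>N. \<forall>n\<ge>N. B (\<lambda>x. -1 * u n x + u k x) (\<lambda>x. -1 * u n x + u k x) < e" by blast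
  qed
  then obtain v where v: "v \<in> V" "(\<lambda>n. B (\<lambda>x. -1 * v x + u n x) (\<lambda>x. -1 * v x + u n x)) \<longlonglongrightarrow> 0"
    by blast
  have "B v w = l w" if w: "w \<in> V" for w
  proof -
    let ?d = "\<lambda>n x. -1 * v x + u n x"
    have d: "?d n \<in> V" for n using comb[OF v(1) u(1)] .
    \<comment> \<open>By Cauchy-Schwarz, convergence in energy implies convergence of the pairings
      with a fixed \<open>w\<close>.\<close>
    have lim: "(\<lambda>n. B w (u n)) \<longlonglongrightarrow> B w v"
    proof -
      have "(\<lambda>n. B (?d n) w) \<longlonglongrightarrow> 0"
      proof (rule Lim_null_comparison[OF always_eventually])
        show "\<forall>n. norm (B (?d n) w) \<le> sqrt (B (?d n) (?d n) * B w w)"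
          using CS[OF d w] by (auto intro: real_le_rsqrt)
        show "(\<lambda>n. sqrt (B (?d n) (?d n) * B w w)) \<longlonglongrightarrow> 0"
          using tendsto_real_sqrt[OF tendsto_mult[OF v(2) tendsto_const[of "B w w"]]] by simp
      qed
      then have "(\<lambda>n. B (?d n) w + B v w) \<longlonglongrightarrow> 0 + B v w"
        by (intro tendsto_add tendsto_const)
      moreover have "B (?d n) w + B v w = B w (u n)" for n
        using B_lin[OF v(1) u(1) w, of "-1" n] by (simp add: B_sym)
      ultimately show ?thesis by (simp add: B_sym[of v w])
    qed
    \<comment> \<open>Moving from \<open>u n\<close> in direction \<open>w\<close> cannot lower
      \<open>J\<close> below \<open>m\<close>, and \<open>J (u n)\<close> exceeds \<open>m\<close>
      by less than 1 / (n + 1). In the limit the quadratic in t has no constant term, so its linear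
      coefficient vanishes.\<close>
    have "0 \<le> t\<^sup>2 * B w w + 2 * t * (B w v - l w) + 0" for t
    proof (rule LIMSEQ_le_const)
      show "(\<lambda>n. t\<^sup>2 * B w w + 2 * t * (B w (u n) - l w) + 1 / Suc n)
          \<longlonglongrightarrow> t\<^sup>2 * B w w + 2 * t * (B w v - l w) + 0"
        by (intro tendsto_add tendsto_mult tendsto_diff tendsto_const lim LIMSEQ_Suc[OF lim_1_over_n])
      have "0 \<le> t\<^sup>2 * B w w + 2 * t * (B w (u n) - l w) + 1 / Suc n" for n
        using m_le[OF comb[OF w u(1)], of t n] J_exp[OF w u(1), of t n] u(2)[of n] by linarith
      then show "\<exists>N. \<forall>n\<ge>N. 0 \<le> t\<^sup>2 * B w w + 2 * t * (B w (u n) - l w) + 1 / Suc n" by blast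
    qed
    then have "(B w v - l w)\<^sup>2 \<le> B w w * 0"
      by (rule nonneg_quadratic_discriminant[OF B_nonneg[OF w]])
    then show ?thesis by (simp add: B_sym)
  qed
  with v(1) show ?thesis by blast
qed

section \<open>The energy form and the weak solution\<close>

context ac_curve_recip
begin

text \<open>The form on gradients is split into coordinates, so that the real-valued L2 lemmas apply
  to each direction.\<close>

definition energy :: "(real \<times> 'a \<Rightarrow> real) \<Rightarrow> (real \<times> 'a \<Rightarrow> real) \<Rightarrow> real" where
  "energy f g = (\<Sum>b\<in>Basis. \<integral>z. D b f z * D b g z \<partial>spacetime \<rho>)"

lemma grad_x_inner: "grad_x f z \<bullet> grad_x g z = (\<Sum>b\<in>Basis. D b f z * D b g z)"
  unfolding grad_x_def by (simp add: inner_sum_left inner_sum_right inner_Basis if_distrib mult.commute cong: if_cong)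

lemma
  assumes "f \<in> H1_x \<rho>" "g \<in> H1_x \<rho>"
  shows integrable_grad_x_inner: "integrable (spacetime \<rho>) (\<lambda>z. grad_x f z \<bullet> grad_x g z)"
    and integral_grad_x_inner: "(\<integral>z. grad_x f z \<bullet> grad_x g z \<partial>spacetime \<rho>) = energy f g"
proof -
  have i: "integrable (spacetime \<rho>) (\<lambda>z. D b f z * D b g z)" if "b \<in> Basis" for b
    using assms that by (intro L2_integrable_mult weak_derivative_L2)
  then show "integrable (spacetime \<rho>) (\<lambda>z. grad_x f z \<bullet> grad_x g z)"
    unfolding grad_x_inner by (intro Bochner_Integration.integrable_sum)
  show "(\<integral>z. grad_x f z \<bullet> grad_x g z \<partial>spacetime \<rho>) = energy f g"
    unfolding grad_x_inner energy_def using i by (intro Bochner_Integration.integral_sum)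
qed

lemma energy_nonneg: "0 \<le> energy f f"
  unfolding energy_def by (intro sum_nonneg integral_nonneg_AE) simp

lemma L2_norm_grad_x: "f \<in> H1_x \<rho> \<Longrightarrow> (L2_norm (spacetime \<rho>) (grad_x f))\<^sup>2 = energy f f"
  using integral_grad_x_inner[of f f] energy_nonneg[of f]
  by (simp add: L2_norm_def dot_square_norm[symmetric] power2_norm_eq_inner)

lemma L2_norm_power2: "(L2_norm M f)\<^sup>2 = (\<integral>x. (f x)\<^sup>2 \<partial>M)" for f :: "'x \<Rightarrow> real"
  by (simp add: L2_norm_def)

lemma energy_commute: "energy f g = energy g f"
  unfolding energy_def by (simp add: mult.commute)

lemma energy_add:
  assumes "f \<in> H1_x \<rho>" "g \<in> H1_x \<rho>" "h \<in> H1_x \<rho>"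
  shows "energy (\<lambda>z. c * f z + g z) h = c * energy f h + energy g h"
proof -
  have "(\<integral>z. D b (\<lambda>z. c * f z + g z) z * D b h z \<partial>spacetime \<rho>)
      = c * (\<integral>z. D b f z * D b h z \<partial>spacetime \<rho>) + (\<integral>z. D b g z * D b h z \<partial>spacetime \<rho>)"
    if b: "b \<in> Basis" for b
  proof -
    note [measurable] = weak_derivative_measurable[THEN measurable_spacetimeI, OF _ b]
    note i = L2_integrable_mult[OF weak_derivative_L2[OF assms(1) b] weak_derivative_L2[OF assms(3) b]]
      L2_integrable_mult[OF weak_derivative_L2[OF assms(2) b] weak_derivative_L2[OF assms(3) b]]
    have "(\<integral>z. D b (\<lambda>z. c * f z + g z) z * D b h z \<partial>spacetime \<rho>)
        = (\<integral>z. c * (D b f z * D b h z) + D b g z * D b h z \<partial>spacetime \<rho>)"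
    proof (rule integral_cong_AE)
      show "AE z in spacetime \<rho>. D b (\<lambda>z. c * f z + g z) z * D b h z
          = c * (D b f z * D b h z) + D b g z * D b h z"
        using weak_derivative_add[OF assms(1,2) b, of c] by eventually_elim (simp add: algebra_simps)
    qed (use assms H1_x_add[OF assms(1,2)] in measurable)
    then show ?thesis using i by simp
  qed
  then show ?thesis
    unfolding energy_def by (simp add: sum.distrib sum_distrib_left)
qed

lemma X_0_1_add:
  assumes "f \<in> X_0_1 \<rho>" "g \<in> X_0_1 \<rho>"
  shows "(\<lambda>z. c * f z + g z) \<in> X_0_1 \<rho>"
proof -
  have fg: "f \<in> H1_x \<rho>" "g \<in> H1_x \<rho>" using assms by (auto simp: X_0_1_iff)
  have "AE t in lborel. t \<in> {0..1} \<longrightarrow> (\<integral>x. f (t, x) \<partial>\<rho> t) = 0"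
    "AE t in lborel. t \<in> {0..1} \<longrightarrow> (\<integral>x. g (t, x) \<partial>\<rho> t) = 0"
    using assms by (auto simp: X_0_1_iff)
  then have "AE t in lborel. t \<in> {0..1} \<longrightarrow> (\<integral>x. c * f (t, x) + g (t, x) \<partial>\<rho> t) = 0"
    using AE_slice_integrable[OF st.L2_integrable[OF H1_x_L2[OF fg(1)]]]
      AE_slice_integrable[OF st.L2_integrable[OF H1_x_L2[OF fg(2)]]]
    by eventually_elim simp
  then show ?thesis
    using H1_x_add[OF fg] by (simp add: X_0_1_iff)
qed

lemma zero_X_0_1: "(\<lambda>_. 0) \<in> X_0_1 \<rho>"
proof -
  have 0: "(\<lambda>_. 0 :: real) \<in> L2 (spacetime \<rho>)"
    by (simp add: L2_iff)
  have "has_weak_derivative (\<lambda>_. 0) (\<lambda>_. 0) (0, b) (open_strip :: (real \<times> 'a) set)" for b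
    by (auto simp: has_weak_derivative_def locally_integrable_on_def set_integrable_def set_lebesgue_integral_def)
  with 0 have "(\<lambda>_. 0) \<in> H1_x \<rho>"
    by (intro H1_xI[of _ "\<lambda>_ _. 0"]) auto
  then show ?thesis by (simp add: X_0_1_iff)
qed

lemma X_0_1_complete:
  assumes PI: "partial_Poincare \<rho> K" and K: "0 < K" and u: "\<And>n :: nat. u n \<in> X_0_1 \<rho>"
    and Cauchy: "\<And>e. 0 < e \<Longrightarrow> \<exists>N. \<forall>m\<ge>N. \<forall>n\<ge>N.
      energy (\<lambda>z. -1 * u n z + u m z) (\<lambda>z. -1 * u n z + u m z) < e"
  shows "\<exists>v\<in>X_0_1 \<rho>. (\<lambda>n. energy (\<lambda>z. -1 * v z + u n z) (\<lambda>z. -1 * v z + u n z)) \<longlonglongrightarrow> 0"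
proof -
  have uH: "u n \<in> H1_x \<rho>" for n using u by (simp add: X_0_1_iff)
  let ?d = "\<lambda>m n z. -1 * u n z + u m z"
  have dX: "?d m n \<in> X_0_1 \<rho>" for m n using X_0_1_add[OF u u] .
  have dH: "?d m n \<in> H1_x \<rho>" for m n using dX by (simp add: X_0_1_iff)
  have le0: "(\<integral>z. (u m z - u n z)\<^sup>2 \<partial>spacetime \<rho>) \<le> K * energy (?d m n) (?d m n)" for m n
    using PI[unfolded partial_Poincare_def, rule_format, OF dX[of n m]] L2_norm_grad_x[OF dH]
    by (simp add: L2_norm_power2)
  have leb: "(\<integral>z. (D b (u m) z - D b (u n) z)\<^sup>2 \<partial>spacetime \<rho>) \<le> energy (?d m n) (?d m n)"
    if b: "b \<in> Basis" for b m n
  proof -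
    note [measurable] = weak_derivative_measurable[THEN measurable_spacetimeI, OF _ b]
    have "(\<integral>z. (D b (u m) z - D b (u n) z)\<^sup>2 \<partial>spacetime \<rho>) = (\<integral>z. D b (?d m n) z * D b (?d m n) z \<partial>spacetime \<rho>)"
    proof (rule integral_cong_AE)
      show "AE z in spacetime \<rho>. (D b (u m) z - D b (u n) z)\<^sup>2 = D b (?d m n) z * D b (?d m n) z"
        using weak_derivative_add[OF uH[of n] uH[of m] b, of "-1"]
        by eventually_elim (simp add: power2_eq_square)
    qed (use uH dH in measurable)
    also have "\<dots> \<le> energy (?d m n) (?d m n)"
      unfolding energy_def by (rule member_le_sum[OF b]) (auto intro: integral_nonneg_AE)
    finally show ?thesis .
  qed
  have "\<exists>F. F \<in> L2 (spacetime \<rho>) \<and> (\<lambda>n. \<integral>z. (u n z - F z)\<^sup>2 \<partial>spacetime \<rho>) \<longlonglongrightarrow> 0"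
  proof (rule st.L2_complete[of u])
    show "u n \<in> L2 (spacetime \<rho>)" for n using H1_x_L2[OF uH] .
    fix e :: real assume "0 < e"
    then obtain N where N: "\<forall>m\<ge>N. \<forall>n\<ge>N. energy (?d m n) (?d m n) < e / K"
      using Cauchy[of "e / K"] K by auto
    have "(\<integral>z. (u m z - u n z)\<^sup>2 \<partial>spacetime \<rho>) < e" if "m \<ge> N" "n \<ge> N" for m n
    proof -
      have "energy (?d m n) (?d m n) < e / K" using N that by blast
      then have "K * energy (?d m n) (?d m n) < e" using K by (simp add: pos_less_divide_eq mult.commute)
      then show ?thesis using le0[of m n] by linarith
    qed
    then show "\<exists>N. \<forall>m\<ge>N. \<forall>n\<ge>N. (\<integral>z. (u m z - u n z)\<^sup>2 \<partial>spacetime \<rho>) < e"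
      by (intro exI[of _ N] allI impI)
  qed blast
  then obtain F where F: "F \<in> L2 (spacetime \<rho>)" "(\<lambda>n. \<integral>z. (u n z - F z)\<^sup>2 \<partial>spacetime \<rho>) \<longlonglongrightarrow> 0"
    by blast
  have exG: "\<exists>G. G \<in> L2 (spacetime \<rho>) \<and> (\<lambda>n. \<integral>z. (D b (u n) z - G z)\<^sup>2 \<partial>spacetime \<rho>) \<longlonglongrightarrow> 0"
    if b: "b \<in> Basis" for b
  proof (rule st.L2_complete[of "\<lambda>n. D b (u n)"])
    show "D b (u n) \<in> L2 (spacetime \<rho>)" for n using weak_derivative_L2[OF uH b] .
    fix e :: real assume "0 < e"
    then obtain N where N: "\<forall>m\<ge>N. \<forall>n\<ge>N. energy (?d m n) (?d m n) < e"
      using Cauchy by blast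
    have "(\<integral>z. (D b (u m) z - D b (u n) z)\<^sup>2 \<partial>spacetime \<rho>) < e" if "m \<ge> N" "n \<ge> N" for m n
      using leb[OF b] N[rule_format, OF that] by (rule le_less_trans)
    then show "\<exists>N. \<forall>m\<ge>N. \<forall>n\<ge>N. (\<integral>z. (D b (u m) z - D b (u n) z)\<^sup>2 \<partial>spacetime \<rho>) < e"
      by (intro exI[of _ N] allI impI)
  qed blast
  have "\<exists>G. \<forall>b\<in>Basis. G b \<in> L2 (spacetime \<rho>) \<and>
      (\<lambda>n. \<integral>z. (D b (u n) z - G b z)\<^sup>2 \<partial>spacetime \<rho>) \<longlonglongrightarrow> 0"
    by (rule bchoice) (intro ballI exG)
  then obtain G where G: "\<And>b. b \<in> Basis \<Longrightarrow> G b \<in> L2 (spacetime \<rho>)"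
    "\<And>b. b \<in> Basis \<Longrightarrow> (\<lambda>n. \<integral>z. (D b (u n) z - G b z)\<^sup>2 \<partial>spacetime \<rho>) \<longlonglongrightarrow> 0"
    by blast
  have wd: "has_weak_derivative F (G b) (0, b) open_strip" if b: "b \<in> Basis" for b
    by (rule has_weak_derivative_L2_limit[OF H1_x_L2[OF uH] weak_derivative_L2[OF uH b]
        has_weak_derivative_weak_derivative[OF uH b] b F(1) G(1)[OF b] F(2) G(2)[OF b]])
  have FH: "F \<in> H1_x \<rho>"
    using F(1) G(1) wd by (intro H1_xI[of F G]) auto
  \<comment> \<open>The slices of \<open>u n\<close> have mean zero, so the mean of F at time t is
    at most the L1 distance of the slices. Integrated over t this is at most the L2 distance of
    \<open>u n\<close> and \<open>F\<close>, since the total mass is \<open>1\<close>.\<close>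
  have "AE t in lborel. t \<in> {0..1} \<longrightarrow> (\<integral>x. F (t, x) \<partial>\<rho> t) = 0"
  proof -
    let ?m = "\<lambda>t. \<bar>\<integral>x. F (t, x) \<partial>\<rho> t\<bar>"
    have mi: "set_integrable lborel {0..1} ?m"
      using set_integrable_slice_integral[OF st.L2_integrable[OF F(1)]] by (rule set_integrable_abs)
    have le: "(LBINT t:{0..1}. ?m t) \<le> sqrt (\<integral>z. (u n z - F z)\<^sup>2 \<partial>spacetime \<rho>)" for n
    proof -
      have d: "(\<lambda>z. u n z - F z) \<in> L2 (spacetime \<rho>)"
        using L2_add[OF F(1) H1_x_L2[OF uH[of n]], of "-1"] by simp
      have a: "integrable (spacetime \<rho>) (\<lambda>z. \<bar>u n z - F z\<bar>)"
        using st.L2_integrable[OF d] by simp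
      have "(LBINT t:{0..1}. ?m t) \<le> (LBINT t:{0..1}. (\<integral>x. \<bar>u n (t, x) - F (t, x)\<bar> \<partial>\<rho> t))"
      proof (rule set_integral_mono_AE[OF mi set_integrable_slice_integral[OF a]])
        have "AE t in lborel. t \<in> {0..1} \<longrightarrow> (\<integral>x. u n (t, x) \<partial>\<rho> t) = 0"
          using u by (simp add: X_0_1_iff)
        then show "AE t\<in>{0..1} in lborel. ?m t \<le> (\<integral>x. \<bar>u n (t, x) - F (t, x)\<bar> \<partial>\<rho> t)"
          using AE_slice_integrable[OF st.L2_integrable[OF F(1)]]
            AE_slice_integrable[OF st.L2_integrable[OF H1_x_L2[OF uH[of n]]]]
        proof eventually_elim
          case (elim t)
          show ?case
          proof
            assume t: "t \<in> {0..1}"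
            then have "?m t = \<bar>\<integral>x. u n (t, x) - F (t, x) \<partial>\<rho> t\<bar>"
              using elim by simp
            also have "\<dots> \<le> (\<integral>x. \<bar>u n (t, x) - F (t, x)\<bar> \<partial>\<rho> t)"
              by (rule integral_abs_bound)
            finally show "?m t \<le> (\<integral>x. \<bar>u n (t, x) - F (t, x)\<bar> \<partial>\<rho> t)" .
          qed
        qed
      qed
      also have "\<dots> = (\<integral>z. \<bar>u n z - F z\<bar> \<partial>spacetime \<rho>)"
        using integral_spacetime[OF a] by simp
      also have "\<dots> \<le> sqrt (\<integral>z. (u n z - F z)\<^sup>2 \<partial>spacetime \<rho>)"
      proof (rule real_le_rsqrt)
        have "(\<lambda>z. \<bar>u n z - F z\<bar>) \<in> L2 (spacetime \<rho>)" "(\<lambda>_. 1 :: real) \<in> L2 (spacetime \<rho>)"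
          using d by (auto simp: L2_iff)
        from L2_Cauchy_Schwarz[OF this]
        show "(\<integral>z. \<bar>u n z - F z\<bar> \<partial>spacetime \<rho>)\<^sup>2 \<le> (\<integral>z. (u n z - F z)\<^sup>2 \<partial>spacetime \<rho>)"
          by (simp add: st.prob_space)
      qed
      finally show ?thesis .
    qed
    have "(\<lambda>n. sqrt (\<integral>z. (u n z - F z)\<^sup>2 \<partial>spacetime \<rho>)) \<longlonglongrightarrow> 0"
      using tendsto_real_sqrt[OF F(2)] by simp
    then have "(LBINT t:{0..1}. ?m t) \<le> 0"
      by (rule LIMSEQ_le_const) (use le in blast)
    moreover have "0 \<le> (LBINT t:{0..1}. ?m t)"
      unfolding set_lebesgue_integral_def by (intro integral_nonneg_AE) auto
    ultimately have "(LINT t|lborel. indicator {0..1} t *\<^sub>R ?m t) = 0"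
      unfolding set_lebesgue_integral_def by linarith
    then have "AE t in lborel. indicator {0..1} t *\<^sub>R ?m t = 0"
      using mi unfolding set_integrable_def by (subst (asm) integral_nonneg_eq_0_iff_AE) auto
    then show ?thesis
      by eventually_elim (auto split: split_indicator_asm)
  qed
  with FH have FX: "F \<in> X_0_1 \<rho>" by (simp add: X_0_1_iff)
  \<comment> \<open>Uniqueness of weak derivatives identifies the chosen derivative of
    \<open>F\<close> with the L2 limit \<open>G b\<close> almost everywhere, which turns convergence
    of derivatives into convergence in energy.\<close>
  have eq: "energy (\<lambda>z. -1 * F z + u n z) (\<lambda>z. -1 * F z + u n z)
      = (\<Sum>b\<in>Basis. \<integral>z. (D b (u n) z - G b z)\<^sup>2 \<partial>spacetime \<rho>)" for n
    unfolding energy_def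
  proof (rule sum.cong[OF refl])
    fix b :: 'a assume b: "b \<in> Basis"
    note [measurable] = weak_derivative_measurable[THEN measurable_spacetimeI, OF _ b]
    have [measurable]: "G b \<in> borel_measurable (spacetime \<rho>)"
      using G(1)[OF b] by (simp add: L2_iff)
    show "(\<integral>z. D b (\<lambda>z. -1 * F z + u n z) z * D b (\<lambda>z. -1 * F z + u n z) z \<partial>spacetime \<rho>)
        = (\<integral>z. (D b (u n) z - G b z)\<^sup>2 \<partial>spacetime \<rho>)"
    proof (rule integral_cong_AE)
      show "AE z in spacetime \<rho>. D b (\<lambda>z. -1 * F z + u n z) z * D b (\<lambda>z. -1 * F z + u n z) z
          = (D b (u n) z - G b z)\<^sup>2"
        using weak_derivative_add[OF FH uH[of n] b, of "-1"] weak_derivative_AE[OF FH b wd[OF b]]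
        by eventually_elim (simp add: power2_eq_square)
    qed (use uH FH H1_x_add[OF FH uH] in measurable)
  qed
  have "(\<lambda>n. \<Sum>b\<in>Basis. \<integral>z. (D b (u n) z - G b z)\<^sup>2 \<partial>spacetime \<rho>) \<longlonglongrightarrow> (\<Sum>b\<in>(Basis :: 'a set). 0)"
    by (intro tendsto_sum G(2))
  then show ?thesis
    using FX unfolding eq[symmetric] by auto
qed

text \<open>Both iterated integrals have integrable integrands in space-time, as products of L2
  functions, and so turn into the bilinear form and the functional of the abstract theorem.\<close>

lemma weak_solution_iff:
  assumes a: "(\<lambda>(t, x). \<alpha> (t, x) - slice_mean \<rho> \<alpha> t) \<in> L2 (spacetime \<rho>)" and s: "s \<in> X_0_1 \<rho>"
  shows "weak_solution \<rho> \<alpha> s \<longleftrightarrow> (\<forall>\<psi>\<in>X_0_1 \<rho>. energy s \<psi> =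
    (\<integral>z. \<psi> z * (case z of (t, x) \<Rightarrow> \<alpha> (t, x) - slice_mean \<rho> \<alpha> t) \<partial>spacetime \<rho>))"
proof -
  have "(LBINT t:{0..1}. (\<integral>x. grad_x s (t, x) \<bullet> grad_x \<psi> (t, x) \<partial>\<rho> t)) = energy s \<psi>"
    if "\<psi> \<in> X_0_1 \<rho>" for \<psi>
    using integral_spacetime[OF integrable_grad_x_inner] integral_grad_x_inner s that
    by (simp add: X_0_1_iff)
  moreover have "(LBINT t:{0..1}. (\<integral>x. \<psi> (t, x) * (\<alpha> (t, x) - slice_mean \<rho> \<alpha> t) \<partial>\<rho> t))
      = (\<integral>z. \<psi> z * (case z of (t, x) \<Rightarrow> \<alpha> (t, x) - slice_mean \<rho> \<alpha> t) \<partial>spacetime \<rho>)"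
    if "\<psi> \<in> X_0_1 \<rho>" for \<psi>
    using integral_spacetime[OF L2_integrable_mult[OF H1_x_L2 a]] that by (simp add: X_0_1_iff)
  ultimately show ?thesis
    unfolding weak_solution_def by simp
qed

lemma weak_solution_exists_unique:
  assumes K: "0 < K" and PI: "partial_Poincare \<rho> K"
    and a: "(\<lambda>(t, x). \<alpha> (t, x) - slice_mean \<rho> \<alpha> t) \<in> L2 (spacetime \<rho>)"
  shows "\<exists>s\<in>X_0_1 \<rho>. weak_solution \<rho> \<alpha> s \<and>
    (\<forall>s'\<in>X_0_1 \<rho>. weak_solution \<rho> \<alpha> s' \<longrightarrow> (AE z in spacetime \<rho>. s' z = s z))"
proof -
  let ?a = "\<lambda>(t, x). \<alpha> (t, x) - slice_mean \<rho> \<alpha> t"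
  define l where "l \<psi> = (\<integral>z. \<psi> z * ?a z \<partial>spacetime \<rho>)" for \<psi>
  define A where "A = (\<integral>z. (?a z)\<^sup>2 \<partial>spacetime \<rho>)"
  have XH: "f \<in> H1_x \<rho>" "f \<in> L2 (spacetime \<rho>)" if "f \<in> X_0_1 \<rho>" for f
    using that H1_x_L2 by (auto simp: X_0_1_iff)
  have P: "(\<integral>z. (f z)\<^sup>2 \<partial>spacetime \<rho>) \<le> K * energy f f" if "f \<in> X_0_1 \<rho>" for f
    using PI[unfolded partial_Poincare_def, rule_format, OF that] L2_norm_grad_x[OF XH(1)[OF that]]
    by (simp add: L2_norm_power2)
  have "\<exists>s\<in>X_0_1 \<rho>. \<forall>w\<in>X_0_1 \<rho>. energy s w = l w"
  proof (rule riesz_representation_minimization)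
    show "X_0_1 \<rho> \<noteq> {}" using zero_X_0_1 by blast
    show "(\<lambda>z. c * f z + g z) \<in> X_0_1 \<rho>" if "f \<in> X_0_1 \<rho>" "g \<in> X_0_1 \<rho>" for f g c
      using X_0_1_add[OF that] .
    show "energy (\<lambda>z. c * f z + g z) h = c * energy f h + energy g h"
      if "f \<in> X_0_1 \<rho>" "g \<in> X_0_1 \<rho>" "h \<in> X_0_1 \<rho>" for f g h c
      using energy_add XH(1) that by blast
    show "energy f g = energy g f" for f g by (rule energy_commute)
    show "0 \<le> energy f f" for f by (rule energy_nonneg)
    show "l (\<lambda>z. c * f z + g z) = c * l f + l g" if "f \<in> X_0_1 \<rho>" "g \<in> X_0_1 \<rho>" for f g c
      using L2_integrable_mult[OF XH(2)[OF that(1)] a] L2_integrable_mult[OF XH(2)[OF that(2)] a]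
      unfolding l_def by (simp add: distrib_right mult.assoc)
    \<comment> \<open>The constant combines Cauchy-Schwarz in L2, which contributes
      \<open>A\<close>, with the Poincare inequality, which contributes \<open>K\<close>.\<close>
    show "0 \<le> A * K" using K by (simp add: A_def)
    show "(l f)\<^sup>2 \<le> (A * K) * energy f f" if f: "f \<in> X_0_1 \<rho>" for f
    proof -
      have "(l f)\<^sup>2 \<le> (\<integral>z. (f z)\<^sup>2 \<partial>spacetime \<rho>) * A"
        unfolding l_def A_def by (rule L2_Cauchy_Schwarz[OF XH(2)[OF f] a])
      also have "\<dots> \<le> (K * energy f f) * A"
        by (rule mult_right_mono[OF P[OF f]]) (simp add: A_def)
      finally show ?thesis by (simp add: mult_ac)
    qed
    show "\<exists>v\<in>X_0_1 \<rho>. (\<lambda>n. energy (\<lambda>z. -1 * v z + u n z) (\<lambda>z. -1 * v z + u n z)) \<longlonglongrightarrow> 0"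
      if "\<And>n :: nat. u n \<in> X_0_1 \<rho>" "\<And>e. 0 < e \<Longrightarrow> \<exists>N. \<forall>m\<ge>N. \<forall>n\<ge>N.
        energy (\<lambda>z. -1 * u n z + u m z) (\<lambda>z. -1 * u n z + u m z) < e" for u
      by (rule X_0_1_complete[OF PI K that])
  qed
  then obtain s where s: "s \<in> X_0_1 \<rho>" "\<forall>w\<in>X_0_1 \<rho>. energy s w = l w" by blast
  show ?thesis
  proof (intro bexI[OF _ s(1)] conjI ballI impI)
    show "weak_solution \<rho> \<alpha> s"
      using s(2) unfolding weak_solution_iff[OF a s(1)] l_def by blast
    fix s' assume s': "s' \<in> X_0_1 \<rho>" "weak_solution \<rho> \<alpha> s'"
    let ?d = "\<lambda>z. -1 * s z + s' z"
    have d: "?d \<in> X_0_1 \<rho>" using X_0_1_add[OF s(1) s'(1)] .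
    have "energy s' ?d = l ?d"
      using s'(2) d unfolding weak_solution_iff[OF a s'(1)] l_def by blast
    \<comment> \<open>Both solutions represent the same functional, so it cancels when their
      difference is tested with itself. The Poincare inequality then makes the L2 norm of the
      difference vanish.\<close>
    then have "energy ?d ?d = 0"
      using energy_add[OF XH(1)[OF s(1)] XH(1)[OF s'(1)] XH(1)[OF d], of "-1"] s(2) d by simp
    then have "(\<integral>z. (?d z)\<^sup>2 \<partial>spacetime \<rho>) \<le> 0"
      using P[OF d] by simp
    then have "(\<integral>z. (?d z)\<^sup>2 \<partial>spacetime \<rho>) = 0"
      by (simp add: order_antisym)
    then have "AE z in spacetime \<rho>. (?d z)\<^sup>2 = 0"
      using XH(2)[OF d] by (subst (asm) integral_nonneg_eq_0_iff_AE) (auto simp: L2_iff)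
    then show "AE z in spacetime \<rho>. s' z = s z"
      by eventually_elim simp
  qed
qed

end

theorem theorem1:
  fixes \<rho> :: "real \<Rightarrow> 'a::euclidean_space measure"
    and K :: real
    and \<alpha> :: "real \<times> 'a \<Rightarrow> real"
  assumes "\<And>t. t \<in> {0..1} \<Longrightarrow> \<rho> t \<in> P_ac"
    and "weakly_continuous_curve \<rho>"
    and "K > 0"
    and "partial_Poincare \<rho> K"
    and "reciprocal_density_L1_loc \<rho>"
    and "\<alpha> \<in> borel_measurable (restrict_space borel ({0..1} \<times> UNIV))"
    and "\<And>t. t \<in> {0..1} \<Longrightarrow> (\<lambda>x. \<alpha> (t, x)) \<in> L2 (\<rho> t)"
    and "(\<lambda>(t, x). \<alpha> (t, x) - slice_mean \<rho> \<alpha> t) \<in> L2 (spacetime \<rho>)"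
  shows "\<exists>s\<in>X_0_1 \<rho>. weak_solution \<rho> \<alpha> s \<and>
    (\<forall>s'\<in>X_0_1 \<rho>. weak_solution \<rho> \<alpha> s' \<longrightarrow> (AE z in spacetime \<rho>. s' z = s z))"
proof -
  interpret ac_curve_recip \<rho>
    using assms(1,2,5) by unfold_locales
  show ?thesis
    using assms(3,4,8) by (rule weak_solution_exists_unique)
qed

end
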